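(* Let $n=3$ and let $\Sigma_\circ=(\mathbf x,\mathbf p,B)$ be a seed in $\mathcal F$ whose exchange matrix $B$ is skew-symmetrizable. Then the cluster algebra $\mathcal A(\Sigma_\circ)$ is finitely generated over $\mathbb{ZP}$ if and only if it has an acyclic seed, i.e. some seed mutation equivalent to $\Sigma_\circ$ is acyclic.
   Context: Let $\mathbb P$ be a torsion-free abelian group, written multiplicatively, $\mathbb{ZP}$ its integer group ring, $n\ge 1$ (the rank), and $\mathcal F$ a field isomorphic to the field of rational functions in $n$ independent variables over the fraction field of $\mathbb{ZP}$. A seed in $\mathcal F$ is a triple $\Sigma=(\mathbf x,\mathbf p,B)$ where: $\mathbf x=\{x_1,\dots,x_n\}$ (the cluster; its elements are the cluster variables) is a transcendence basis of $\mathcal F$ over the fraction field of $\mathbb{ZP}$ (so that $\mathcal F$ is the field of rational functions in $\mathbf x$); $\mathbf p=(p_1^\pm,\dots,p_n^\pm)$ is a $2n$-tuple of elements of $\mathbb P$; $B=(b_{ij})$ is an $n\times n$ integer matrix (the exchange matrix) which is sign-skew-symmetric, i.e. for all $i,j$ either $b_{ij}=b_{ji}=0$ or $b_{ij}b_{ji}<0$. Seeds differing by a simultaneous relabeling are identified. $B$ is skew-symmetrizable if there are positive numbers $d_1,\dots,d_n$ with $d_ib_{ij}=-d_jb_{ji}$ for all $i,j$; this property is preserved by the matrix mutations below. A seed is acyclic if the directed graph with vertices $1,\dots,n$ and edges $(i,j)$ for $b_{ij}>0$ has no oriented cycles. For $j\in\{1,\dots,n\}$ define $x_j'\in\mathcal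 F$ by $x_jx_j'=p_j^+\prod_{b_{ij}>0}x_i^{b_{ij}}+p_j^-\prod_{b_{ij}<0}x_i^{-b_{ij}}$ and let $\mathbf x_j=(\mathbf x-\{x_j\})\cup\{x_j'\}$. Matrix mutation in direction $k$: $\mu_k(B)=(b'_{ij})$ with $b'_{ij}=-b_{ij}$ if $i=k$ or $j=k$, and $b'_{ij}=b_{ij}+\frac{|b_{ik}|b_{kj}+b_{ik}|b_{kj}|}{2}$ otherwise. A seed $\Sigma'=(\mathbf x',\mathbf p',B')$ is obtained from $\Sigma$ by a seed mutation in direction $k$ if $\mathbf x'=\mathbf x_k$, $B'=\mu_k(B)$, $p_k'^{\pm}=p_k^{\mp}$, and for $i\ne k$: $p_i'^+/p_i'^-=(p_k^+)^{b_{ki}}p_i^+/p_i^-$ if $b_{ki}\ge0$ and $p_i'^+/p_i'^-=(p_k^-)^{b_{ki}}p_i^+/p_i^-$ if $b_{ki}\le 0$. Mutation equivalence of seeds is the equivalence relation generated by seed mutations. The cluster algebra $\mathcal A(\Sigma_\circ)$ is the $\mathbb{ZP}$-subalgebra of $\mathcal F$ generated by all cluster variables from all seeds mutation equivalent to $\Sigma_\circ$. *)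

theory Defs
  imports "HOL-Analysis.Finite_Cartesian_Product" "HOL-Library.Poly_Mapping"
begin

section \<open>The coefficient group and its group ring\<close>

text \<open>
  The abelian group $P$ is a type \<open>'p\<close> of class \<^class>\<open>ab_group_add\<close>, hence written additively.
  Its integer group ring is the convolution ring \<open>'p \<Rightarrow>\<^sub>0 int\<close>, in which
  \<open>Poly_Mapping.single p 1\<close> is the element $p$ of $P$.
\<close>

text \<open>The integer multiple $k p$; in multiplicative notation, the power $p^k$.\<close>

definition int_multiple :: "int \<Rightarrow> 'p::ab_group_add \<Rightarrow> 'p" where
  "int_multiple k p =
     (if k \<ge> 0 then (((+) p) ^^ nat k) 0 else - (((+) p) ^^ nat (- k)) 0)"

lemma int_multiple_0 [simp]: "int_multiple 0 p = 0"
  by (simp add: int_multiple_def)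

lemma int_multiple_1 [simp]: "int_multiple 1 p = p"
  by (simp add: int_multiple_def)

lemma int_multiple_Suc: "int_multiple (k + 1) p = p + int_multiple k p"
proof (cases "k \<ge> 0")
  case True
  then have "nat (k + 1) = Suc (nat k)" by simp
  with True show ?thesis by (simp add: int_multiple_def)
next
  case False
  define n where "n = nat (- k - 1)"
  have k: "k = - int (Suc n)" using False by (simp add: n_def)
  show ?thesis by (cases n) (simp_all add: k int_multiple_def nat_add_distrib)
qed

lemma int_multiple_add: "int_multiple (k + l) p = int_multiple k p + int_multiple l p"
proof (induction k rule: int_induct[where k = 0])
  case base
  then show ?case by simp
next
  case (step1 i)
  then show ?case
    using int_multiple_Suc[of "i + l" p] int_multiple_Suc[of i p]
    by (simp add: algebra_simps)
next
  case (step2 i)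
  then show ?case
    using int_multiple_Suc[of "i - 1 + l" p] int_multiple_Suc[of "i - 1" p]
    by (simp add: algebra_simps)
qed

definition torsion_free :: "'p::ab_group_add itself \<Rightarrow> bool" where
  "torsion_free _ \<longleftrightarrow> (\<forall>(k::int) (p::'p). k \<noteq> 0 \<longrightarrow> int_multiple k p = 0 \<longrightarrow> p = 0)"

definition group_ring_embedding :: "(('p::ab_group_add \<Rightarrow>\<^sub>0 int) \<Rightarrow> 'f::field) \<Rightarrow> bool" where
  "group_ring_embedding \<iota> \<longleftrightarrow>
     \<iota> 1 = 1 \<and> (\<forall>a b. \<iota> (a + b) = \<iota> a + \<iota> b) \<and> (\<forall>a b. \<iota> (a * b) = \<iota> a * \<iota> b) \<and> inj \<iota>"

definition group_elt :: "(('p::ab_group_add \<Rightarrow>\<^sub>0 int) \<Rightarrow> 'f::field) \<Rightarrow> 'p \<Rightarrow> 'f" where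
  "group_elt \<iota> p = \<iota> (Poly_Mapping.single p 1)"

text \<open>The fraction field of the group ring, inside the ambient field \<open>'f\<close>.\<close>

definition coeff_field :: "(('p::ab_group_add \<Rightarrow>\<^sub>0 int) \<Rightarrow> 'f::field) \<Rightarrow> 'f set" where
  "coeff_field \<iota> = {\<iota> a / \<iota> b | a b. b \<noteq> 0}"

section \<open>Rational function fields\<close>

text \<open>Polynomials over \<open>'f\<close> in variables indexed by \<open>'n\<close> have type
  \<open>('n \<Rightarrow>\<^sub>0 nat) \<Rightarrow>\<^sub>0 'f\<close>.\<close>

definition poly_eval :: "('n::finite \<Rightarrow> 'f::field) \<Rightarrow> (('n \<Rightarrow>\<^sub>0 nat) \<Rightarrow>\<^sub>0 'f) \<Rightarrow> 'f" where
  "poly_eval x q =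
     (\<Sum>m\<in>Poly_Mapping.keys q.
        Poly_Mapping.lookup q m * (\<Prod>i\<in>UNIV. x i ^ Poly_Mapping.lookup m i))"

definition algebraically_independent :: "'f::field set \<Rightarrow> ('n::finite \<Rightarrow> 'f) \<Rightarrow> bool" where
  "algebraically_independent K x \<longleftrightarrow>
     (\<forall>q. (\<forall>m. Poly_Mapping.lookup q m \<in> K) \<and> poly_eval x q = 0 \<longrightarrow> q = 0)"

definition is_subfield :: "'f::field set \<Rightarrow> bool" where
  "is_subfield L \<longleftrightarrow>
     0 \<in> L \<and> 1 \<in> L \<and>
     (\<forall>a\<in>L. \<forall>b\<in>L. a + b \<in> L \<and> a - b \<in> L \<and> a * b \<in> L) \<and> (\<forall>a\<in>L. inverse a \<in> L)"

text \<open>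
  The family \<open>x\<close> is a transcendence basis of \<open>'f\<close> over the coefficient field such that moreover
  \<open>'f\<close> is the field of rational functions in \<open>x\<close>.
\<close>

definition free_generators ::
    "(('p::ab_group_add \<Rightarrow>\<^sub>0 int) \<Rightarrow> 'f::field) \<Rightarrow> ('n::finite \<Rightarrow> 'f) \<Rightarrow> bool" where
  "free_generators \<iota> x \<longleftrightarrow>
     algebraically_independent (coeff_field \<iota>) x \<and>
     is_subfield hull (coeff_field \<iota> \<union> range x) = UNIV"

text \<open>
  The type \<open>'f\<close> is (isomorphic to) the field of rational functions in \<open>CARD('n)\<close> independent
  variables over the fraction field of the group ring, the latter being embedded by \<open>\<iota>\<close>.
\<close>

definition ambient_field ::
    "'n::finite itself \<Rightarrow> (('p::ab_group_add \<Rightarrow>\<^sub>0 int) \<Rightarrow> 'f::field) \<Rightarrow> bool" where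
  "ambient_field _ \<iota> \<longleftrightarrow> group_ring_embedding \<iota> \<and> (\<exists>z :: 'n \<Rightarrow> 'f. free_generators \<iota> z)"

section \<open>Exchange matrices\<close>

definition sign_skew_symmetric :: "int ^ 'n ^ 'n \<Rightarrow> bool" where
  "sign_skew_symmetric B \<longleftrightarrow>
     (\<forall>i j. (B $ i $ j = 0 \<and> B $ j $ i = 0) \<or> B $ i $ j * B $ j $ i < 0)"

definition skew_symmetrizable :: "int ^ 'n ^ 'n \<Rightarrow> bool" where
  "skew_symmetrizable B \<longleftrightarrow>
     (\<exists>d :: 'n \<Rightarrow> real. (\<forall>i. d i > 0) \<and>
        (\<forall>i j. d i * of_int (B $ i $ j) = - (d j * of_int (B $ j $ i))))"

text \<open>The numerator below is always even, so the integer division is exact.\<close>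

definition matrix_mutation :: "'n \<Rightarrow> int ^ 'n ^ 'n \<Rightarrow> int ^ 'n ^ 'n" where
  "matrix_mutation k B =
     (\<chi> i j. if i = k \<or> j = k then - B $ i $ j
             else B $ i $ j + (\<bar>B $ i $ k\<bar> * B $ k $ j + B $ i $ k * \<bar>B $ k $ j\<bar>) div 2)"

section \<open>Seeds and their mutations\<close>

text \<open>
  Seeds are labeled by the finite type \<open>'n\<close>. The identification of seeds that differ by a
  simultaneous relabeling is part of mutation equivalence below.
\<close>

record ('n, 'p, 'f) seed =
  cluster :: "'n \<Rightarrow> 'f"
  coeff_pos :: "'n \<Rightarrow> 'p"
  coeff_neg :: "'n \<Rightarrow> 'p"
  exchange_matrix :: "int ^ 'n ^ 'n"

definition is_seed ::
    "(('p::ab_group_add \<Rightarrow>\<^sub>0 int) \<Rightarrow> 'f::field) \<Rightarrow> ('n::finite, 'p, 'f) seed \<Rightarrow> bool" where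
  "is_seed \<iota> S \<longleftrightarrow> free_generators \<iota> (cluster S) \<and> sign_skew_symmetric (exchange_matrix S)"

definition acyclic_seed :: "('n::finite, 'p, 'f) seed \<Rightarrow> bool" where
  "acyclic_seed S \<longleftrightarrow> acyclic {(i, j). exchange_matrix S $ i $ j > 0}"

definition exchange_rhs ::
    "(('p::ab_group_add \<Rightarrow>\<^sub>0 int) \<Rightarrow> 'f::field) \<Rightarrow> ('n::finite, 'p, 'f) seed \<Rightarrow> 'n \<Rightarrow> 'f" where
  "exchange_rhs \<iota> S j =
     (let x = cluster S; B = exchange_matrix S in
        group_elt \<iota> (coeff_pos S j) * (\<Prod>i\<in>{i. B $ i $ j > 0}. x i ^ nat (B $ i $ j)) +
        group_elt \<iota> (coeff_neg S j) * (\<Prod>i\<in>{i. B $ i $ j < 0}. x i ^ nat (- B $ i $ j)))"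

text \<open>
  This is a relation, not a function of \<open>S\<close>: for \<open>i \<noteq> k\<close> only the ratio of the new
  coefficients at \<open>i\<close> is prescribed. Products, ratios and powers in the coefficient group appear
  in additive notation.
\<close>

definition seed_mutation ::
    "(('p::ab_group_add \<Rightarrow>\<^sub>0 int) \<Rightarrow> 'f::field) \<Rightarrow> 'n::finite \<Rightarrow>
     ('n, 'p, 'f) seed \<Rightarrow> ('n, 'p, 'f) seed \<Rightarrow> bool" where
  "seed_mutation \<iota> k S S' \<longleftrightarrow>
     is_seed \<iota> S \<and> is_seed \<iota> S' \<and>
     cluster S k * cluster S' k = exchange_rhs \<iota> S k \<and>
     (\<forall>i. i \<noteq> k \<longrightarrow> cluster S' i = cluster S i) \<and>
     exchange_matrix S' = matrix_mutation k (exchange_matrix S) \<and>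
     coeff_pos S' k = coeff_neg S k \<and> coeff_neg S' k = coeff_pos S k \<and>
     (\<forall>i. i \<noteq> k \<longrightarrow>
        (let b = exchange_matrix S $ k $ i in
           (b \<ge> 0 \<longrightarrow> coeff_pos S' i - coeff_neg S' i =
              int_multiple b (coeff_pos S k) + (coeff_pos S i - coeff_neg S i)) \<and>
           (b \<le> 0 \<longrightarrow> coeff_pos S' i - coeff_neg S' i =
              int_multiple b (coeff_neg S k) + (coeff_pos S i - coeff_neg S i))))"

definition seed_relabeling :: "('n::finite, 'p, 'f) seed \<Rightarrow> ('n, 'p, 'f) seed \<Rightarrow> bool" where
  "seed_relabeling S S' \<longleftrightarrow>
     (\<exists>\<sigma>. bij \<sigma> \<and>
        (\<forall>i. cluster S' i = cluster S (\<sigma> i) \<and>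
             coeff_pos S' i = coeff_pos S (\<sigma> i) \<and> coeff_neg S' i = coeff_neg S (\<sigma> i)) \<and>
        (\<forall>i j. exchange_matrix S' $ i $ j = exchange_matrix S $ \<sigma> i $ \<sigma> j))"

definition mutation_equivalent ::
    "(('p::ab_group_add \<Rightarrow>\<^sub>0 int) \<Rightarrow> 'f::field) \<Rightarrow>
     ('n::finite, 'p, 'f) seed \<Rightarrow> ('n, 'p, 'f) seed \<Rightarrow> bool" where
  "mutation_equivalent \<iota> =
     equivclp (\<lambda>S S'. (\<exists>k. seed_mutation \<iota> k S S') \<or> seed_relabeling S S')"

section \<open>Cluster algebras\<close>

definition is_subalgebra ::
    "(('p::ab_group_add \<Rightarrow>\<^sub>0 int) \<Rightarrow> 'f::field) \<Rightarrow> 'f set \<Rightarrow> bool" where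
  "is_subalgebra \<iota> A \<longleftrightarrow>
     range \<iota> \<subseteq> A \<and> (\<forall>a\<in>A. \<forall>b\<in>A. a + b \<in> A \<and> a - b \<in> A \<and> a * b \<in> A)"

definition cluster_algebra ::
    "(('p::ab_group_add \<Rightarrow>\<^sub>0 int) \<Rightarrow> 'f::field) \<Rightarrow> ('n::finite, 'p, 'f) seed \<Rightarrow> 'f set" where
  "cluster_algebra \<iota> S =
     is_subalgebra \<iota> hull (\<Union>S'\<in>{S'. mutation_equivalent \<iota> S S'}. range (cluster S'))"

definition finitely_generated_algebra ::
    "(('p::ab_group_add \<Rightarrow>\<^sub>0 int) \<Rightarrow> 'f::field) \<Rightarrow> 'f set \<Rightarrow> bool" where
  "finitely_generated_algebra \<iota> A \<longleftrightarrow> (\<exists>G. finite G \<and> A = is_subalgebra \<iota> hull G)"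

end

theory Submission
  imports Defs "HOL-Computational_Algebra.Polynomial_Factorial" "HOL-Analysis.Continuum_Not_Denumerable"
begin

text \<open>
  Suppose that every seed is cyclic. Then the transposed exchange matrices have a positive kernel
  vector, which gives every cluster variable a positive degree $d$. Choose a second weight $w$,
  sufficiently independent of $d$, and transport it tropically. In each seed some
  mutation produces a cluster variable of larger slope $w/d$ than any given one, so the slopes have
  no maximum. If finitely many cluster variables of slope at most $\mu$ generated the
  algebra, the monomial valuation with weights $w - \mu d$ would be nonpositive on all of it, but it is
  positive on a cluster variable of slope larger than $\mu$.

  Conversely, the cluster algebra of an acyclic seed is generated by the cluster variables
  $x_i$ and their exchange partners $x_i'$. All cluster variables lie in the intersection of the rings
  $R[x_i, x_i', x_j, x_j', x_k^{\pm 1}]$, provided that this intersection does not change under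
  mutation, and for an acyclic seed the intersection is $R[x_1, x_1', x_2, x_2', x_3, x_3']$. Invariance needs
  the exchange polynomials of unlinked vertices to be coprime. This is enforced by multiplying the
  coefficients with powers of a new variable $t$, and the result is specialised at $t = 1$.
\<close>

section \<open>Subrings generated over a base\<close>

text \<open>A degree alone cannot refute finite generation. Slopes help because the valuation must
  be computable on every exchange binomial, that is, the two monomials must never tie. For d they
  always tie, d being a kernel vector; for w a tie is excluded by independence of d and w over the
  integers. Real independence would be too much to ask of two weights in dimension three, while the
  integral version suffices and survives mutation.

  In the converse, the given coefficients may make the exchange polynomials of two unlinked vertices
  equal, and then invariance of the intersection can no longer be argued. A perturbation helps only
  if coprimality persists in all seeds at once, which calls for a quantity preserved by mutation:
  the exponents of t paired with a right kernel vector of the exchange matrix. The specialisation is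
  applied last, to elements of the ring on six generators, where it can be checked on generators.
  The zero matrix is treated separately, as both exchange polynomials of a pair are then
  constants.\<close>

definition is_subring :: "'a::field set \<Rightarrow> bool" where
  "is_subring T \<longleftrightarrow> 1 \<in> T \<and> (\<forall>a\<in>T. \<forall>b\<in>T. a + b \<in> T \<and> a - b \<in> T \<and> a * b \<in> T)"

lemma subring_1: "is_subring T \<Longrightarrow> 1 \<in> T"
  and subring_add: "is_subring T \<Longrightarrow> a \<in> T \<Longrightarrow> b \<in> T \<Longrightarrow> a + b \<in> T"
  and subring_diff: "is_subring T \<Longrightarrow> a \<in> T \<Longrightarrow> b \<in> T \<Longrightarrow> a - b \<in> T"
  and subring_mult: "is_subring T \<Longrightarrow> a \<in> T \<Longrightarrow> b \<in> T \<Longrightarrow> a * b \<in> T"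
  by (auto simp: is_subring_def)

lemma subring_0: "is_subring T \<Longrightarrow> 0 \<in> T"
  using subring_diff[of T 1 1] subring_1 by fastforce

lemma subring_uminus: "is_subring T \<Longrightarrow> a \<in> T \<Longrightarrow> - a \<in> T"
  using subring_diff[of T 0 a] subring_0 by fastforce

lemma subring_power: "is_subring T \<Longrightarrow> a \<in> T \<Longrightarrow> a ^ n \<in> T"
  by (induction n) (auto intro: subring_1 subring_mult)

lemma subring_sum: "is_subring T \<Longrightarrow> (\<And>i. i \<in> I \<Longrightarrow> f i \<in> T) \<Longrightarrow> sum f I \<in> T"
  by (induction I rule: infinite_finite_induct) (auto intro: subring_0 subring_add)

lemma subring_prod: "is_subring T \<Longrightarrow> (\<And>i. i \<in> I \<Longrightarrow> f i \<in> T) \<Longrightarrow> prod f I \<in> T"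
  by (induction I rule: infinite_finite_induct) (auto intro: subring_1 subring_mult)

lemma subring_poly:
  assumes "is_subring T" "\<And>i. coeff P i \<in> T" "x \<in> T"
  shows "poly P x \<in> T"
  unfolding poly_altdef using assms by (auto intro!: subring_sum subring_mult subring_power)

lemmas subring_closed = subring_0 subring_1 subring_add subring_diff subring_mult subring_uminus
  subring_power subring_sum subring_prod

lemma is_subring_Inter: "(\<And>T. T \<in> \<T> \<Longrightarrow> is_subring T) \<Longrightarrow> is_subring (\<Inter>\<T>)"
  unfolding is_subring_def by blast

definition gen :: "'a::field set \<Rightarrow> 'a set" where
  "gen X = is_subring hull X"

lemma is_subring_gen: "is_subring (gen X)"
  unfolding gen_def by (rule hull_in) (auto intro: is_subring_Inter)

lemma gen_base: "x \<in> X \<Longrightarrow> x \<in> gen X"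
  unfolding gen_def by (rule hull_inc)

lemma gen_least: "X \<subseteq> T \<Longrightarrow> is_subring T \<Longrightarrow> gen X \<subseteq> T"
  unfolding gen_def by (rule hull_minimal)

lemma gen_mono: "X \<subseteq> gen Y \<Longrightarrow> gen X \<subseteq> gen Y"
  by (rule gen_least) (auto intro: is_subring_gen)

lemma gen_subset: "X \<subseteq> Y \<Longrightarrow> gen X \<subseteq> gen Y"
  by (rule gen_mono) (auto intro: gen_base)

lemmas gen_closed = subring_closed[OF is_subring_gen]

section \<open>Expansions in one transcendental element\<close>

definition trans_over :: "'a::field set \<Rightarrow> 'a \<Rightarrow> bool" where
  "trans_over T x \<longleftrightarrow> (\<forall>P. (\<forall>i. coeff P i \<in> T) \<and> poly P x = 0 \<longrightarrow> P = 0)"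

lemma trans_over_eq:
  assumes "is_subring T" "trans_over T x" "poly P x = poly Q x"
    "\<And>i. coeff P i \<in> T" "\<And>i. coeff Q i \<in> T"
  shows "P = Q"
proof -
  have "poly (P - Q) x = 0" "\<forall>i. coeff (P - Q) i \<in> T"
    using assms(3) subring_diff[OF assms(1,4,5)] by auto
  then have "P - Q = 0" using assms(2) unfolding trans_over_def by blast
  then show ?thesis by simp
qed

text \<open>
  This is the ring $T[x, M/x]$: in the Laurent expansion $r = \sum_i c_i x^{i-N}$ the coefficient
  of $x^{-m}$ must be divisible by $M^m$. For $i \ge N$ the truncated subtraction \<open>N - i\<close> is 0 and only
  \<open>c\<^sub>i \<in> T\<close> is required. The choice $M = 1$ gives the ring of Laurent polynomials.
\<close>

definition exch_ext :: "'a::field set \<Rightarrow> 'a \<Rightarrow> 'a \<Rightarrow> 'a set" where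
  "exch_ext T M x = {r. \<exists>N P. r * x ^ N = poly P x \<and> (\<forall>i. \<exists>e\<in>T. coeff P i = M ^ (N - i) * e)}"

lemma exch_ext_I:
  "r * x ^ N = poly P x \<Longrightarrow> (\<And>i. \<exists>e\<in>T. coeff P i = M ^ (N - i) * e) \<Longrightarrow> r \<in> exch_ext T M x"
  unfolding exch_ext_def by blast

text \<open>The exponent N of an expansion is not canonical. Multiplying by x^k shifts the
  coefficients and the required powers of M alike, and the new low coefficients vanish; so two
  elements can be given the same N.\<close>

lemma exch_ext_raise:
  assumes T: "is_subring T" and M: "M \<in> T"
    and r: "r * x ^ N = poly P x" and c: "\<forall>i. \<exists>e\<in>T. coeff P i = M ^ (N - i) * e"
  shows "\<exists>Q. r * x ^ (N + k) = poly Q x \<and> (\<forall>i. \<exists>e\<in>T. coeff Q i = M ^ (N + k - i) * e)"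
proof (intro exI conjI allI)
  show "r * x ^ (N + k) = poly (monom 1 k * P) x"
    using r by (simp add: power_add poly_monom algebra_simps)
  fix i show "\<exists>e\<in>T. coeff (monom 1 k * P) i = M ^ (N + k - i) * e"
  proof (cases "i < k")
    case True
    then show ?thesis using subring_0[OF T] by (auto simp: coeff_monom_mult)
  next
    case False
    then have "N + k - i = N - (i - k)" by simp
    moreover have "coeff (monom 1 k * P) i = coeff P (i - k)"
      using False by (simp add: coeff_monom_mult)
    ultimately show ?thesis using c by metis
  qed
qed

lemma is_subring_exch_ext:
  assumes T: "is_subring T" and M: "M \<in> T" and x: "x \<noteq> 0"
  shows "is_subring (exch_ext T M x)"
proof -
  have one: "1 \<in> exch_ext T M x"
    by (rule exch_ext_I[of _ _ 0 1]) (use subring_0[OF T] subring_1[OF T] in \<open>auto simp: coeff_1\<close>)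
  have "a + b \<in> exch_ext T M x \<and> a - b \<in> exch_ext T M x \<and> a * b \<in> exch_ext T M x"
    if "a \<in> exch_ext T M x" "b \<in> exch_ext T M x" for a b
  proof -
    obtain N P where a: "a * x ^ N = poly P x" "\<forall>i. \<exists>e\<in>T. coeff P i = M ^ (N - i) * e"
      using \<open>a \<in> exch_ext T M x\<close> unfolding exch_ext_def by blast
    obtain N' P' where b: "b * x ^ N' = poly P' x" "\<forall>i. \<exists>e\<in>T. coeff P' i = M ^ (N' - i) * e"
      using \<open>b \<in> exch_ext T M x\<close> unfolding exch_ext_def by blast
    obtain Q where Q: "a * x ^ (N + N') = poly Q x" "\<forall>i. \<exists>e\<in>T. coeff Q i = M ^ (N + N' - i) * e"
      using exch_ext_raise[OF T M a] by blast
    obtain Q' where "b * x ^ (N' + N) = poly Q' x" "\<forall>i. \<exists>e\<in>T. coeff Q' i = M ^ (N' + N - i) * e"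
      using exch_ext_raise[OF T M b] by blast
    then have Q': "b * x ^ (N + N') = poly Q' x" "\<forall>i. \<exists>e\<in>T. coeff Q' i = M ^ (N + N' - i) * e"
      by (simp_all add: add.commute)
    have "\<exists>e\<in>T. coeff (Q + Q') i = M ^ (N + N' - i) * e" for i
    proof -
      obtain e e' where "e \<in> T" "e' \<in> T" "coeff Q i = M ^ (N + N' - i) * e" "coeff Q' i = M ^ (N + N' - i) * e'"
        using Q(2) Q'(2) by blast
      then show ?thesis using T by (auto intro!: bexI[of _ "e + e'"] subring_add simp: algebra_simps)
    qed
    moreover have "(a + b) * x ^ (N + N') = poly (Q + Q') x"
      using Q(1) Q'(1) by (simp add: distrib_right)
    ultimately have 1: "a + b \<in> exch_ext T M x" by (rule exch_ext_I[rotated])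
    have "\<exists>e\<in>T. coeff (Q - Q') i = M ^ (N + N' - i) * e" for i
    proof -
      obtain e e' where "e \<in> T" "e' \<in> T" "coeff Q i = M ^ (N + N' - i) * e" "coeff Q' i = M ^ (N + N' - i) * e'"
        using Q(2) Q'(2) by blast
      then show ?thesis using T by (auto intro!: bexI[of _ "e - e'"] subring_diff simp: algebra_simps)
    qed
    moreover have "(a - b) * x ^ (N + N') = poly (Q - Q') x"
      using Q(1) Q'(1) by (simp add: left_diff_distrib)
    ultimately have 2: "a - b \<in> exch_ext T M x" by (rule exch_ext_I[rotated])
    have "\<exists>e\<in>T. coeff (P * P') i = M ^ (N + N' - i) * e" for i
    proof -
      have "\<exists>e\<in>T. coeff P j * coeff P' (i - j) = M ^ (N + N' - i) * e" if "j \<le> i" for j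
      proof -
        obtain e e' where e: "e \<in> T" "e' \<in> T" "coeff P j = M ^ (N - j) * e"
            "coeff P' (i - j) = M ^ (N' - (i - j)) * e'"
          using a(2) b(2) by blast
        \<comment> \<open>Truncated subtraction only enlarges the exponents, so the product carries
          at least N + N' - i factors M; \<open>k\<close> counts the surplus, which is absorbed into
          T.\<close>
        define k where "k = (N - j) + (N' - (i - j)) - (N + N' - i)"
        have "(N - j) + (N' - (i - j)) = (N + N' - i) + k"
          using that unfolding k_def by simp
        then have "coeff P j * coeff P' (i - j) = M ^ (N + N' - i) * (M ^ k * e * e')"
          using e by (metis (no_types, lifting) mult.assoc mult.left_commute power_add)
        moreover have "M ^ k * e * e' \<in> T" using e T M by (auto intro!: subring_mult subring_power)
        ultimately show ?thesis by blast
      qed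
      then obtain f where f: "\<And>j. j \<le> i \<Longrightarrow> f j \<in> T \<and> coeff P j * coeff P' (i - j) = M ^ (N + N' - i) * f j"
        by metis
      have "coeff (P * P') i = M ^ (N + N' - i) * (\<Sum>j\<le>i. f j)"
        unfolding coeff_mult sum_distrib_left using f by (intro sum.cong) auto
      moreover have "(\<Sum>j\<le>i. f j) \<in> T" using T f by (auto intro!: subring_sum)
      ultimately show ?thesis by blast
    qed
    moreover have "(a * b) * x ^ (N + N') = poly (P * P') x"
      by (simp add: a(1)[symmetric] b(1)[symmetric] power_add mult_ac)
    ultimately have 3: "a * b \<in> exch_ext T M x" by (rule exch_ext_I[rotated])
    show ?thesis using 1 2 3 by blast
  qed
  then show ?thesis using one unfolding is_subring_def by blast
qed

text \<open>Two views of one ring: generators are convenient for proving inclusions, expansions for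
  comparing coefficients.\<close>

lemma exch_ext_eq_gen:
  assumes T: "is_subring T" and M: "M \<in> T" and x: "x \<noteq> 0"
  shows "exch_ext T M x = gen (T \<union> {x, M / x})"
proof
  show "exch_ext T M x \<subseteq> gen (T \<union> {x, M / x})"
  proof
    fix r assume "r \<in> exch_ext T M x"
    then obtain N P where r: "r * x ^ N = poly P x" and c: "\<forall>i. \<exists>e\<in>T. coeff P i = M ^ (N - i) * e"
      unfolding exch_ext_def by blast
    have "r = (\<Sum>i\<le>degree P. coeff P i * x ^ i / x ^ N)"
      using r x by (simp add: poly_altdef field_simps sum_divide_distrib[symmetric])
    moreover have "coeff P i * x ^ i / x ^ N \<in> gen (T \<union> {x, M / x})" for i
    proof -
      obtain e where e: "e \<in> T" "coeff P i = M ^ (N - i) * e" using c by blast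
      show ?thesis
      proof (cases "i < N")
        case True
        then have "x ^ N = x ^ i * x ^ (N - i)" by (simp flip: power_add)
        then have "coeff P i * x ^ i / x ^ N = e * (M / x) ^ (N - i)"
          using e x by (simp add: power_divide)
        then show ?thesis using e by (auto intro!: gen_closed intro: gen_base)
      next
        case False
        then have "x ^ i = x ^ N * x ^ (i - N)" by (simp flip: power_add)
        then have "coeff P i * x ^ i / x ^ N = e * x ^ (i - N)"
          using e x False by simp
        then show ?thesis using e by (auto intro!: gen_closed intro: gen_base)
      qed
    qed
    ultimately show "r \<in> gen (T \<union> {x, M / x})" by (auto intro!: gen_closed)
  qed
  have "r \<in> exch_ext T M x" if "r \<in> T" for r
    by (rule exch_ext_I[of _ _ 0 "[:r:]"]) (use that subring_0[OF T] in \<open>auto simp: coeff_pCons split: nat.splits\<close>)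
  moreover have "x \<in> exch_ext T M x"
    by (rule exch_ext_I[of _ _ 0 "[:0, 1:]"])
      (use subring_0[OF T] subring_1[OF T] in \<open>auto simp: coeff_pCons split: nat.splits\<close>)
  moreover have "M / x \<in> exch_ext T M x"
  proof (rule exch_ext_I[of _ _ 1 "[:M:]"])
    show "M / x * x ^ 1 = poly [:M:] x" using x by simp
    show "\<exists>e\<in>T. coeff [:M:] i = M ^ (1 - i) * e" for i
      using subring_0[OF T] subring_1[OF T] by (cases i) auto
  qed
  ultimately show "gen (T \<union> {x, M / x}) \<subseteq> exch_ext T M x"
    by (intro gen_least is_subring_exch_ext[OF T M x]) auto
qed

text \<open>As x is transcendental over K, the expansions over T0 and over T1 are the same
  polynomial once N is common. Intersecting two such rings is thereby reduced to the divisibility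
  statement \<open>div\<close> about single coefficients.\<close>

lemma exch_ext_inter:
  assumes T0: "is_subring T0" "M0 \<in> T0" and T1: "is_subring T1" "M1 \<in> T1"
    and K: "is_subring K" "T0 \<subseteq> K" "T1 \<subseteq> K" "trans_over K x"
    and r: "r \<in> exch_ext T0 M0 x" "r \<in> exch_ext T1 M1 x"
    and div: "\<And>n e0 e1. e0 \<in> T0 \<Longrightarrow> e1 \<in> T1 \<Longrightarrow> M0 ^ n * e0 = M1 ^ n * e1 \<Longrightarrow>
                \<exists>e\<in>T. M0 ^ n * e0 = M ^ n * e"
  shows "r \<in> exch_ext T M x"
proof -
  obtain N P where a: "r * x ^ N = poly P x" "\<forall>i. \<exists>e\<in>T0. coeff P i = M0 ^ (N - i) * e"
    using r unfolding exch_ext_def by blast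
  obtain N' P' where b: "r * x ^ N' = poly P' x" "\<forall>i. \<exists>e\<in>T1. coeff P' i = M1 ^ (N' - i) * e"
    using r unfolding exch_ext_def by blast
  obtain Q where Q: "r * x ^ (N + N') = poly Q x" "\<forall>i. \<exists>e\<in>T0. coeff Q i = M0 ^ (N + N' - i) * e"
    using exch_ext_raise[OF T0 a] by blast
  obtain Q' where Q': "r * x ^ (N' + N) = poly Q' x" "\<forall>i. \<exists>e\<in>T1. coeff Q' i = M1 ^ (N' + N - i) * e"
    using exch_ext_raise[OF T1 b] by blast
  have "coeff Q i \<in> K" for i
    using Q(2) T0 K(1,2) subring_mult[OF T0(1) subring_power[OF T0]] by (metis subsetD)
  moreover have "coeff Q' i \<in> K" for i
    using Q'(2) T1 K(1,3) subring_mult[OF T1(1) subring_power[OF T1]] by (metis subsetD)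
  moreover have "poly Q x = poly Q' x" using Q(1) Q'(1) by (simp add: add.commute)
  ultimately have "Q = Q'" using trans_over_eq[OF K(1,4)] by blast
  have "\<exists>e\<in>T. coeff Q i = M ^ (N + N' - i) * e" for i
  proof -
    obtain e0 where "e0 \<in> T0" "coeff Q i = M0 ^ (N + N' - i) * e0" using Q(2) by blast
    moreover obtain e1 where "e1 \<in> T1" "coeff Q i = M1 ^ (N + N' - i) * e1"
      using Q'(2) \<open>Q = Q'\<close> by (metis add.commute)
    ultimately show ?thesis using div by metis
  qed
  with Q(1) show ?thesis by (rule exch_ext_I)
qed

section \<open>Algebraic independence\<close>

definition mon :: "('n::finite \<Rightarrow> 'a::field) \<Rightarrow> ('n \<Rightarrow> nat) \<Rightarrow> 'a" where
  "mon x m = (\<Prod>i\<in>UNIV. x i ^ m i)"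

lemma mon_add: "mon x (\<lambda>i. m i + m' i) = mon x m * mon x m'"
  by (simp add: mon_def power_add prod.distrib)

lemma mon_zero [simp]: "mon x (\<lambda>_. 0) = 1"
  by (simp add: mon_def)

lemma mon_split: "mon x m = x k ^ m k * mon x (m(k := 0))"
proof -
  have "mon x m = x k ^ m k * (\<Prod>i\<in>UNIV - {k}. x i ^ m i)"
    unfolding mon_def by (subst prod.remove[of _ k]) auto
  also have "(\<Prod>i\<in>UNIV - {k}. x i ^ m i) = (\<Prod>i\<in>UNIV - {k}. x i ^ (m(k := 0)) i)"
    by (intro prod.cong) auto
  also have "\<dots> = mon x (m(k := 0))"
    unfolding mon_def by (subst prod.remove[of UNIV k]) auto
  finally show ?thesis .
qed

lemma mon_cong: "(\<And>i. i \<noteq> k \<Longrightarrow> x i = y i) \<Longrightarrow> m k = 0 \<Longrightarrow> mon x m = mon y m"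
  unfolding mon_def by (intro prod.cong) (auto, metis power_0)

lemma mon_single: "mon x (\<lambda>j. if j = k then e else 0) = x k ^ e"
proof -
  have "mon x (\<lambda>j. if j = k then e else 0) = (\<Prod>j\<in>UNIV. if j = k then x k ^ e else 1)"
    unfolding mon_def by (rule prod.cong) auto
  then show ?thesis by simp
qed

text \<open>Exponents are plain functions and coefficients a finite family, so that relations can be
  split by the exponent of one variable without handling the polynomial type.\<close>

definition indep :: "'a::field set \<Rightarrow> ('n::finite \<Rightarrow> 'a) \<Rightarrow> bool" where
  "indep R x \<longleftrightarrow> (\<forall>S c. finite S \<and> (\<forall>m\<in>S. c m \<in> R) \<and> (\<Sum>m\<in>S. c m * mon x m) = 0 \<longrightarrow> (\<forall>m\<in>S. c m = 0))"

lemma indepD: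
  "indep R x \<Longrightarrow> finite S \<Longrightarrow> (\<And>m. m \<in> S \<Longrightarrow> c m \<in> R) \<Longrightarrow> (\<Sum>m\<in>S. c m * mon x m) = 0 \<Longrightarrow> m \<in> S \<Longrightarrow> c m = 0"
  unfolding indep_def by blast

lemma indep_subset: "indep R x \<Longrightarrow> R' \<subseteq> R \<Longrightarrow> indep R' x"
  unfolding indep_def by blast

lemma inj_lookup: "inj Poly_Mapping.lookup"
  by (auto intro: injI poly_mapping_eqI)

text \<open>On a finite index type every exponent function has finite support, so
  \<open>Poly_Mapping.lookup\<close> is a bijection between the two kinds of exponents. That 0 lies
  in R covers the coefficients outside the support.\<close>

lemma algebraically_independent_iff_indep:
  fixes x :: "'n::finite \<Rightarrow> 'a::field"
  assumes "0 \<in> R"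
  shows "algebraically_independent R x \<longleftrightarrow> indep R x"
proof
  assume ai: "algebraically_independent R x"
  show "indep R x"
    unfolding indep_def
  proof (intro allI impI ballI; elim conjE)
    fix S :: "('n \<Rightarrow> nat) set" and c m
    assume S: "finite S" and c: "\<forall>m\<in>S. c m \<in> R" and sum: "(\<Sum>m\<in>S. c m * mon x m) = 0" and m: "m \<in> S"
    define f where "f m' = (if Poly_Mapping.lookup m' \<in> S then c (Poly_Mapping.lookup m') else 0)"
      for m' :: "'n \<Rightarrow>\<^sub>0 nat"
    define q where "q = Abs_poly_mapping f"
    have fin: "finite (Poly_Mapping.lookup -` S :: ('n \<Rightarrow>\<^sub>0 nat) set)"
      using S inj_lookup by (rule finite_vimageI)
    have "finite {m'. f m' \<noteq> 0}"
      by (rule finite_subset[OF _ fin]) (auto simp: f_def)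
    then have lq: "Poly_Mapping.lookup q = f" unfolding q_def by simp
    have surj: "\<exists>m'. Poly_Mapping.lookup m' = m" for m :: "'n \<Rightarrow> nat"
      by (rule exI[of _ "Abs_poly_mapping m"]) simp
    have "poly_eval x q = (\<Sum>m\<in>Poly_Mapping.lookup -` S. f m * (\<Prod>i\<in>UNIV. x i ^ Poly_Mapping.lookup m i))"
      unfolding poly_eval_def lq
      by (rule sum.mono_neutral_left) (auto simp: fin f_def in_keys_iff lq split: if_splits)
    also have "\<dots> = (\<Sum>m\<in>S. c m * mon x m)"
      by (rule sum.reindex_bij_witness[of _ "Abs_poly_mapping" "Poly_Mapping.lookup"])
        (auto simp: f_def mon_def)
    finally have "poly_eval x q = 0" using sum by simp
    moreover have "\<forall>m. Poly_Mapping.lookup q m \<in> R" using assms c unfolding lq f_def by auto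
    ultimately have "q = 0" using ai unfolding algebraically_independent_def by blast
    obtain m' where "Poly_Mapping.lookup m' = m" using surj by blast
    moreover have "f m' = 0" using \<open>q = 0\<close> lq by (metis lookup_zero)
    ultimately show "c m = 0" using m by (simp add: f_def)
  qed
next
  assume ind: "indep R x"
  show "algebraically_independent R x"
    unfolding algebraically_independent_def
  proof (intro allI impI; elim conjE)
    fix q :: "('n \<Rightarrow>\<^sub>0 nat) \<Rightarrow>\<^sub>0 'a"
    assume R: "\<forall>m. Poly_Mapping.lookup q m \<in> R" and q: "poly_eval x q = 0"
    define S where "S = Poly_Mapping.lookup ` Poly_Mapping.keys q"
    define c where "c m = Poly_Mapping.lookup q (Abs_poly_mapping m)" for m
    have Abs: "Abs_poly_mapping (Poly_Mapping.lookup m) = m" for m :: "'n \<Rightarrow>\<^sub>0 nat"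
      by (rule poly_mapping_eqI) simp
    have "(\<Sum>m\<in>S. c m * mon x m) = poly_eval x q"
      unfolding S_def poly_eval_def by (subst sum.reindex) (auto simp: c_def mon_def Abs intro: inj_on_subset[OF inj_lookup])
    then have "\<forall>m\<in>S. c m = 0"
      using ind R q unfolding indep_def by (metis S_def c_def finite_imageI finite_keys)
    then show "q = 0" unfolding S_def c_def Abs
      by (intro poly_mapping_eqI) (metis (no_types, lifting) Abs imageI in_keys_iff lookup_zero)
  qed
qed

text \<open>Built term by term so that closure properties follow by induction. Monomials may repeat;
  \<open>lspan_sumD\<close> collects them. Q will be the absence of one variable or a bound on the
  weight.\<close>

inductive_set lspan :: "'a::field set \<Rightarrow> ('n::finite \<Rightarrow> 'a) \<Rightarrow> (('n \<Rightarrow> nat) \<Rightarrow> bool) \<Rightarrow> 'a set"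
  for R x Q where
  zero: "0 \<in> lspan R x Q"
| step: "c \<in> R \<Longrightarrow> Q m \<Longrightarrow> f \<in> lspan R x Q \<Longrightarrow> c * mon x m + f \<in> lspan R x Q"

lemma lspan_mon: "c \<in> R \<Longrightarrow> Q m \<Longrightarrow> c * mon x m \<in> lspan R x Q"
  using lspan.step[OF _ _ lspan.zero] by fastforce

lemma lspan_add: "f \<in> lspan R x Q \<Longrightarrow> g \<in> lspan R x Q \<Longrightarrow> f + g \<in> lspan R x Q"
  by (induction rule: lspan.induct) (auto simp: add.assoc intro: lspan.intros)

lemma lspan_uminus:
  assumes R: "is_subring R" and f: "f \<in> lspan R x Q"
  shows "- f \<in> lspan R x Q"
  using f
proof (induction rule: lspan.induct)
  case (step c m f)
  with R have "(- c) * mon x m + - f \<in> lspan R x Q" by (intro lspan.step) (auto intro: subring_uminus)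
  then show ?case by simp
qed (auto intro: lspan.zero)

lemma lspan_diff: "is_subring R \<Longrightarrow> f \<in> lspan R x Q \<Longrightarrow> g \<in> lspan R x Q \<Longrightarrow> f - g \<in> lspan R x Q"
  using lspan_add[of f R x Q "- g"] lspan_uminus[of R g x Q] by simp

lemma lspan_mono: "f \<in> lspan R x Q \<Longrightarrow> (\<And>m. Q m \<Longrightarrow> Q' m) \<Longrightarrow> f \<in> lspan R x Q'"
  by (induction rule: lspan.induct) (auto intro: lspan.intros)

lemma lspan_mult:
  assumes R: "is_subring R" and f: "f \<in> lspan R x Q" and g: "g \<in> lspan R x Q'"
    and Q: "\<And>m m'. Q m \<Longrightarrow> Q' m' \<Longrightarrow> Q'' (\<lambda>i. m i + m' i)"
  shows "f * g \<in> lspan R x Q''"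
  using f
proof (induction rule: lspan.induct)
  case zero
  then show ?case by (simp add: lspan.zero)
next
  case (step c m f)
  have "c * mon x m * g \<in> lspan R x Q''"
    using g
  proof (induction rule: lspan.induct)
    case zero
    then show ?case by (simp add: lspan.zero)
  next
    case (step c' m' g)
    have "(c * c') * mon x (\<lambda>i. m i + m' i) + c * mon x m * g \<in> lspan R x Q''"
      using step \<open>c \<in> R\<close> \<open>Q m\<close> R by (intro lspan.step) (auto intro: subring_mult Q)
    then show ?case by (simp add: mon_add algebra_simps)
  qed
  with step show ?case by (simp add: distrib_right lspan_add)
qed

lemma lspan_sumD:
  assumes R: "is_subring R" and f: "f \<in> lspan R x Q"
  shows "\<exists>S c. finite S \<and> (\<forall>m\<in>S. Q m \<and> c m \<in> R) \<and> f = (\<Sum>m\<in>S. c m * mon x m)"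
  using f
proof (induction rule: lspan.induct)
  case zero
  show ?case by (rule exI[of _ "{}"]) auto
next
  case (step c m f)
  then obtain S d where S: "finite S" "\<forall>m\<in>S. Q m \<and> d m \<in> R" "f = (\<Sum>m\<in>S. d m * mon x m)" by blast
  define d' where "d' = d(m := c + (if m \<in> S then d m else 0))"
  have "(\<Sum>m\<in>insert m S. d' m * mon x m) = d' m * mon x m + (\<Sum>m\<in>S - {m}. d' m * mon x m)"
    using S by (subst sum.insert_remove) auto
  also have "(\<Sum>m\<in>S - {m}. d' m * mon x m) = (\<Sum>m\<in>S - {m}. d m * mon x m)"
    by (rule sum.cong) (auto simp: d'_def)
  also have "d' m * mon x m + \<dots> = c * mon x m + f"
  proof (cases "m \<in> S")
    case True
    then have "f = d m * mon x m + (\<Sum>m\<in>S - {m}. d m * mon x m)"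
      unfolding S(3) using S(1) by (simp add: sum.remove)
    then show ?thesis using True by (simp add: d'_def distrib_right)
  next
    case False
    then show ?thesis using S(3) by (simp add: d'_def)
  qed
  finally have "(\<Sum>m\<in>insert m S. d' m * mon x m) = c * mon x m + f" .
  moreover have "\<forall>m'\<in>insert m S. Q m' \<and> d' m' \<in> R"
    using S step R by (auto simp: d'_def intro: subring_add)
  moreover have "finite (insert m S)" using S(1) by simp
  ultimately show ?case
    by (intro exI[of _ "insert m S"] exI[of _ d']) simp
qed

lemma is_subring_lspan:
  assumes R: "is_subring R"
  shows "is_subring (lspan R x (\<lambda>m. m k = 0))"
proof -
  have "1 * mon x (\<lambda>_. 0) \<in> lspan R x (\<lambda>m. m k = 0)"
    by (rule lspan_mon) (auto intro: subring_1[OF R])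
  then have "1 \<in> lspan R x (\<lambda>m. m k = 0)" by simp
  moreover have "f * g \<in> lspan R x (\<lambda>m. m k = 0)"
    if "f \<in> lspan R x (\<lambda>m. m k = 0)" "g \<in> lspan R x (\<lambda>m. m k = 0)" for f g
    by (rule lspan_mult[OF R that]) simp
  ultimately show ?thesis
    unfolding is_subring_def by (intro conjI ballI lspan_add lspan_diff[OF R])
qed

text \<open>Writing each coefficient of P in the remaining variables turns P(x_k) = 0 into one
  relation between monomials. The exponents \<open>m(k := i)\<close> are distinct for distinct pairs
  (i, m), so no two terms collide.\<close>

lemma trans_lspan:
  assumes R: "is_subring R" and ind: "indep R x"
  shows "trans_over (lspan R x (\<lambda>m. m k = 0)) (x k)"
  unfolding trans_over_def
proof (intro allI impI; elim conjE)
  fix P assume c: "\<forall>i. coeff P i \<in> lspan R x (\<lambda>m. m k = 0)" and P: "poly P (x k) = 0"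
  have "\<exists>p. finite (fst p) \<and> (\<forall>m\<in>fst p. m k = 0 \<and> snd p m \<in> R) \<and>
      coeff P i = (\<Sum>m\<in>fst p. snd p m * mon x m)" for i
    using lspan_sumD[OF R spec[OF c, of i]] by simp
  then have "\<exists>p. \<forall>i. finite (fst (p i)) \<and> (\<forall>m\<in>fst (p i). m k = 0 \<and> snd (p i) m \<in> R) \<and>
      coeff P i = (\<Sum>m\<in>fst (p i). snd (p i) m * mon x m)"
    by (intro choice allI)
  then obtain p where p: "\<And>i. finite (fst (p i)) \<and> (\<forall>m\<in>fst (p i). m k = 0 \<and> snd (p i) m \<in> R) \<and>
      coeff P i = (\<Sum>m\<in>fst (p i). snd (p i) m * mon x m)"
    by blast
  define S d where "S i = fst (p i)" and "d i = snd (p i)" for i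
  have S: "\<And>i. finite (S i)" "\<And>i m. m \<in> S i \<Longrightarrow> m k = 0 \<and> d i m \<in> R"
      "\<And>i. coeff P i = (\<Sum>m\<in>S i. d i m * mon x m)"
    using p unfolding S_def d_def by auto
  define I where "I = Sigma {..degree P} S"
  define h where "h = (\<lambda>(i::nat, m::'b \<Rightarrow> nat). m(k := i))"
  have inj: "inj_on h I"
  proof (rule inj_onI, clarify)
    fix i m i' m' assume *: "(i, m) \<in> I" "(i', m') \<in> I" "h (i, m) = h (i', m')"
    then have "i = i'" unfolding h_def by (auto dest: fun_cong[of _ _ k])
    moreover have "m j = m' j" for j
    proof (cases "j = k")
      case True
      have "m k = 0" "m' k = 0" using * S(2) unfolding I_def by blast+
      then show ?thesis using True by simp
    next
      case False
      then show ?thesis using fun_cong[OF *(3), of j] unfolding h_def by simp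
    qed
    ultimately show "i = i' \<and> m = m'" by auto
  qed
  \<comment> \<open>\<open>e\<close> recovers \<open>d i m\<close> from the combined exponent: its
    entry at k is the power of x_k, the rest is the exponent inside the coefficient.\<close>
  define e where "e m = d (m k) (m(k := 0))" for m
  have e: "e (h (i, m)) = d i m" if "(i, m) \<in> I" for i m
    using that S(2)[of m i] unfolding e_def h_def I_def by (auto simp: fun_upd_idem)
  have mh: "mon x (h (i, m)) = x k ^ i * mon x m" if "(i, m) \<in> I" for i m
    using that S(2)[of m i] unfolding h_def I_def by (subst mon_split[of _ _ k]) (auto simp: fun_upd_idem)
  have "(\<Sum>m\<in>h ` I. e m * mon x m) = (\<Sum>(i, m)\<in>I. d i m * (x k ^ i * mon x m))"
    by (subst sum.reindex[OF inj]) (auto simp: e mh intro!: sum.cong)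
  also have "\<dots> = (\<Sum>i\<le>degree P. \<Sum>m\<in>S i. d i m * (x k ^ i * mon x m))"
    unfolding I_def using S(1) by (subst sum.Sigma) auto
  also have "\<dots> = poly P (x k)"
    unfolding poly_altdef S(3) by (simp add: sum_distrib_right sum_distrib_left mult_ac)
  finally have "(\<Sum>m\<in>h ` I. e m * mon x m) = 0" using P by simp
  moreover have "finite (h ` I)" unfolding I_def using S(1) by auto
  moreover have "e m \<in> R" if "m \<in> h ` I" for m
    using that e S(2) unfolding I_def by auto
  ultimately have "\<forall>m\<in>h ` I. e m = 0" using indepD[OF ind] by blast
  then have "d i m = 0" if "i \<le> degree P" "m \<in> S i" for i m
    using that e unfolding I_def by force
  then have "coeff P i = 0" if "i \<le> degree P" for i
    unfolding S(3) using that by simp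
  then show "P = 0" by (metis leading_coeff_0_iff order_refl)
qed

section \<open>Fractions in all variables but one\<close>

definition fracs :: "'a::field set \<Rightarrow> 'a set" where
  "fracs T = {a / b | a b. a \<in> T \<and> b \<in> T \<and> b \<noteq> 0}"

lemma fracs_I: "a \<in> T \<Longrightarrow> b \<in> T \<Longrightarrow> b \<noteq> 0 \<Longrightarrow> a / b \<in> fracs T"
  unfolding fracs_def by blast

lemma fracs_base: "is_subring T \<Longrightarrow> a \<in> T \<Longrightarrow> a \<in> fracs T"
  using fracs_I[of a T 1] subring_1[of T] by simp

lemma is_subring_fracs:
  assumes T: "is_subring T"
  shows "is_subring (fracs T)"
  unfolding is_subring_def
proof (intro conjI ballI)
  show "1 \<in> fracs T" by (simp add: T fracs_base subring_1)
  fix a b assume "a \<in> fracs T" "b \<in> fracs T"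
  then obtain p q r s where *: "a = p / q" "b = r / s" "p \<in> T" "q \<in> T" "r \<in> T" "s \<in> T" "q \<noteq> 0" "s \<noteq> 0"
    unfolding fracs_def by auto
  have "(p * s + r * q) / (q * s) \<in> fracs T" "(p * s - r * q) / (q * s) \<in> fracs T" "(p * r) / (q * s) \<in> fracs T"
    using * T by (auto intro!: fracs_I subring_add subring_mult subring_diff)
  then show "a + b \<in> fracs T" "a - b \<in> fracs T" "a * b \<in> fracs T"
    using *(7,8) unfolding *(1,2) by (simp_all add: add_frac_eq diff_frac_eq)
qed

lemma fracs_inverse: "is_subring T \<Longrightarrow> a \<in> fracs T \<Longrightarrow> inverse a \<in> fracs T"
proof -
  assume T: "is_subring T" and "a \<in> fracs T"
  then obtain p q where *: "a = p / q" "p \<in> T" "q \<in> T" "q \<noteq> 0" unfolding fracs_def by auto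
  show "inverse a \<in> fracs T"
  proof (cases "p = 0")
    case True
    then show ?thesis using T * fracs_base subring_0 by fastforce
  next
    case False
    then show ?thesis using fracs_I[of q T p] * by simp
  qed
qed

lemma common_denominator:
  assumes T: "is_subring T" and f: "\<And>i. i \<in> I \<Longrightarrow> f i \<in> fracs T" and I: "finite I"
  shows "\<exists>g\<in>T. g \<noteq> 0 \<and> (\<forall>i\<in>I. g * f i \<in> T)"
  using I f
proof (induction I rule: finite_induct)
  case empty
  then show ?case using subring_1[OF T] by (auto intro!: bexI[of _ 1])
next
  case (insert i I)
  then obtain g where g: "g \<in> T" "g \<noteq> 0" "\<forall>i\<in>I. g * f i \<in> T" by auto
  obtain a b where ab: "a \<in> T" "b \<in> T" "b \<noteq> 0" "f i = a / b"
    using insert(4)[of i] unfolding fracs_def by auto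
  show ?case
  proof (intro bexI[of _ "g * b"] conjI ballI)
    fix j assume "j \<in> insert i I"
    then show "g * b * f j \<in> T"
    proof
      assume "j = i"
      then have "g * b * f j = g * a" using ab by simp
      moreover have "g * a \<in> T" using T g(1) ab(1) by (rule subring_mult)
      ultimately show ?thesis by (simp only:)
    next
      assume "j \<in> I"
      then have "b * (g * f j) \<in> T" using g(3) ab(2) T by (blast intro: subring_mult)
      then show ?thesis by (simp add: mult_ac)
    qed
  qed (use g ab T in \<open>auto intro: subring_mult\<close>)
qed

text \<open>Finitely many coefficients have a common denominator, so a relation over the fractions
  becomes one over T.\<close>

lemma trans_fracs:
  assumes T: "is_subring T" and x: "trans_over T x"
  shows "trans_over (fracs T) x"
  unfolding trans_over_def
proof (intro allI impI; elim conjE)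
  fix P assume P: "\<forall>i. coeff P i \<in> fracs T" "poly P x = 0"
  obtain g where g: "g \<in> T" "g \<noteq> 0" "\<forall>i\<in>{..degree P}. g * coeff P i \<in> T"
    using common_denominator[OF T, of "{..degree P}" "coeff P"] P by auto
  have "coeff (smult g P) i \<in> T" for i
    using g subring_0[OF T] by (cases "i \<le> degree P") (auto simp: coeff_eq_0)
  moreover have "poly (smult g P) x = 0" using P by simp
  ultimately have "smult g P = 0" using x unfolding trans_over_def by blast
  then show "P = 0" using g by simp
qed

text \<open>A field that contains the Laurent polynomials in the other variables and over which x_k
  is still transcendental; it serves as the ambient K when expansions in x_k are compared.\<close>

definition fracs_without :: "'a::field set \<Rightarrow> ('n::finite \<Rightarrow> 'a) \<Rightarrow> 'n \<Rightarrow> 'a set" where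
  "fracs_without R x k = fracs (lspan R x (\<lambda>m. m k = 0))"

lemma is_subring_fracs_without: "is_subring R \<Longrightarrow> is_subring (fracs_without R x k)"
  by (simp add: fracs_without_def is_subring_fracs is_subring_lspan)

lemma trans_fracs_without: "is_subring R \<Longrightarrow> indep R x \<Longrightarrow> trans_over (fracs_without R x k) (x k)"
  by (simp add: fracs_without_def is_subring_lspan trans_fracs trans_lspan)

lemma fracs_without_inverse: "is_subring R \<Longrightarrow> a \<in> fracs_without R x k \<Longrightarrow> inverse a \<in> fracs_without R x k"
  by (simp add: fracs_without_def fracs_inverse is_subring_lspan)

lemma fracs_without_coeff: "is_subring R \<Longrightarrow> a \<in> R \<Longrightarrow> a \<in> fracs_without R x k"
  using lspan_mon[of a R "\<lambda>m. m k = 0" "\<lambda>_. 0" x]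
  by (simp add: fracs_without_def fracs_base is_subring_lspan)

lemma fracs_without_var:
  assumes R: "is_subring R" and ik: "i \<noteq> k"
  shows "x i \<in> fracs_without R x k"
proof -
  have "1 * mon x (\<lambda>j. if j = i then 1 else 0) \<in> lspan R x (\<lambda>m. m k = 0)"
    by (rule lspan_mon) (use R ik in \<open>auto intro: subring_1\<close>)
  then show ?thesis using R by (simp add: mon_single fracs_without_def fracs_base is_subring_lspan)
qed

lemma indep_nonzero:
  assumes R: "is_subring R" and ind: "indep R x"
  shows "x i \<noteq> 0"
proof
  assume "x i = 0"
  have "(\<lambda>_. 1) (\<lambda>j. if j = i then 1 else 0 :: nat) = (0::'a)"
    by (rule indepD[OF ind, of "{\<lambda>j. if j = i then 1 else 0}"])
      (use \<open>x i = 0\<close> subring_1[OF R] in \<open>auto simp: mon_single\<close>)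
  then show False by simp
qed

text \<open>A relation in x' times x_k^N is a polynomial in x_k over the fractions in the other
  variables, since x'_k = M / x_k turns the e-th power into M^e x_k^(N - e). Transcendence of x_k
  kills each coefficient M^e g_e, and g_e = 0 yields a relation in x itself.\<close>

lemma indep_mutate:
  fixes x x' :: "'n::finite \<Rightarrow> 'a::field"
  assumes R: "is_subring R" and ind: "indep R x"
    and M: "M \<in> fracs_without R x k" "M \<noteq> 0" and x': "\<And>i. i \<noteq> k \<Longrightarrow> x' i = x i" "x k * x' k = M"
  shows "indep R x'"
  unfolding indep_def
proof (intro allI impI; elim conjE)
  fix S :: "('n \<Rightarrow> nat) set" and c
  assume S: "finite S" and c: "\<forall>m\<in>S. c m \<in> R" and sum: "(\<Sum>m\<in>S. c m * mon x' m) = 0"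
  have xk: "x k \<noteq> 0" using indep_nonzero[OF R ind] .
  have x'k: "x' k = M / x k" using x' xk by (simp add: field_simps)
  define N where "N = Max (insert 0 ((\<lambda>m. m k) ` S))"
  have N: "m k \<le> N" if "m \<in> S" for m using that S unfolding N_def by auto
  define T where "T = fracs_without R x k"
  have T: "is_subring T" unfolding T_def by (rule is_subring_fracs_without[OF R])
  \<comment> \<open>\<open>g e\<close> is the coefficient of the e-th power of x'_k, a polynomial in
    the other variables.\<close>
  define g where "g e = (\<Sum>m | m \<in> S \<and> m k = e. c m * mon x (m(k := 0)))" for e
  define P where "P = (\<Sum>e\<le>N. monom (M ^ e * g e) (N - e))"
  have mT: "mon x (m(k := 0)) \<in> T" for m
    unfolding mon_def T_def using R
    by (intro subring_prod[OF is_subring_fracs_without[OF R]])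
      (auto intro!: subring_power[OF is_subring_fracs_without[OF R]] fracs_without_var subring_1[OF is_subring_fracs_without[OF R]])
  have "c m \<in> T" if "m \<in> S" for m unfolding T_def using R c that by (auto intro: fracs_without_coeff)
  then have gT: "g e \<in> T" for e unfolding g_def using T mT by (auto intro!: subring_sum subring_mult)
  have "coeff P i \<in> T" for i
    unfolding P_def coeff_sum using T gT M
    by (auto intro!: subring_sum subring_mult subring_power subring_0 simp: T_def)
  moreover have "poly P (x k) = 0"
  proof -
    have "poly P (x k) = (\<Sum>e\<le>N. \<Sum>m | m \<in> S \<and> m k = e. M ^ e * (c m * mon x (m(k := 0))) * x k ^ (N - e))"
      unfolding P_def g_def by (simp add: poly_sum poly_monom sum_distrib_left sum_distrib_right)
    also have "\<dots> = (\<Sum>e\<le>N. \<Sum>m | m \<in> S \<and> m k = e. x k ^ N * (c m * mon x' m))"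
    proof (intro sum.cong refl)
      fix e m assume "e \<in> {..N}" and m: "m \<in> {m \<in> S. m k = e}"
      then have "x k ^ N = x k ^ (N - e) * x k ^ e" by (simp flip: power_add)
      moreover have "mon x' m = x' k ^ e * mon x (m(k := 0))"
        using m by (subst mon_split[of _ _ k]) (auto intro!: mon_cong[of k] simp: x')
      ultimately show "M ^ e * (c m * mon x (m(k := 0))) * x k ^ (N - e) = x k ^ N * (c m * mon x' m)"
        using xk by (simp add: x'k power_divide)
    qed
    also have "\<dots> = (\<Sum>m\<in>S. x k ^ N * (c m * mon x' m))"
      using sum.group[OF S finite_atMost[of N], of "\<lambda>m. m k" "\<lambda>m. x k ^ N * (c m * mon x' m)"] N
      by (auto simp: image_subset_iff)
    finally show ?thesis using sum by (simp add: sum_distrib_left[symmetric])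
  qed
  ultimately have "P = 0" using trans_fracs_without[OF R ind, of k] unfolding trans_over_def T_def by blast
  have g0: "g e = 0" if "e \<le> N" for e
  proof -
    have "coeff P (N - e) = (\<Sum>e'\<le>N. if e' = e then M ^ e' * g e' else 0)"
      unfolding P_def coeff_sum using that by (intro sum.cong) auto
    also have "\<dots> = M ^ e * g e" using that by simp
    finally show ?thesis using \<open>P = 0\<close> M by simp
  qed
  show "\<forall>m\<in>S. c m = 0"
  proof
    fix m assume m: "m \<in> S"
    define S' where "S' = {m' \<in> S. m' k = m k}"
    have "(\<Sum>m\<in>S'. c m * mon x m) = x k ^ m k * g (m k)"
      unfolding g_def S'_def sum_distrib_left
      by (intro sum.cong refl, subst mon_split[of _ _ k]) auto
    then have "(\<Sum>m\<in>S'. c m * mon x m) = 0" using g0 N[OF m] by simp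
    moreover have "finite S'" "\<And>m. m \<in> S' \<Longrightarrow> c m \<in> R" "m \<in> S'" using S c m unfolding S'_def by auto
    ultimately show "c m = 0" using indepD[OF ind] by blast
  qed
qed

section \<open>Matrix mutation and monomial valuations\<close>

text \<open>Doubling removes the integer division, so that later identities become linear and can be
  transferred to the reals.\<close>

lemma two_matrix_mutation:
  assumes "i \<noteq> k" "j \<noteq> k"
  shows "2 * (matrix_mutation k B $ i $ j - B $ i $ j) = \<bar>B $ i $ k\<bar> * B $ k $ j + B $ i $ k * \<bar>B $ k $ j\<bar>"
proof -
  have "even (\<bar>B $ i $ k\<bar> * B $ k $ j + B $ i $ k * \<bar>B $ k $ j\<bar>)"
    by (cases "B $ i $ k \<ge> 0"; cases "B $ k $ j \<ge> 0") simp_all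
  then show ?thesis using assms by (simp add: matrix_mutation_def)
qed

lemma matrix_mutation_k: "i = k \<or> j = k \<Longrightarrow> matrix_mutation k B $ i $ j = - B $ i $ j"
  by (simp add: matrix_mutation_def)

text \<open>One-sided form of the mutation rule: the sign of b_kj selects the positive or the
  negative part of column k, that is, the exponents of one of the two monomials in the exchange
  polynomial at k.\<close>

lemma matrix_mutation_other:
  assumes "i \<noteq> k" "j \<noteq> k"
  shows "matrix_mutation k B $ i $ j = B $ i $ j +
    (if B $ k $ j \<ge> 0 then max (B $ i $ k) 0 else max (- B $ i $ k) 0) * B $ k $ j"
  using two_matrix_mutation[OF assms, of B] by (auto simp: max_def abs_if algebra_simps split: if_splits)

text \<open>The first mutation negates row and column k, which negates the correction term of the
  second.\<close>

lemma matrix_mutation_involution: "matrix_mutation k (matrix_mutation k B) = B"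
proof -
  have "matrix_mutation k (matrix_mutation k B) $ i $ j = B $ i $ j" for i j
  proof (cases "i = k \<or> j = k")
    case True
    then show ?thesis by (auto simp: matrix_mutation_k)
  next
    case False
    then have ij: "i \<noteq> k" "j \<noteq> k" by auto
    have "2 * (matrix_mutation k (matrix_mutation k B) $ i $ j - matrix_mutation k B $ i $ j) =
        - (2 * (matrix_mutation k B $ i $ j - B $ i $ j))"
      by (simp only: two_matrix_mutation[OF ij]) (simp add: matrix_mutation_k)
    moreover have "a = c" if "2 * (a - b) = - (2 * (b - c))" for a b c :: int
      using that by arith
    ultimately show ?thesis by blast
  qed
  then show ?thesis by (simp add: vec_eq_iff)
qed

lemma sign_skew_symmetricD:
  assumes "sign_skew_symmetric B"
  shows "B $ i $ i = 0" and "B $ i $ j > 0 \<longleftrightarrow> B $ j $ i < 0" and "B $ i $ j = 0 \<longleftrightarrow> B $ j $ i = 0"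
  using assms unfolding sign_skew_symmetric_def
  by (metis not_square_less_zero)
    (use assms in \<open>auto simp: sign_skew_symmetric_def mult_less_0_iff, (metis less_asym less_irrefl)+\<close>)

lemma skew_symmetrizable_imp_sign_skew_symmetric:
  assumes "skew_symmetrizable B"
  shows "sign_skew_symmetric B"
  unfolding sign_skew_symmetric_def
proof (intro allI)
  fix i j
  obtain d :: "'a \<Rightarrow> real" where d: "\<And>i. d i > 0" "\<And>i j. d i * of_int (B $ i $ j) = - (d j * of_int (B $ j $ i))"
    using assms unfolding skew_symmetrizable_def by blast
  show "B $ i $ j = 0 \<and> B $ j $ i = 0 \<or> B $ i $ j * B $ j $ i < 0"
  proof (cases "B $ j $ i = 0")
    case True
    then show ?thesis using d(1)[of i] d(2)[of i j] by simp
  next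
    case False
    have "d i * of_int (B $ i $ j * B $ j $ i) = - (d j * (of_int (B $ j $ i))\<^sup>2)"
      using arg_cong[OF d(2)[of i j], of "\<lambda>z. z * of_int (B $ j $ i)"] by (simp add: power2_eq_square mult.assoc)
    also have "\<dots> < 0" using d(1)[of j] False by simp
    finally have "of_int (B $ i $ j * B $ j $ i) < (0::real)" using d(1)[of i] by (simp only: mult_less_0_iff) auto
    then show ?thesis unfolding of_int_less_0_iff by (rule disjI2)
  qed
qed

text \<open>The same symmetrizer works: by d_i b_ik = - d_k b_ki and its version with absolute
  values, the factor d_i passes through the correction term and comes out as d_j with i and j
  exchanged.\<close>

lemma skew_symmetrizable_mutation:
  assumes "skew_symmetrizable B"
  shows "skew_symmetrizable (matrix_mutation k B)"
proof -
  obtain d :: "'a \<Rightarrow> real" where d: "\<And>i. d i > 0" "\<And>i j. d i * of_int (B $ i $ j) = - (d j * of_int (B $ j $ i))"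
    using assms unfolding skew_symmetrizable_def by blast
  have abs: "d i * \<bar>of_int (B $ i $ j)\<bar> = d j * \<bar>of_int (B $ j $ i)\<bar>" for i j
    using d(1)[of i] d(1)[of j] arg_cong[OF d(2)[of i j], of abs] by (simp add: abs_mult)
  have "d i * of_int (matrix_mutation k B $ i $ j) = - (d j * of_int (matrix_mutation k B $ j $ i))" for i j
  proof (cases "i = k \<or> j = k")
    case True
    then show ?thesis using d(2)[of i j] by (auto simp: matrix_mutation_k)
  next
    case False
    define b where "b i j = real_of_int (B $ i $ j)" for i j
    have two: "2 * (real_of_int (matrix_mutation k B $ i $ j) - b i j) = \<bar>b i k\<bar> * b k j + b i k * \<bar>b k j\<bar>"
      if "i \<noteq> k" "j \<noteq> k" for i j
      using arg_cong[OF two_matrix_mutation[OF that, of B], of real_of_int] unfolding b_def by simp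
    have "d i * (\<bar>b i k\<bar> * b k j + b i k * \<bar>b k j\<bar>) = (d i * \<bar>b i k\<bar>) * b k j + (d i * b i k) * \<bar>b k j\<bar>"
      by (simp add: algebra_simps)
    also have "\<dots> = \<bar>b k i\<bar> * (d k * b k j) - b k i * (d k * \<bar>b k j\<bar>)"
      using d(2)[of i k] abs[of i k] by (simp add: b_def)
    also have "\<dots> = - (d j * (\<bar>b j k\<bar> * b k i + b j k * \<bar>b k i\<bar>))"
      using d(2)[of k j] abs[of k j] by (simp add: b_def algebra_simps)
    finally have "d i * (2 * (real_of_int (matrix_mutation k B $ i $ j) - b i j)) =
        - (d j * (2 * (real_of_int (matrix_mutation k B $ j $ i) - b j i)))"
      using two False by simp
    then show ?thesis using d(2)[of i j] by (simp add: b_def algebra_simps)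
  qed
  then show ?thesis unfolding skew_symmetrizable_def using d(1) by blast
qed

section \<open>Monomial valuations\<close>

definition weight :: "('n::finite \<Rightarrow> real) \<Rightarrow> ('n \<Rightarrow> nat) \<Rightarrow> real" where
  "weight \<phi> m = (\<Sum>i\<in>UNIV. real (m i) * \<phi> i)"

lemma weight_add: "weight \<phi> (\<lambda>i. m i + m' i) = weight \<phi> m + weight \<phi> m'"
  by (simp add: weight_def distrib_right sum.distrib)

text \<open>
  Values are measured by maximal weights, so they satisfy $v(f+g) \le \max(v(f), v(g))$. The weights
  need not separate monomials: \<open>lead\<close> requires the monomial of maximal weight to be unique, and an
  element has a value only if it is a quotient of two such polynomials.
\<close>

definition lead :: "'a::field set \<Rightarrow> ('n::finite \<Rightarrow> 'a) \<Rightarrow> ('n \<Rightarrow> real) \<Rightarrow> real \<Rightarrow> 'a \<Rightarrow> bool" where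
  "lead R x \<phi> \<delta> f \<longleftrightarrow> (\<exists>c m l. c \<in> R \<and> c \<noteq> 0 \<and> weight \<phi> m = \<delta> \<and> l \<in> lspan R x (\<lambda>m. weight \<phi> m < \<delta>) \<and> f = c * mon x m + l)"

definition hasval :: "'a::field set \<Rightarrow> ('n::finite \<Rightarrow> 'a) \<Rightarrow> ('n \<Rightarrow> real) \<Rightarrow> 'a \<Rightarrow> real \<Rightarrow> bool" where
  "hasval R x \<phi> f \<delta> \<longleftrightarrow> (\<exists>P Q \<alpha> \<beta>. lead R x \<phi> \<alpha> P \<and> lead R x \<phi> \<beta> Q \<and> f * Q = P \<and> \<delta> = \<alpha> - \<beta>)"

text \<open>Only the weights in the numerator are bounded, without asking for a unique top monomial.
  A sum of two elements with values may have none, so a subring needs this weaker condition.\<close>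

definition val_nonpos :: "'a::field set \<Rightarrow> ('n::finite \<Rightarrow> 'a) \<Rightarrow> ('n \<Rightarrow> real) \<Rightarrow> 'a set" where
  "val_nonpos R x \<phi> = {f. \<exists>Q \<beta>. lead R x \<phi> \<beta> Q \<and> f * Q \<in> lspan R x (\<lambda>m. weight \<phi> m \<le> \<beta>)}"

context
  fixes R :: "'a::field set" and x :: "'n::finite \<Rightarrow> 'a" and \<phi> :: "'n \<Rightarrow> real"
  assumes R: "is_subring R" and ind: "indep R x"
begin

text \<open>Otherwise the difference would be a relation in which the top monomial has coefficient
  \<open>- c\<close>. This is what makes values meaningful.\<close>

lemma lead_not_lower:
  assumes f: "lead R x \<phi> \<delta> f" "f \<in> lspan R x (\<lambda>m. weight \<phi> m < \<delta>)"
  shows False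
proof -
  obtain c m l where *: "c \<in> R" "c \<noteq> 0" "weight \<phi> m = \<delta>" "l \<in> lspan R x (\<lambda>m. weight \<phi> m < \<delta>)" "f = c * mon x m + l"
    using f unfolding lead_def by auto
  have "f - l \<in> lspan R x (\<lambda>m. weight \<phi> m < \<delta>)" using f * R by (intro lspan_diff)
  from lspan_sumD[OF R this] obtain S d
    where Sd: "finite S \<and> (\<forall>m\<in>S. weight \<phi> m < \<delta> \<and> d m \<in> R) \<and> f - l = (\<Sum>m\<in>S. d m * mon x m)"
    by (elim exE)
  then have S: "finite S" "\<And>m. m \<in> S \<Longrightarrow> weight \<phi> m < \<delta>" "\<And>m. m \<in> S \<Longrightarrow> d m \<in> R"
      "f - l = (\<Sum>m\<in>S. d m * mon x m)"
    by auto
  have m: "m \<notin> S" using S(2) *(3) by blast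
  define e where "e = (\<lambda>m'. if m' = m then - c else d m')"
  have "(\<Sum>m\<in>S. e m * mon x m) = (\<Sum>m\<in>S. d m * mon x m)"
    using m by (intro sum.cong) (auto simp: e_def)
  then have "(\<Sum>m\<in>insert m S. e m * mon x m) = 0"
    using S(1) S(4)[symmetric] m *(5) by (simp add: e_def)
  moreover have "e m' \<in> R" if "m' \<in> insert m S" for m'
    using that S(3) *(1) R by (auto simp: e_def intro: subring_uminus)
  ultimately have "e m = 0" using S(1) indepD[OF ind, of "insert m S" e m] by blast
  then show False using *(2) by (simp add: e_def)
qed

lemma lead_in_le: "lead R x \<phi> \<delta> f \<Longrightarrow> f \<in> lspan R x (\<lambda>m. weight \<phi> m \<le> \<delta>)"
proof -
  assume "lead R x \<phi> \<delta> f"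
  then obtain c m l where *: "c \<in> R" "c \<noteq> 0" "weight \<phi> m = \<delta>" "l \<in> lspan R x (\<lambda>m. weight \<phi> m < \<delta>)" "f = c * mon x m + l"
    unfolding lead_def by auto
  have "l \<in> lspan R x (\<lambda>m. weight \<phi> m \<le> \<delta>)" by (rule lspan_mono[OF *(4)]) simp
  then show ?thesis unfolding *(5) by (intro lspan.step *(1)) (simp_all add: *(3))
qed

lemma lead_in_less: "lead R x \<phi> \<delta> f \<Longrightarrow> \<delta> < \<gamma> \<Longrightarrow> f \<in> lspan R x (\<lambda>m. weight \<phi> m < \<gamma>)"
  by (rule lspan_mono[OF lead_in_le]) auto

lemma lead_add_lower:
  assumes "lead R x \<phi> \<delta> f" "g \<in> lspan R x (\<lambda>m. weight \<phi> m < \<delta>)"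
  shows "lead R x \<phi> \<delta> (f + g)"
proof -
  obtain c m l where *: "c \<in> R" "c \<noteq> 0" "weight \<phi> m = \<delta>" "l \<in> lspan R x (\<lambda>m. weight \<phi> m < \<delta>)" "f = c * mon x m + l"
    using assms unfolding lead_def by auto
  have "f + g = c * mon x m + (l + g)" using *(5) by simp
  moreover have "l + g \<in> lspan R x (\<lambda>m. weight \<phi> m < \<delta>)" using *(4) assms(2) by (rule lspan_add)
  ultimately show ?thesis unfolding lead_def using *(1-3) by blast
qed

lemma lead_mult:
  assumes f: "lead R x \<phi> \<delta> f" and g: "lead R x \<phi> \<gamma> g"
  shows "lead R x \<phi> (\<delta> + \<gamma>) (f * g)"
proof -
  obtain c m l where *: "c \<in> R" "c \<noteq> 0" "weight \<phi> m = \<delta>" "l \<in> lspan R x (\<lambda>m. weight \<phi> m < \<delta>)" "f = c * mon x m + l"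
    using f unfolding lead_def by auto
  obtain c' m' l' where **: "c' \<in> R" "c' \<noteq> 0" "weight \<phi> m' = \<gamma>" "l' \<in> lspan R x (\<lambda>m. weight \<phi> m < \<gamma>)" "g = c' * mon x m' + l'"
    using g unfolding lead_def by auto
  define r where "r = l * g + (c * mon x m) * l'"
  have "l * g \<in> lspan R x (\<lambda>m. weight \<phi> m < \<delta> + \<gamma>)"
    by (rule lspan_mult[OF R *(4) lead_in_le[OF g]]) (auto simp: weight_add)
  moreover have "(c * mon x m) * l' \<in> lspan R x (\<lambda>m. weight \<phi> m < \<delta> + \<gamma>)"
    by (rule lspan_mult[OF R lspan_mon[of c R "\<lambda>m. weight \<phi> m \<le> \<delta>"] **(4)]) (use * in \<open>auto simp: weight_add\<close>)
  ultimately have "r \<in> lspan R x (\<lambda>m. weight \<phi> m < \<delta> + \<gamma>)" unfolding r_def by (rule lspan_add)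
  moreover have "f * g = (c * c') * mon x (\<lambda>i. m i + m' i) + r"
    unfolding r_def *(5) **(5) mon_add by (simp add: algebra_simps)
  moreover have "c * c' \<in> R" "c * c' \<noteq> 0" using * ** R by (auto intro: subring_mult)
  moreover have "weight \<phi> (\<lambda>i. m i + m' i) = \<delta> + \<gamma>" using * ** by (simp add: weight_add)
  ultimately show ?thesis unfolding lead_def by blast
qed

lemma lead_nonzero: "lead R x \<phi> \<delta> f \<Longrightarrow> f \<noteq> 0"
  using lead_not_lower[of \<delta> f] lspan.zero by blast

lemma lead_mon: "c \<in> R \<Longrightarrow> c \<noteq> 0 \<Longrightarrow> lead R x \<phi> (weight \<phi> m) (c * mon x m)"
  unfolding lead_def by (metis add.right_neutral lspan.zero)

lemma lead_coeff: "c \<in> R \<Longrightarrow> c \<noteq> 0 \<Longrightarrow> lead R x \<phi> 0 c"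
  using lead_mon[of c "\<lambda>_. 0"] by (simp add: weight_def)

lemma lead_one: "lead R x \<phi> 0 1"
  using lead_coeff[of 1] subring_1[OF R] by simp

lemma hasval_lead: "lead R x \<phi> \<delta> f \<Longrightarrow> hasval R x \<phi> f \<delta>"
  unfolding hasval_def using lead_one by (metis diff_zero mult.right_neutral)

lemma hasval_coeff: "c \<in> R \<Longrightarrow> c \<noteq> 0 \<Longrightarrow> hasval R x \<phi> c 0"
  by (rule hasval_lead[OF lead_coeff])

lemma hasval_var: "hasval R x \<phi> (x i) (\<phi> i)"
proof -
  have "lead R x \<phi> (weight \<phi> (\<lambda>j. if j = i then 1 else 0)) (1 * mon x (\<lambda>j. if j = i then 1 else 0))"
    by (rule lead_mon) (auto intro: subring_1[OF R])
  moreover have "weight \<phi> (\<lambda>j. if j = i then 1 else 0) = (\<Sum>j\<in>UNIV. if j = i then \<phi> i else 0)"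
    unfolding weight_def by (rule sum.cong) auto
  ultimately show ?thesis by (intro hasval_lead) (simp add: mon_single)
qed

lemma hasval_nonzero: "hasval R x \<phi> f \<delta> \<Longrightarrow> f \<noteq> 0"
  unfolding hasval_def using lead_nonzero by fastforce

lemma hasval_mult:
  assumes "hasval R x \<phi> f \<delta>" "hasval R x \<phi> g \<gamma>"
  shows "hasval R x \<phi> (f * g) (\<delta> + \<gamma>)"
proof -
  obtain P Q \<alpha> \<beta> where f: "lead R x \<phi> \<alpha> P" "lead R x \<phi> \<beta> Q" "f * Q = P" "\<delta> = \<alpha> - \<beta>"
    using assms(1) unfolding hasval_def by auto
  obtain P' Q' \<alpha>' \<beta>' where g: "lead R x \<phi> \<alpha>' P'" "lead R x \<phi> \<beta>' Q'" "g * Q' = P'" "\<gamma> = \<alpha>' - \<beta>'"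
    using assms(2) unfolding hasval_def by auto
  have "(f * g) * (Q * Q') = P * P'" unfolding f(3)[symmetric] g(3)[symmetric] by (simp add: mult_ac)
  moreover have "\<delta> + \<gamma> = (\<alpha> + \<alpha>') - (\<beta> + \<beta>')" using f g by simp
  ultimately show ?thesis unfolding hasval_def using lead_mult f(1,2) g(1,2) by blast
qed

lemma hasval_divide:
  assumes "hasval R x \<phi> f \<delta>" "hasval R x \<phi> g \<gamma>"
  shows "hasval R x \<phi> (f / g) (\<delta> - \<gamma>)"
proof -
  obtain P Q \<alpha> \<beta> where f: "lead R x \<phi> \<alpha> P" "lead R x \<phi> \<beta> Q" "f * Q = P" "\<delta> = \<alpha> - \<beta>"
    using assms(1) unfolding hasval_def by auto
  obtain P' Q' \<alpha>' \<beta>' where g: "lead R x \<phi> \<alpha>' P'" "lead R x \<phi> \<beta>' Q'" "g * Q' = P'" "\<gamma> = \<alpha>' - \<beta>'"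
    using assms(2) unfolding hasval_def by auto
  have "(f / g) * (Q * P') = P * Q'"
    unfolding f(3)[symmetric] g(3)[symmetric] using hasval_nonzero[OF assms(2)] by simp
  moreover have "\<delta> - \<gamma> = (\<alpha> + \<beta>') - (\<beta> + \<alpha>')" using f g by simp
  ultimately show ?thesis unfolding hasval_def using lead_mult f(1,2) g(1,2) by blast
qed

text \<open>The strict inequality excludes cancellation of top monomials: over the common
  denominator, g contributes only lower terms.\<close>

lemma hasval_add:
  assumes "hasval R x \<phi> f \<delta>" "hasval R x \<phi> g \<gamma>" "\<gamma> < \<delta>"
  shows "hasval R x \<phi> (f + g) \<delta>"
proof -
  obtain P Q \<alpha> \<beta> where f: "lead R x \<phi> \<alpha> P" "lead R x \<phi> \<beta> Q" "f * Q = P" "\<delta> = \<alpha> - \<beta>"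
    using assms(1) unfolding hasval_def by auto
  obtain P' Q' \<alpha>' \<beta>' where g: "lead R x \<phi> \<alpha>' P'" "lead R x \<phi> \<beta>' Q'" "g * Q' = P'" "\<gamma> = \<alpha>' - \<beta>'"
    using assms(2) unfolding hasval_def by auto
  have "lead R x \<phi> (\<alpha> + \<beta>') (P * Q' + P' * Q)"
    using f g assms(3) by (intro lead_add_lower lead_mult lead_in_less[OF lead_mult]) auto
  moreover have "(f + g) * (Q * Q') = P * Q' + P' * Q"
    unfolding f(3)[symmetric] g(3)[symmetric] by (simp add: algebra_simps)
  moreover have "\<delta> = (\<alpha> + \<beta>') - (\<beta> + \<beta>')" using f g by simp
  ultimately show ?thesis unfolding hasval_def using lead_mult[OF f(2) g(2)] by blast
qed

lemma hasval_power: "hasval R x \<phi> f \<delta> \<Longrightarrow> hasval R x \<phi> (f ^ n) (real n * \<delta>)"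
proof (induction n)
  case 0
  then show ?case using hasval_lead[OF lead_one] by simp
next
  case (Suc n)
  then show ?case using hasval_mult[of f \<delta> "f ^ n" "real n * \<delta>"] by (simp add: algebra_simps)
qed

lemma hasval_prod:
  "(\<And>i. i \<in> I \<Longrightarrow> hasval R x \<phi> (f i) (\<delta> i)) \<Longrightarrow> finite I \<Longrightarrow> hasval R x \<phi> (\<Prod>i\<in>I. f i) (\<Sum>i\<in>I. \<delta> i)"
proof (induction I rule: infinite_finite_induct)
  case empty
  then show ?case using hasval_lead[OF lead_one] by simp
next
  case (insert i I)
  then show ?case by (simp add: hasval_mult)
qed simp

lemma is_subring_val_nonpos: "is_subring (val_nonpos R x \<phi>)"
  unfolding is_subring_def
proof (intro conjI ballI)
  show "1 \<in> val_nonpos R x \<phi>"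
    unfolding val_nonpos_def using lead_one lead_in_le[OF lead_one]
    by (intro CollectI exI[of _ "1::'a"] exI[of _ "0::real"]) simp
  fix f g assume "f \<in> val_nonpos R x \<phi>" "g \<in> val_nonpos R x \<phi>"
  then obtain P \<alpha> Q \<beta> where f: "lead R x \<phi> \<alpha> P" "f * P \<in> lspan R x (\<lambda>m. weight \<phi> m \<le> \<alpha>)"
    and g: "lead R x \<phi> \<beta> Q" "g * Q \<in> lspan R x (\<lambda>m. weight \<phi> m \<le> \<beta>)"
    unfolding val_nonpos_def by auto
  have 1: "(f * P) * Q \<in> lspan R x (\<lambda>m. weight \<phi> m \<le> \<alpha> + \<beta>)"
    by (rule lspan_mult[OF R f(2) lead_in_le[OF g(1)]]) (auto simp: weight_add)
  have 2: "P * (g * Q) \<in> lspan R x (\<lambda>m. weight \<phi> m \<le> \<alpha> + \<beta>)"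
    by (rule lspan_mult[OF R lead_in_le[OF f(1)] g(2)]) (auto simp: weight_add)
  have 3: "(f * P) * (g * Q) \<in> lspan R x (\<lambda>m. weight \<phi> m \<le> \<alpha> + \<beta>)"
    by (rule lspan_mult[OF R f(2) g(2)]) (auto simp: weight_add)
  have "(f + g) * (P * Q) = (f * P) * Q + P * (g * Q)" "(f - g) * (P * Q) = (f * P) * Q - P * (g * Q)"
    "(f * g) * (P * Q) = (f * P) * (g * Q)" by (simp_all add: algebra_simps)
  then have "(f + g) * (P * Q) \<in> lspan R x (\<lambda>m. weight \<phi> m \<le> \<alpha> + \<beta>)"
    "(f - g) * (P * Q) \<in> lspan R x (\<lambda>m. weight \<phi> m \<le> \<alpha> + \<beta>)"
    "(f * g) * (P * Q) \<in> lspan R x (\<lambda>m. weight \<phi> m \<le> \<alpha> + \<beta>)"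
    using 1 2 3 R by (simp_all only: lspan_add lspan_diff)
  then show "f + g \<in> val_nonpos R x \<phi>" "f - g \<in> val_nonpos R x \<phi>" "f * g \<in> val_nonpos R x \<phi>"
    unfolding val_nonpos_def using lead_mult[OF f(1) g(1)] by blast+
qed

lemma val_nonpos_coeff: "c \<in> R \<Longrightarrow> c \<in> val_nonpos R x \<phi>"
  unfolding val_nonpos_def using lead_one lspan_mon[of c R "\<lambda>m. weight \<phi> m \<le> 0" "\<lambda>_. 0" x]
  by (intro CollectI exI[of _ "1::'a"] exI[of _ "0::real"]) (simp add: weight_def)

lemma val_nonpos_hasval: "hasval R x \<phi> f \<delta> \<Longrightarrow> \<delta> \<le> 0 \<Longrightarrow> f \<in> val_nonpos R x \<phi>"
  unfolding hasval_def val_nonpos_def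
  by clarsimp (metis (no_types, lifting) lead_in_le lspan_mono order_trans)

text \<open>Clearing both denominators places \<open>P * Q'\<close>, whose top weight is \<alpha> +
  \<beta>', among the polynomials of weight at most \<beta> + \<beta>', although \<alpha> >
  \<beta>.\<close>

lemma hasval_pos_notin_val_nonpos:
  assumes "hasval R x \<phi> f \<delta>" "0 < \<delta>"
  shows "f \<notin> val_nonpos R x \<phi>"
proof
  assume "f \<in> val_nonpos R x \<phi>"
  then obtain Q' \<beta>' where g: "lead R x \<phi> \<beta>' Q'" "f * Q' \<in> lspan R x (\<lambda>m. weight \<phi> m \<le> \<beta>')"
    unfolding val_nonpos_def by auto
  obtain P Q \<alpha> \<beta> where f: "lead R x \<phi> \<alpha> P" "lead R x \<phi> \<beta> Q" "f * Q = P" "\<delta> = \<alpha> - \<beta>"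
    using assms(1) unfolding hasval_def by auto
  have "(f * Q') * Q \<in> lspan R x (\<lambda>m. weight \<phi> m < \<alpha> + \<beta>')"
    by (rule lspan_mult[OF R g(2) lead_in_le[OF f(2)]]) (use f(4) assms(2) in \<open>auto simp: weight_add\<close>)
  moreover have "(f * Q') * Q = P * Q'" using f(3) by (simp add: mult_ac)
  ultimately show False using lead_not_lower[OF lead_mult[OF f(1) g(1)]] by simp
qed

end

section \<open>Seeds and mutation equivalence\<close>

lemma sum_UNIV3:
  assumes "UNIV = {i, j, k}" "i \<noteq> j" "i \<noteq> k" "j \<noteq> k"
  shows "sum f UNIV = f i + f j + (f k :: 'b::comm_monoid_add)"
  unfolding assms(1) using assms(2-4) by (simp add: add.assoc)

lemma prod_UNIV3:
  assumes "UNIV = {i, j, k}" "i \<noteq> j" "i \<noteq> k" "j \<noteq> k"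
  shows "prod f UNIV = f i * f j * (f k :: 'b::comm_monoid_mult)"
  unfolding assms(1) using assms(2-4) by (simp add: mult.assoc)

lemma UNIV_eq3:
  fixes i j k :: "'n::finite"
  assumes "CARD('n) = 3" "i \<noteq> j" "i \<noteq> k" "j \<noteq> k"
  shows "UNIV = {i, j, k}"
proof -
  have "{i, j, k} = UNIV" by (rule card_subset_eq) (use assms in auto)
  then show ?thesis by simp
qed

lemma indep_reindex:
  fixes x :: "'n::finite \<Rightarrow> 'a::field" and \<sigma> :: "'n \<Rightarrow> 'n"
  assumes "indep R x" "bij \<sigma>"
  shows "indep R (\<lambda>i. x (\<sigma> i))"
  unfolding indep_def
proof (intro allI impI; elim conjE)
  fix S :: "('n \<Rightarrow> nat) set" and c
  assume S: "finite S" "\<forall>m\<in>S. c m \<in> R" "(\<Sum>m\<in>S. c m * mon (\<lambda>i. x (\<sigma> i)) m) = 0"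
  define h where "h m = m \<circ> inv \<sigma>" for m :: "'n \<Rightarrow> nat"
  have hinv: "h m \<circ> \<sigma> = m" for m unfolding h_def using assms(2) by (simp add: fun_eq_iff bij_is_inj)
  then have inj: "inj_on h S" by (metis inj_onI)
  have "mon (\<lambda>i. x (\<sigma> i)) m = mon x (h m)" for m
  proof -
    have "mon x (h m) = (\<Prod>i\<in>UNIV. x (\<sigma> i) ^ h m (\<sigma> i))"
      unfolding mon_def by (rule prod.reindex_bij_betw[OF assms(2), symmetric])
    moreover have "h m (\<sigma> i) = m i" for i using fun_cong[OF hinv[of m], of i] by simp
    ultimately show ?thesis by (simp add: mon_def)
  qed
  then have "(\<Sum>m\<in>h ` S. c (m \<circ> \<sigma>) * mon x m) = 0"
    using S(3) by (simp add: sum.reindex[OF inj] hinv)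
  moreover have "finite (h ` S)" "\<And>m. m \<in> h ` S \<Longrightarrow> c (m \<circ> \<sigma>) \<in> R"
    using S(1,2) hinv by auto
  ultimately have "c (h m \<circ> \<sigma>) = 0" if "m \<in> S" for m
    using indepD[OF assms(1), of "h ` S" "\<lambda>m. c (m \<circ> \<sigma>)" "h m"] that by blast
  then show "\<forall>m\<in>S. c m = 0" by (simp add: hinv)
qed

lemma int_multiple_uminus: "int_multiple (- k) p = - int_multiple k p"
  using int_multiple_add[of k "- k" p] by (simp add: eq_neg_iff_add_eq_0 add.commute)

section \<open>The group ring inside the field\<close>

locale group_ring_embedded =
  fixes \<iota> :: "('p::ab_group_add \<Rightarrow>\<^sub>0 int) \<Rightarrow> 'f::field"
  assumes emb: "group_ring_embedding \<iota>"
begin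

lemma iota_1: "\<iota> 1 = 1" and iota_add: "\<iota> (a + b) = \<iota> a + \<iota> b"
  and iota_mult: "\<iota> (a * b) = \<iota> a * \<iota> b" and iota_inj: "\<iota> a = \<iota> b \<longleftrightarrow> a = b"
  using emb unfolding group_ring_embedding_def by (auto dest: injD)

lemma iota_0: "\<iota> 0 = 0"
  using iota_add[of 0 0] by (metis add.right_neutral add_left_cancel)

lemma iota_diff: "\<iota> (a - b) = \<iota> a - \<iota> b"
  using iota_add[of "a - b" b] by simp

lemma iota_eq_0: "\<iota> a = 0 \<longleftrightarrow> a = 0"
  using iota_inj[of a 0] iota_0 by simp

lemma is_subring_iota: "is_subring (range \<iota>)"
  unfolding is_subring_def
  by (metis (no_types, lifting) iota_1 iota_add iota_diff iota_mult imageE rangeI)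

lemma is_subalgebra_iff: "is_subalgebra \<iota> A \<longleftrightarrow> range \<iota> \<subseteq> A \<and> is_subring A"
proof -
  have "range \<iota> \<subseteq> A \<Longrightarrow> 1 \<in> A" using iota_1 by (metis rangeI subsetD)
  then show ?thesis unfolding is_subalgebra_def is_subring_def by auto
qed

lemma hull_eq_gen: "is_subalgebra \<iota> hull X = gen (range \<iota> \<union> X)"
proof (rule hull_unique)
  show "X \<subseteq> gen (range \<iota> \<union> X)" by (auto intro: gen_base)
  show "is_subalgebra \<iota> (gen (range \<iota> \<union> X))"
    unfolding is_subalgebra_iff using is_subring_gen by (auto intro: gen_base)
  show "gen (range \<iota> \<union> X) \<subseteq> T" if "X \<subseteq> T" "is_subalgebra \<iota> T" for T
    using that unfolding is_subalgebra_iff by (intro gen_least) auto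
qed

lemma coeff_field_eq: "coeff_field \<iota> = fracs (range \<iota>)"
proof -
  have "\<iota> a / \<iota> b \<in> fracs (range \<iota>)" if "b \<noteq> 0" for a b
    by (rule fracs_I) (use that iota_eq_0 in auto)
  moreover have "\<iota> a / \<iota> b \<in> coeff_field \<iota>" if "\<iota> b \<noteq> 0" for a b
    using that unfolding coeff_field_def iota_eq_0 by blast
  ultimately show ?thesis
    unfolding fracs_def by (auto simp: coeff_field_def)
qed

lemma is_subring_coeff_field: "is_subring (coeff_field \<iota>)"
  by (simp add: coeff_field_eq is_subring_fracs is_subring_iota)

lemma range_iota_subset_coeff_field: "range \<iota> \<subseteq> coeff_field \<iota>"
  unfolding coeff_field_eq using fracs_base[OF is_subring_iota] by blast

lemma group_elt_in: "group_elt \<iota> p \<in> range \<iota>"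
  by (simp add: group_elt_def)

lemma group_elt_add: "group_elt \<iota> (p + q) = group_elt \<iota> p * group_elt \<iota> q"
  by (simp add: group_elt_def flip: iota_mult add: mult_single)

lemma group_elt_0: "group_elt \<iota> 0 = 1"
  by (simp add: group_elt_def iota_1)

lemma group_elt_nonzero: "group_elt \<iota> p \<noteq> 0"
proof -
  have "group_elt \<iota> p * group_elt \<iota> (- p) = 1"
    by (simp flip: group_elt_add add: group_elt_0)
  then show ?thesis by auto
qed

lemma group_elt_uminus: "group_elt \<iota> (- p) = inverse (group_elt \<iota> p)"
proof -
  have "group_elt \<iota> p * group_elt \<iota> (- p) = 1"
    by (simp flip: group_elt_add add: group_elt_0)
  then show ?thesis by (simp add: inverse_unique)
qed

text \<open>The coefficient of p in the group ring is 1 or 2. This covers an exchange polynomial in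
  which both monomials are 1.\<close>

lemma group_elt_sum_nonzero: "group_elt \<iota> p + group_elt \<iota> q \<noteq> 0"
proof
  assume "group_elt \<iota> p + group_elt \<iota> q = 0"
  then have "Poly_Mapping.single p 1 + Poly_Mapping.single q (1::int) = 0"
    unfolding group_elt_def by (simp flip: iota_add add: iota_eq_0)
  then have "Poly_Mapping.lookup (Poly_Mapping.single p 1 + Poly_Mapping.single q (1::int)) p = 0"
    by simp
  then show False by (simp add: lookup_add lookup_single when_def split: if_splits)
qed

text \<open>\<open>nat\<close> of a negative entry is 0, so both products may range over all
  vertices and become monomials.\<close>

lemma exchange_rhs_UNIV:
  fixes S :: "('n::finite, 'p, 'f) seed"
  shows "exchange_rhs \<iota> S j =
     group_elt \<iota> (coeff_pos S j) * mon (cluster S) (\<lambda>i. nat (exchange_matrix S $ i $ j)) +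
     group_elt \<iota> (coeff_neg S j) * mon (cluster S) (\<lambda>i. nat (- exchange_matrix S $ i $ j))"
proof -
  have "(\<Prod>i\<in>{i. f i > 0}. x i ^ nat (f i)) = mon x (\<lambda>i. nat (f i))"
    for x :: "'n \<Rightarrow> 'f" and f :: "'n \<Rightarrow> int"
    unfolding mon_def by (rule prod.mono_neutral_left) (auto simp: not_less)
  from this[of "cluster S" "\<lambda>i. exchange_matrix S $ i $ j"] this[of "cluster S" "\<lambda>i. - exchange_matrix S $ i $ j"]
  show ?thesis unfolding exchange_rhs_def Let_def by simp
qed

lemma seed_indep:
  assumes "is_seed \<iota> S"
  shows "indep (coeff_field \<iota>) (cluster S)"
  using assms algebraically_independent_iff_indep[OF subring_0[OF is_subring_coeff_field]]
  unfolding is_seed_def free_generators_def by blast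

lemma seed_indep_range:
  assumes "is_seed \<iota> S"
  shows "indep (range \<iota>) (cluster S)"
  by (rule indep_subset[OF seed_indep[OF assms] range_iota_subset_coeff_field])

lemma cluster_nonzero: "is_seed \<iota> S \<Longrightarrow> cluster S i \<noteq> 0"
  by (rule indep_nonzero[OF is_subring_coeff_field seed_indep])

text \<open>The two exponent vectors have disjoint supports. They coincide only if both vanish,
  where a sum of two group elements remains; otherwise independence applies to two distinct
  monomials.\<close>

lemma exchange_rhs_nonzero:
  fixes S :: "('n::finite, 'p, 'f) seed"
  assumes "is_seed \<iota> S"
  shows "exchange_rhs \<iota> S k \<noteq> 0"
proof
  assume 0: "exchange_rhs \<iota> S k = 0"
  define b where "b i = exchange_matrix S $ i $ k" for i
  define m1 m2 where "m1 = (\<lambda>i. nat (b i))" and "m2 = (\<lambda>i. nat (- b i))"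
  have eq: "group_elt \<iota> (coeff_pos S k) * mon (cluster S) m1 + group_elt \<iota> (coeff_neg S k) * mon (cluster S) m2 = 0"
    using 0 unfolding exchange_rhs_UNIV m1_def m2_def b_def .
  show False
  proof (cases "m1 = m2")
    case True
    have "m1 i = 0" for i using fun_cong[OF True, of i] unfolding m1_def m2_def by simp
    then have "m1 = (\<lambda>_. 0)" "m2 = (\<lambda>_. 0)" using True by auto
    with eq show False using group_elt_sum_nonzero by simp
  next
    case False
    define c where "c m = (if m = m1 then group_elt \<iota> (coeff_pos S k) else group_elt \<iota> (coeff_neg S k))" for m
    have "(\<Sum>m\<in>{m1, m2}. c m * mon (cluster S) m) = 0"
      using False eq by (simp add: c_def)
    then have "c m1 = 0"
      by (intro indepD[OF seed_indep_range[OF assms], of "{m1, m2}" c m1]) (auto simp: c_def group_elt_in)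
    then show False by (simp add: c_def group_elt_nonzero)
  qed
qed

lemma is_subfield_imp_subring: "is_subfield L \<Longrightarrow> is_subring L"
  unfolding is_subfield_def is_subring_def by blast

lemma is_subfield_hull: "is_subfield (is_subfield hull X)"
  by (rule hull_in) (unfold is_subfield_def, blast)

lemma exchange_rhs_in_subring:
  assumes T: "is_subring T" and "range \<iota> \<subseteq> T" and "\<And>i. i \<noteq> k \<Longrightarrow> cluster S i \<in> T"
    and "sign_skew_symmetric (exchange_matrix S)"
  shows "exchange_rhs \<iota> S k \<in> T"
proof -
  have "mon (cluster S) m \<in> T" if "m k = 0" for m
    unfolding mon_def using assms that by (intro subring_prod[OF T]) (metis power_0 subring_1 subring_power)
  moreover have "group_elt \<iota> p \<in> T" for p using assms group_elt_in by blast
  ultimately show ?thesis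
    unfolding exchange_rhs_UNIV using sign_skew_symmetricD(1)[OF assms(4)]
    by (intro subring_add[OF T] subring_mult[OF T]) auto
qed

text \<open>The exchange polynomial is free of x_k, so independence passes to the new cluster; and
  x_k is the exchange polynomial divided by x'_k, so the generated field is unchanged.\<close>

lemma free_generators_mutate:
  assumes S: "is_seed \<iota> S"
  shows "free_generators \<iota> ((cluster S)(k := exchange_rhs \<iota> S k / cluster S k))"
proof -
  let ?x = "cluster S" and ?K = "coeff_field \<iota>"
  let ?x' = "(cluster S)(k := exchange_rhs \<iota> S k / cluster S k)"
  have K: "is_subring ?K" by (rule is_subring_coeff_field)
  have sk: "sign_skew_symmetric (exchange_matrix S)" using S unfolding is_seed_def by blast
  have "exchange_rhs \<iota> S k \<in> fracs_without ?K ?x k"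
    by (rule exchange_rhs_in_subring[OF is_subring_fracs_without[OF K] _ _ sk])
      (use range_iota_subset_coeff_field K in \<open>auto intro: fracs_without_coeff fracs_without_var\<close>)
  then have "indep ?K ?x'"
    by (rule indep_mutate[OF K seed_indep[OF S]]) (use exchange_rhs_nonzero[OF S] cluster_nonzero[OF S] in auto)
  moreover have "is_subfield hull (?K \<union> range ?x') = UNIV"
  proof -
    define L where "L = is_subfield hull (?K \<union> range ?x')"
    have L: "is_subfield L" unfolding L_def by (rule is_subfield_hull)
    have sub: "?K \<union> range ?x' \<subseteq> L" unfolding L_def by (rule hull_subset)
    have other: "?x i \<in> L" if "i \<noteq> k" for i using sub that by (metis UnI2 fun_upd_apply rangeI subsetD)
    have rhs: "exchange_rhs \<iota> S k \<in> L"
      by (rule exchange_rhs_in_subring[OF is_subfield_imp_subring[OF L] _ other sk])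
        (use sub range_iota_subset_coeff_field in auto)
    have "?x' k \<in> L" using sub by blast
    then have "inverse (?x' k) \<in> L" using L unfolding is_subfield_def by blast
    then have "exchange_rhs \<iota> S k * inverse (?x' k) \<in> L"
      using rhs L unfolding is_subfield_def by blast
    then have "?x k \<in> L" using exchange_rhs_nonzero[OF S] cluster_nonzero[OF S] by simp
    then have "?K \<union> range ?x \<subseteq> L" using other sub by (metis Un_subset_iff image_subset_iff)
    then have "is_subfield hull (?K \<union> range ?x) \<subseteq> L" using L by (rule hull_minimal)
    then show ?thesis using S unfolding is_seed_def free_generators_def L_def by auto
  qed
  ultimately show ?thesis
    unfolding free_generators_def
    using algebraically_independent_iff_indep[OF subring_0[OF is_subring_coeff_field]] by blast
qed

lemma seed_mutation_exists:
  fixes S :: "('n::finite, 'p, 'f) seed"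
  assumes S: "is_seed \<iota> S" and sk: "skew_symmetrizable (exchange_matrix S)"
  shows "\<exists>S'. seed_mutation \<iota> k S S'"
proof -
  define b where "b i = exchange_matrix S $ k $ i" for i
  \<comment> \<open>Only ratios are prescribed away from k; taking 0, the neutral element, for the
    negative coefficient puts the whole ratio into the positive one.\<close>
  define S' :: "('n, 'p, 'f) seed" where "S' = \<lparr>cluster = (cluster S)(k := exchange_rhs \<iota> S k / cluster S k),
    coeff_pos = (\<lambda>i. if i = k then coeff_neg S k else
      int_multiple (b i) (if b i \<ge> 0 then coeff_pos S k else coeff_neg S k) + (coeff_pos S i - coeff_neg S i)),
    coeff_neg = (\<lambda>i. if i = k then coeff_pos S k else 0),
    exchange_matrix = matrix_mutation k (exchange_matrix S)\<rparr>"
  have "is_seed \<iota> S'"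
    unfolding is_seed_def S'_def
    using free_generators_mutate[OF S] skew_symmetrizable_imp_sign_skew_symmetric[OF skew_symmetrizable_mutation[OF sk]]
    by simp
  then have "seed_mutation \<iota> k S S'"
    unfolding seed_mutation_def Let_def using S cluster_nonzero[OF S, of k]
    by (auto simp: S'_def b_def order_antisym_conv)
  then show ?thesis by blast
qed

text \<open>Column k changes sign while the two coefficients at k are swapped, so the exchange
  polynomial is the same. Row k changes sign too, so mutating back multiplies each ratio by the
  inverse factor.\<close>

lemma seed_mutation_sym:
  assumes "seed_mutation \<iota> k S S'"
  shows "seed_mutation \<iota> k S' S"
proof -
  have B': "exchange_matrix S' = matrix_mutation k (exchange_matrix S)"
    and x: "cluster S k * cluster S' k = exchange_rhs \<iota> S k" "\<And>i. i \<noteq> k \<Longrightarrow> cluster S' i = cluster S i"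
    and c: "coeff_pos S' k = coeff_neg S k" "coeff_neg S' k = coeff_pos S k"
    and seeds: "is_seed \<iota> S" "is_seed \<iota> S'"
    and r: "\<And>i. i \<noteq> k \<Longrightarrow> (let b = exchange_matrix S $ k $ i in
           (b \<ge> 0 \<longrightarrow> coeff_pos S' i - coeff_neg S' i =
              int_multiple b (coeff_pos S k) + (coeff_pos S i - coeff_neg S i)) \<and>
           (b \<le> 0 \<longrightarrow> coeff_pos S' i - coeff_neg S' i =
              int_multiple b (coeff_neg S k) + (coeff_pos S i - coeff_neg S i)))"
    using assms unfolding seed_mutation_def by blast+
  have kk: "exchange_matrix S $ k $ k = 0"
    using seeds(1) sign_skew_symmetricD(1) unfolding is_seed_def by blast
  have m: "mon (cluster S') m = mon (cluster S) m" if "m k = 0" for m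
    by (rule mon_cong[of k]) (use x that in auto)
  have "exchange_rhs \<iota> S' k = exchange_rhs \<iota> S k"
    unfolding exchange_rhs_UNIV B' by (simp add: matrix_mutation_k c m kk)
  moreover have "exchange_matrix S = matrix_mutation k (exchange_matrix S')"
    unfolding B' by (simp add: matrix_mutation_involution)
  ultimately show ?thesis
    unfolding seed_mutation_def Let_def
    using seeds x c r unfolding Let_def
    by (auto simp: B' matrix_mutation_k int_multiple_uminus mult.commute)
qed

end

lemma seed_relabeling_sym:
  assumes "seed_relabeling S S'"
  shows "seed_relabeling S' S"
proof -
  obtain \<sigma> where \<sigma>: "bij \<sigma>"
    "\<forall>i. cluster S' i = cluster S (\<sigma> i) \<and> coeff_pos S' i = coeff_pos S (\<sigma> i) \<and> coeff_neg S' i = coeff_neg S (\<sigma> i)"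
    "\<forall>i j. exchange_matrix S' $ i $ j = exchange_matrix S $ \<sigma> i $ \<sigma> j"
    using assms unfolding seed_relabeling_def by blast
  then show ?thesis
    unfolding seed_relabeling_def
    by (intro exI[of _ "inv \<sigma>"]) (auto simp: bij_imp_bij_inv bij_inv_eq_iff bij_is_surj surj_f_inv_f)
qed

context group_ring_embedded
begin

lemma mutation_equivalent_refl: "mutation_equivalent \<iota> S S"
  by (simp add: mutation_equivalent_def)

lemma mutation_equivalent_sym: "mutation_equivalent \<iota> S S' \<Longrightarrow> mutation_equivalent \<iota> S' S"
  unfolding mutation_equivalent_def by (rule equivclp_sym)

lemma mutation_equivalent_trans:
  "mutation_equivalent \<iota> S S' \<Longrightarrow> mutation_equivalent \<iota> S' S'' \<Longrightarrow> mutation_equivalent \<iota> S S''"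
  unfolding mutation_equivalent_def by (rule equivclp_trans)

lemma mutation_equivalent_mutation: "seed_mutation \<iota> k S S' \<Longrightarrow> mutation_equivalent \<iota> S S'"
  unfolding mutation_equivalent_def by (rule r_into_equivclp) blast

text \<open>A step of the equivalence closure may run backwards, but mutations and relabelings are
  symmetric relations, so forward steps suffice.\<close>

lemma mutation_equivalent_induct [consumes 1, case_names base mutate relabel]:
  assumes "mutation_equivalent \<iota> S0 S" "P S0"
    and "\<And>S S' k. mutation_equivalent \<iota> S0 S \<Longrightarrow> P S \<Longrightarrow> seed_mutation \<iota> k S S' \<Longrightarrow> P S'"
    and "\<And>S S'. mutation_equivalent \<iota> S0 S \<Longrightarrow> P S \<Longrightarrow> seed_relabeling S S' \<Longrightarrow> P S'"
  shows "P S"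
  using assms(1) unfolding mutation_equivalent_def
proof (induction rule: equivclp_induct)
  case (step S S')
  then show ?case
    using assms(3,4)[unfolded mutation_equivalent_def] seed_mutation_sym seed_relabeling_sym by blast
qed (rule assms(2))

lemma cluster_algebra_cong:
  "mutation_equivalent \<iota> S S' \<Longrightarrow> cluster_algebra \<iota> S = cluster_algebra \<iota> S'"
proof -
  assume "mutation_equivalent \<iota> S S'"
  then have "{S''. mutation_equivalent \<iota> S S''} = {S''. mutation_equivalent \<iota> S' S''}"
    using mutation_equivalent_sym mutation_equivalent_trans by blast
  then show ?thesis unfolding cluster_algebra_def by simp
qed

lemma is_seed_relabeling:
  assumes "seed_relabeling S S'" "is_seed \<iota> S"
  shows "is_seed \<iota> S'"
proof -
  obtain \<sigma> where \<sigma>: "bij \<sigma>" "\<And>i. cluster S' i = cluster S (\<sigma> i)"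
    "\<And>i j. exchange_matrix S' $ i $ j = exchange_matrix S $ \<sigma> i $ \<sigma> j"
    using assms(1) unfolding seed_relabeling_def by blast
  have x: "cluster S' = (\<lambda>i. cluster S (\<sigma> i))" using \<sigma> by auto
  have "range (cluster S') = range (cluster S)"
    unfolding x using \<sigma>(1) by (metis bij_is_surj image_image)
  moreover have "indep (coeff_field \<iota>) (cluster S')"
    unfolding x by (rule indep_reindex[OF seed_indep[OF assms(2)] \<sigma>(1)])
  ultimately show ?thesis
    using assms(2) unfolding is_seed_def free_generators_def
    by (simp add: algebraically_independent_iff_indep[OF subring_0[OF is_subring_coeff_field]]
        sign_skew_symmetric_def \<sigma>(3))
qed

lemma skew_symmetrizable_relabeling:
  assumes "seed_relabeling S S'" "skew_symmetrizable (exchange_matrix S)"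
  shows "skew_symmetrizable (exchange_matrix S')"
proof -
  obtain \<sigma> where B: "\<And>i j. exchange_matrix S' $ i $ j = exchange_matrix S $ \<sigma> i $ \<sigma> j"
    using assms(1) unfolding seed_relabeling_def by blast
  from assms(2) obtain d :: "'a \<Rightarrow> real" where d: "(\<forall>i. d i > 0) \<and> (\<forall>i j.
    d i * of_int (exchange_matrix S $ i $ j) = - (d j * of_int (exchange_matrix S $ j $ i)))"
    unfolding skew_symmetrizable_def by (elim exE)
  have "(\<forall>i. d (\<sigma> i) > 0) \<and> (\<forall>i j.
    d (\<sigma> i) * of_int (exchange_matrix S' $ i $ j) = - (d (\<sigma> j) * of_int (exchange_matrix S' $ j $ i)))"
    unfolding B using d by blast
  then show ?thesis
    unfolding skew_symmetrizable_def by (intro exI[of _ "\<lambda>i. d (\<sigma> i)"])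
qed

lemma equivalent_seed:
  assumes "mutation_equivalent \<iota> S0 S" "is_seed \<iota> S0" "skew_symmetrizable (exchange_matrix S0)"
  shows "is_seed \<iota> S \<and> skew_symmetrizable (exchange_matrix S)"
  using assms
proof (induction rule: mutation_equivalent_induct)
  case (mutate S S' k)
  then show ?case unfolding seed_mutation_def using skew_symmetrizable_mutation by auto
next
  case (relabel S S')
  then show ?case using is_seed_relabeling skew_symmetrizable_relabeling by blast
qed simp

end

section \<open>Weights on cyclic seeds\<close>

definition cyc3 :: "int ^ 'n ^ 'n \<Rightarrow> 'n \<Rightarrow> 'n \<Rightarrow> 'n \<Rightarrow> bool" where
  "cyc3 B i j k \<longleftrightarrow> UNIV = {i, j, k} \<and> i \<noteq> j \<and> i \<noteq> k \<and> j \<noteq> k \<and> B $ i $ j > 0 \<and> B $ j $ k > 0 \<and> B $ k $ i > 0"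

lemma cyc3_rotate: "cyc3 B i j k \<Longrightarrow> cyc3 B j k i"
  unfolding cyc3_def by auto

lemma cyc3_at:
  assumes "cyc3 B i j k"
  shows "\<exists>i j. cyc3 B i j l"
proof -
  have "l \<in> {i, j, k}" using assms unfolding cyc3_def by blast
  then show ?thesis using assms cyc3_rotate by blast
qed

text \<open>Sign-skew-symmetry excludes loops and cycles of length two, and on three vertices a walk
  of three edges must close up to a triangle. Without a triangle the transitive closure ends after
  two edges and contains no loop.\<close>

lemma not_acyclic_cyc3:
  fixes B :: "int ^ 'n::finite ^ 'n"
  assumes card: "CARD('n) = 3" and sk: "sign_skew_symmetric B"
    and cyc: "\<not> acyclic {(i, j). B $ i $ j > 0}"
  shows "\<exists>i j k. cyc3 B i j k"
proof (rule ccontr)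
  assume no: "\<nexists>i j k. cyc3 B i j k"
  let ?r = "{(i, j). B $ i $ j > 0}"
  note skD = sign_skew_symmetricD[OF sk]
  have loop: "\<not> B $ i $ i > 0" for i using skD(1)[of i] by simp
  have two: "\<not> B $ j $ i > 0" if "B $ i $ j > 0" for i j using that skD(2)[of i j] by simp
  have three: False if "B $ a $ b > 0" "B $ b $ c > 0" "B $ c $ d > 0" for a b c d
  proof -
    have ne: "a \<noteq> b" "b \<noteq> c" "a \<noteq> c" "c \<noteq> d" "b \<noteq> d" using that loop two by auto
    then have U: "UNIV = {a, b, c}" using UNIV_eq3[OF card] by blast
    then have "d = a" using ne by blast
    then have "cyc3 B a b c" using that ne U unfolding cyc3_def by auto
    then show False using no by blast
  qed
  have "(a, b) \<in> ?r \<union> ?r O ?r" if "(a, b) \<in> ?r\<^sup>+" for a b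
    using that
  proof (induction rule: trancl_induct)
    case (step b c)
    then show ?case using three by blast
  qed simp
  moreover have "(a, a) \<notin> ?r \<union> ?r O ?r" for a using loop two by auto
  ultimately show False using cyc unfolding acyclic_def by blast
qed

text \<open>Together with \<open>outflow\<close>: the weights of the two monomials of the exchange
  polynomial at k.\<close>

definition inflow :: "int ^ 'n::finite ^ 'n \<Rightarrow> 'n \<Rightarrow> ('n \<Rightarrow> real) \<Rightarrow> real" where
  "inflow B k w = (\<Sum>i\<in>UNIV. of_int (max (B $ i $ k) 0) * w i)"

definition outflow :: "int ^ 'n::finite ^ 'n \<Rightarrow> 'n \<Rightarrow> ('n \<Rightarrow> real) \<Rightarrow> real" where
  "outflow B k w = (\<Sum>i\<in>UNIV. of_int (max (- B $ i $ k) 0) * w i)"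

text \<open>
  Tropical mutation of weights. On the kernel of the transposed exchange matrix, in- and outflow
  agree, and the maximum is irrelevant.
\<close>

definition mutate_weight :: "int ^ 'n::finite ^ 'n \<Rightarrow> 'n \<Rightarrow> ('n \<Rightarrow> real) \<Rightarrow> 'n \<Rightarrow> real" where
  "mutate_weight B k w = w(k := max (inflow B k w) (outflow B k w) - w k)"

lemma inflow_minus_outflow: "inflow B k w - outflow B k w = (\<Sum>i\<in>UNIV. of_int (B $ i $ k) * w i)"
  unfolding inflow_def outflow_def sum_subtractf[symmetric]
  by (rule sum.cong) (auto simp: max_def algebra_simps)

text \<open>Independence over the integers of the vectors (d_i, w_i) in the real plane. Three such
  vectors are always dependent over the reals; the integral version is enough because the columns of
  B are integral.\<close>

definition int_independent :: "('n::finite \<Rightarrow> real) \<Rightarrow> ('n \<Rightarrow> real) \<Rightarrow> bool" where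
  "int_independent d w \<longleftrightarrow> (\<forall>c :: 'n \<Rightarrow> int.
     (\<Sum>i\<in>UNIV. of_int (c i) * d i) = 0 \<and> (\<Sum>i\<in>UNIV. of_int (c i) * w i) = 0 \<longrightarrow> (\<forall>i. c i = 0))"

lemma int_independentD:
  "int_independent d w \<Longrightarrow> (\<Sum>i\<in>UNIV. of_int (c i) * d i) = 0 \<Longrightarrow> (\<Sum>i\<in>UNIV. of_int (c i) * w i) = 0 \<Longrightarrow> c i = 0"
  unfolding int_independent_def by blast

definition good_weights :: "int ^ 'n::finite ^ 'n \<Rightarrow> ('n \<Rightarrow> real) \<Rightarrow> ('n \<Rightarrow> real) \<Rightarrow> bool" where
  "good_weights B d w \<longleftrightarrow> (\<forall>i. d i > 0) \<and> (\<forall>j. (\<Sum>i\<in>UNIV. of_int (B $ i $ j) * d i) = 0) \<and> int_independent d w"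

lemma good_weights_flow: "good_weights B d w \<Longrightarrow> inflow B k d = outflow B k d"
  using inflow_minus_outflow[of B k d] unfolding good_weights_def by simp

text \<open>Column k is an integer vector orthogonal to d; if it were orthogonal to w too, it would
  vanish.\<close>

lemma good_weights_flow_neq:
  assumes "good_weights B d w" "B $ i $ k \<noteq> 0"
  shows "inflow B k w \<noteq> outflow B k w"
proof
  assume "inflow B k w = outflow B k w"
  then have "(\<Sum>i\<in>UNIV. of_int (B $ i $ k) * w i) = 0" using inflow_minus_outflow[of B k w] by simp
  moreover have "int_independent d w" "(\<Sum>i\<in>UNIV. of_int (B $ i $ k) * d i) = 0"
    using assms(1) unfolding good_weights_def by auto
  ultimately have "B $ i $ k = 0" by (intro int_independentD[of d w "\<lambda>i. B $ i $ k"])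
  then show False using assms(2) by simp
qed

text \<open>In a column j \<noteq> k the correction is b_kj times one sign part of column k, and
  either part pairs with d to the common flow s. The new summand at k, - b_kj (s - d_k), compensates
  exactly this.\<close>

lemma kernel_mutate:
  assumes kk: "B $ k $ k = 0" and ker: "\<And>j. (\<Sum>i\<in>UNIV. of_int (B $ i $ j) * d i) = 0"
  shows "(\<Sum>i\<in>UNIV. of_int (matrix_mutation k B $ i $ j) * mutate_weight B k d i) = 0"
proof -
  define s where "s = inflow B k d"
  have s: "outflow B k d = s" using inflow_minus_outflow[of B k d] ker[of k] unfolding s_def by simp
  have d'k: "mutate_weight B k d k = s - d k" unfolding mutate_weight_def s s_def[symmetric] by simp
  have d': "mutate_weight B k d i = d i" if "i \<noteq> k" for i using that by (simp add: mutate_weight_def)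
  show ?thesis
  proof (cases "j = k")
    case True
    have "(\<Sum>i\<in>UNIV. of_int (matrix_mutation k B $ i $ j) * mutate_weight B k d i) =
        (\<Sum>i\<in>UNIV. - (of_int (B $ i $ k) * d i))"
    proof (rule sum.cong)
      fix i show "of_int (matrix_mutation k B $ i $ j) * mutate_weight B k d i = - (of_int (B $ i $ k) * d i)"
        using True d' kk by (cases "i = k") (auto simp: matrix_mutation_k)
    qed simp
    then show ?thesis using ker by (simp add: sum_negf)
  next
    case False
    define X where "X i = (if B $ k $ j \<ge> 0 then max (B $ i $ k) 0 else max (- B $ i $ k) 0)" for i
    have X: "(\<Sum>i\<in>UNIV. of_int (X i) * d i) = s"
      using s unfolding X_def s_def inflow_def outflow_def by (cases "B $ k $ j \<ge> 0") simp_all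
    have "of_int (matrix_mutation k B $ i $ j) * mutate_weight B k d i =
        of_int (B $ i $ j) * d i + of_int (B $ k $ j) * (of_int (X i) * d i) - (if i = k then of_int (B $ k $ j) * s else 0)"
      for i
    proof (cases "i = k")
      case True
      have "X k = 0" using kk unfolding X_def by simp
      then show ?thesis using True by (simp add: d'k matrix_mutation_k algebra_simps)
    next
      case False
      then show ?thesis using \<open>j \<noteq> k\<close> by (simp add: d' matrix_mutation_other X_def algebra_simps)
    qed
    then have "(\<Sum>i\<in>UNIV. of_int (matrix_mutation k B $ i $ j) * mutate_weight B k d i) =
        (\<Sum>i\<in>UNIV. of_int (B $ i $ j) * d i) + of_int (B $ k $ j) * (\<Sum>i\<in>UNIV. of_int (X i) * d i)
          - of_int (B $ k $ j) * s"
      by (simp add: sum.distrib sum_subtractf sum_distrib_left)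
    then show ?thesis using ker X by simp
  qed
qed

text \<open>The mutation replaces (d_k, w_k) by an integral combination of the other vectors minus
  (d_k, w_k), which is invertible over the integers. One combination serves both weights: the branch
  attaining the maximum for w is also valid for d, whose flows agree.\<close>

lemma int_independent_mutate:
  assumes kk: "B $ k $ k = 0" and fl: "inflow B k d = outflow B k d" and ind: "int_independent d w"
  shows "int_independent (mutate_weight B k d) (mutate_weight B k w)"
  unfolding int_independent_def
proof (intro allI impI; elim conjE)
  fix c' :: "'a \<Rightarrow> int" and i
  assume c'd: "(\<Sum>i\<in>UNIV. of_int (c' i) * mutate_weight B k d i) = 0"
    and c'w: "(\<Sum>i\<in>UNIV. of_int (c' i) * mutate_weight B k w i) = 0"
  define e where "e i = (if inflow B k w \<ge> outflow B k w then max (B $ i $ k) 0 else max (- B $ i $ k) 0)" for i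
  have ek: "e k = 0" using kk unfolding e_def by simp
  have ev: "(\<Sum>i\<in>UNIV. of_int (e i) * v i) = (if inflow B k w \<ge> outflow B k w then inflow B k v else outflow B k v)" for v
    unfolding e_def inflow_def[of B k v] outflow_def[of B k v] by simp
  have ew: "(\<Sum>i\<in>UNIV. of_int (e i) * w i) = max (inflow B k w) (outflow B k w)"
    unfolding ev by (simp add: max_def)
  have ed: "(\<Sum>i\<in>UNIV. of_int (e i) * d i) = max (inflow B k d) (outflow B k d)"
    unfolding ev using fl by simp
  \<comment> \<open>Pulls an integer relation between the new weights back to the old ones.\<close>
  define c where "c i = (if i = k then - c' k else c' i + c' k * e i)" for i
  have *: "(\<Sum>i\<in>UNIV. of_int (c i) * v i) = (\<Sum>i\<in>UNIV. of_int (c' i) * mutate_weight B k v i)"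
    if "(\<Sum>i\<in>UNIV. of_int (e i) * v i) = max (inflow B k v) (outflow B k v)" for v
  proof -
    have "of_int (c i) * v i = (if i = k then 0 else of_int (c' i) * v i) + of_int (c' k) * (of_int (e i) * v i)
        - (if i = k then of_int (c' k) * v k else 0)" for i
      by (simp add: c_def ek algebra_simps)
    then have "(\<Sum>i\<in>UNIV. of_int (c i) * v i) =
        (\<Sum>i\<in>UNIV. if i = k then 0 else of_int (c' i) * v i) + of_int (c' k) * (\<Sum>i\<in>UNIV. of_int (e i) * v i) - of_int (c' k) * v k"
      by (simp add: sum.distrib sum_subtractf sum_distrib_left)
    also have "\<dots> = (\<Sum>i\<in>UNIV. if i = k then 0 else of_int (c' i) * v i) + (\<Sum>i\<in>UNIV. if i = k then of_int (c' k) * mutate_weight B k v k else 0)"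
      unfolding that by (simp add: mutate_weight_def algebra_simps)
    also have "\<dots> = (\<Sum>i\<in>UNIV. of_int (c' i) * mutate_weight B k v i)"
      unfolding sum.distrib[symmetric] by (rule sum.cong) (auto simp: mutate_weight_def)
    finally show ?thesis .
  qed
  have "\<forall>i. c i = 0"
    using ind c'd c'w *[OF ed] *[OF ew] unfolding int_independent_def by metis
  then have "c' k = 0" "i \<noteq> k \<Longrightarrow> c' i + c' k * e i = 0"
    unfolding c_def by (metis neg_equal_0_iff_equal, metis)
  then show "c' i = 0" by auto
qed

text \<open>Only positivity of the new degree at k needs the triangle: in the mutated matrix, the
  kernel equation of column j balances the positive term b_ij d_i against b_kj d_k, where b_kj <
  0.\<close>

lemma good_weights_mutate:
  assumes good: "good_weights B d w" and sk: "sign_skew_symmetric B" "sign_skew_symmetric (matrix_mutation k B)"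
    and cyc: "cyc3 (matrix_mutation k B) i j k"
  shows "good_weights (matrix_mutation k B) (mutate_weight B k d) (mutate_weight B k w)"
proof -
  let ?B = "matrix_mutation k B" and ?d = "mutate_weight B k d"
  have ker: "(\<Sum>i\<in>UNIV. of_int (?B $ i $ j) * ?d i) = 0" for j
    using good by (intro kernel_mutate sign_skew_symmetricD(1)[OF sk(1)]) (simp add: good_weights_def)
  have U: "UNIV = {i, j, k}" and ne: "i \<noteq> j" "i \<noteq> k" "j \<noteq> k" and b: "?B $ i $ j > 0" "?B $ j $ k > 0"
    using cyc unfolding cyc3_def by auto
  have bk: "?B $ k $ j < 0" using b sign_skew_symmetricD(2)[OF sk(2)] by simp
  have di: "?d l > 0" if "l \<noteq> k" for l using that good by (simp add: mutate_weight_def good_weights_def)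
  have "of_int (?B $ i $ j) * ?d i = - of_int (?B $ k $ j) * ?d k"
    using ker[of j, unfolded sum_UNIV3[OF U ne]] sign_skew_symmetricD(1)[OF sk(2), of j] by simp
  moreover have "of_int (?B $ i $ j) * ?d i > 0" using b di ne by simp
  ultimately have "?d k > 0" using bk by (simp add: mult_less_0_iff)
  then have "?d l > 0" for l using di by (cases "l = k") auto
  then show ?thesis
    using ker int_independent_mutate[OF sign_skew_symmetricD(1)[OF sk(1)] good_weights_flow[OF good]] good
    unfolding good_weights_def by blast
qed

text \<open>If \<open>i\<close> has the maximal slope, mutate at a vertex of smaller slope.\<close>

lemma larger_slope:
  assumes good: "good_weights B d w" and sk: "sign_skew_symmetric B" and cyc: "cyc3 B a b c"
    and pos: "\<And>k. mutate_weight B k d k > 0"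
  shows "\<exists>k. w i / d i < w k / d k \<or> w i / d i < mutate_weight B k w k / mutate_weight B k d k"
proof (rule ccontr)
  define u where "u = w i / d i"
  assume neg: "\<not> ?thesis"
  have n: "\<not> (u < w k / d k \<or> u < mutate_weight B k w k / mutate_weight B k d k)" for k
    using neg[unfolded not_ex, folded u_def] by (rule spec)
  have *: "\<And>k. w k / d k \<le> u" "\<And>k. mutate_weight B k w k / mutate_weight B k d k \<le> u"
    using n by (metis not_le)+
  have dpos: "d k > 0" for k using good unfolding good_weights_def by blast
  have wi: "w i = u * d i" using dpos[of i] by (simp add: u_def)
  have le: "w k \<le> u * d k" for k using *(1)[of k] dpos[of k] by (simp add: pos_divide_le_eq)
  have le': "mutate_weight B k w k \<le> u * mutate_weight B k d k" for k
    using *(2)[of k] pos[of k] by (simp add: pos_divide_le_eq)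
  \<comment> \<open>If all slopes were u, then w = u d would be orthogonal to the columns of B,
    contrary to the independence of d and w.\<close>
  have "\<exists>k. w k < u * d k"
  proof (rule ccontr)
    assume "\<nexists>k. w k < u * d k"
    then have "w k = u * d k" for k using le[of k] by (meson not_less_iff_gr_or_eq not_le)
    then have "(\<Sum>i\<in>UNIV. of_int (B $ i $ b) * w i) = u * (\<Sum>i\<in>UNIV. of_int (B $ i $ b) * d i)"
      by (simp add: sum_distrib_left mult_ac)
    then have "inflow B b w = outflow B b w"
      using good inflow_minus_outflow[of B b w] unfolding good_weights_def by simp
    then have "B $ a $ b = 0" using good_weights_flow_neq[OF good] by blast
    then show False using cyc unfolding cyc3_def by simp
  qed
  then obtain k where k: "w k < u * d k" by blast
  then have "k \<noteq> i" using wi by auto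
  obtain p q where pq: "cyc3 B p q k" using cyc3_at[OF cyc] by blast
  then have U: "UNIV = {p, q, k}" and ne: "p \<noteq> q" "p \<noteq> k" "q \<noteq> k" and bq: "B $ q $ k > 0" and bp: "B $ p $ k < 0"
    using sign_skew_symmetricD(2)[OF sk, of k p] unfolding cyc3_def by auto
  have kk: "B $ k $ k = 0" by (rule sign_skew_symmetricD(1)[OF sk])
  have inf: "inflow B k v = of_int (B $ q $ k) * v q" for v
    using bq bp kk unfolding inflow_def sum_UNIV3[OF U ne] by simp
  have out: "outflow B k v = of_int (- B $ p $ k) * v p" for v
    using bq bp kk unfolding outflow_def sum_UNIV3[OF U ne] by simp
  \<comment> \<open>As k \<noteq> i, the vertex i is one of the two neighbours of k, and the flow of
    w through it is exactly u times the flow of d.\<close>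
  have "max (inflow B k w) (outflow B k w) \<ge> u * inflow B k d"
  proof -
    consider "i = q" | "i = p" using U \<open>k \<noteq> i\<close> by blast
    then show ?thesis
    proof cases
      case 1
      then have "inflow B k w = u * inflow B k d" unfolding inf using wi by simp
      then show ?thesis by simp
    next
      case 2
      then have "outflow B k w = u * outflow B k d" unfolding out using wi by simp
      then show ?thesis using good_weights_flow[OF good, of k] by simp
    qed
  qed
  then have "mutate_weight B k w k > u * mutate_weight B k d k"
    using k good_weights_flow[OF good, of k] by (simp add: mutate_weight_def algebra_simps)
  then show False using le'[of k] by simp
qed

lemma good_weights_exist:
  fixes B :: "int ^ 'n::finite ^ 'n"
  assumes sk: "skew_symmetrizable B" and cyc: "cyc3 B i j k"
  shows "\<exists>d w. good_weights B d w"
proof -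
  from sk obtain D :: "'n \<Rightarrow> real" where D: "(\<forall>i. D i > 0) \<and> (\<forall>i j.
    D i * of_int (B $ i $ j) = - (D j * of_int (B $ j $ i)))"
    unfolding skew_symmetrizable_def by (elim exE)
  have U: "UNIV = {i, j, k}" and ne: "i \<noteq> j" "i \<noteq> k" "j \<noteq> k"
    and b: "B $ i $ j > 0" "B $ j $ k > 0" "B $ k $ i > 0"
    using cyc unfolding cyc3_def by auto
  have diag: "B $ l $ l = 0" for l
    using skew_symmetrizable_imp_sign_skew_symmetric[OF sk] sign_skew_symmetricD(1) by blast
  obtain \<alpha> :: real where \<alpha>: "\<alpha> \<notin> \<rat>"
    using countable_rat uncountable_UNIV_real by (metis UNIV_eq_I)
  \<comment> \<open>The matrix a with entries D_l b_lm is skew-symmetric of size three, with kernel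
    vector (a_jk, a_ki, a_ij). Rescaling the entry at l by D_l gives a left kernel vector of B,
    positive because of the oriented triangle.\<close>
  define d where "d l = (if l = i then D i * D j * of_int (B $ j $ k)
    else if l = j then D j * D k * of_int (B $ k $ i) else D k * D i * of_int (B $ i $ j))" for l
  \<comment> \<open>An integer relation for w reads c_j + c_k \<alpha> = 0, so irrationality gives
    c_j = c_k = 0, and then d_i > 0 gives c_i = 0.\<close>
  define w where "w l = (if l = i then 0 else if l = j then 1 else \<alpha>)" for l
  have dv: "d i = D i * D j * of_int (B $ j $ k)" "d j = D j * D k * of_int (B $ k $ i)" "d k = D k * D i * of_int (B $ i $ j)"
    using ne by (simp_all add: d_def)
  have pos: "d l > 0" for l using D b by (simp add: d_def)
  have anti: "of_int (B $ p $ q) * D p = - (of_int (B $ q $ p) * D q)" for p q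
    using D by (metis mult.commute)
  have "of_int (B $ i $ l) * d i + of_int (B $ j $ l) * d j + of_int (B $ k $ l) * d k = 0" for l
  proof -
    consider "l = i" | "l = j" | "l = k" using U by blast
    then show ?thesis
    proof cases
      case 1
      have "of_int (B $ j $ i) * d j + of_int (B $ k $ i) * d k =
          (of_int (B $ j $ i) * D j) * (D k * of_int (B $ k $ i)) + (of_int (B $ i $ j) * D i) * (D k * of_int (B $ k $ i))"
        unfolding dv by (simp add: mult_ac)
      then show ?thesis using 1 diag anti[of j i] by (simp flip: add.assoc)
    next
      case 2
      have "of_int (B $ i $ j) * d i + of_int (B $ k $ j) * d k =
          (of_int (B $ j $ k) * D j) * (D i * of_int (B $ i $ j)) + (of_int (B $ k $ j) * D k) * (D i * of_int (B $ i $ j))"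
        unfolding dv by (simp add: mult_ac)
      then show ?thesis using 2 diag anti[of j k] by simp
    next
      case 3
      have "of_int (B $ i $ k) * d i + of_int (B $ j $ k) * d j =
          (of_int (B $ i $ k) * D i) * (D j * of_int (B $ j $ k)) + (of_int (B $ k $ i) * D k) * (D j * of_int (B $ j $ k))"
        unfolding dv by (simp add: mult_ac)
      then show ?thesis using 3 diag anti[of i k] by simp
    qed
  qed
  then have ker: "(\<Sum>l\<in>UNIV. of_int (B $ l $ m) * d l) = 0" for m
    unfolding sum_UNIV3[OF U ne] .
  have "int_independent d w"
    unfolding int_independent_def
  proof (intro allI impI; elim conjE)
    fix c :: "'n \<Rightarrow> int" and l
    assume c: "(\<Sum>l\<in>UNIV. of_int (c l) * d l) = 0" "(\<Sum>l\<in>UNIV. of_int (c l) * w l) = 0"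
    have cw: "of_int (c j) + of_int (c k) * \<alpha> = 0"
      using c(2) ne unfolding sum_UNIV3[OF U ne] by (simp add: w_def)
    have ck: "c k = 0"
    proof (rule ccontr)
      assume "c k \<noteq> 0"
      then have "\<alpha> = - of_int (c j) / of_int (c k)" using cw by (simp add: field_simps)
      then have "\<alpha> \<in> \<rat>" by simp
      then show False using \<alpha> by simp
    qed
    then have cj: "c j = 0" using cw by simp
    have "c i = 0" using c(1) ck cj pos[of i] unfolding sum_UNIV3[OF U ne] by simp
    moreover have "l = i \<or> l = j \<or> l = k" using U by blast
    ultimately show "c l = 0" using ck cj by blast
  qed
  then show ?thesis using pos ker unfolding good_weights_def by blast
qed

section \<open>Cyclic seeds\<close>

text \<open>Each element involves finitely many generators. This allows an arbitrary finite
  generating set to be replaced by finitely many cluster variables, whose values are known.\<close>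

lemma gen_finite:
  assumes "g \<in> gen (R \<union> X)"
  shows "\<exists>Z. finite Z \<and> Z \<subseteq> X \<and> g \<in> gen (R \<union> Z)"
proof -
  let ?T = "{g. \<exists>Z. finite Z \<and> Z \<subseteq> X \<and> g \<in> gen (R \<union> Z)}"
  have "is_subring ?T"
    unfolding is_subring_def
  proof (intro conjI ballI)
    show "1 \<in> ?T" by (auto intro!: exI[of _ "{}"] gen_closed)
    fix a b assume "a \<in> ?T" "b \<in> ?T"
    then obtain Y Z where YZ: "finite Y" "Y \<subseteq> X" "a \<in> gen (R \<union> Y)" "finite Z" "Z \<subseteq> X" "b \<in> gen (R \<union> Z)" by blast
    have "a \<in> gen (R \<union> (Y \<union> Z))" by (rule subsetD[OF gen_subset YZ(3)]) auto
    moreover have "b \<in> gen (R \<union> (Y \<union> Z))" by (rule subsetD[OF gen_subset YZ(6)]) auto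
    ultimately have "a + b \<in> gen (R \<union> (Y \<union> Z))" "a - b \<in> gen (R \<union> (Y \<union> Z))" "a * b \<in> gen (R \<union> (Y \<union> Z))"
      by (auto intro: gen_closed)
    moreover have "finite (Y \<union> Z)" "Y \<union> Z \<subseteq> X" using YZ by auto
    ultimately show "a + b \<in> ?T" "a - b \<in> ?T" "a * b \<in> ?T" by blast+
  qed
  moreover have "R \<union> X \<subseteq> ?T"
  proof
    fix r assume "r \<in> R \<union> X"
    then show "r \<in> ?T"
    proof
      assume "r \<in> R"
      then show ?thesis by (auto intro!: exI[of _ "{}"] gen_base)
    next
      assume "r \<in> X"
      then show ?thesis by (auto intro!: exI[of _ "{r}"] gen_base)
    qed
  qed
  ultimately have "gen (R \<union> X) \<subseteq> ?T" by (intro gen_least)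
  then show ?thesis using assms by blast
qed

lemma gen_finite_set:
  assumes "finite G" "G \<subseteq> gen (R \<union> X)"
  shows "\<exists>Z. finite Z \<and> Z \<subseteq> X \<and> G \<subseteq> gen (R \<union> Z)"
  using assms
proof (induction G rule: finite_induct)
  case empty
  then show ?case by blast
next
  case (insert g G)
  then obtain Y where Y: "finite Y" "Y \<subseteq> X" "G \<subseteq> gen (R \<union> Y)" by auto
  have "g \<in> gen (R \<union> X)" using insert(4) by simp
  from gen_finite[OF this] obtain Z where "finite Z \<and> Z \<subseteq> X \<and> g \<in> gen (R \<union> Z)" by (elim exE)
  then have Z: "finite Z" "Z \<subseteq> X" "g \<in> gen (R \<union> Z)" by auto
  have "gen (R \<union> Y) \<subseteq> gen (R \<union> (Y \<union> Z))" "gen (R \<union> Z) \<subseteq> gen (R \<union> (Y \<union> Z))"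
    by (intro gen_subset; blast)+
  then have "insert g G \<subseteq> gen (R \<union> (Y \<union> Z))" using Y Z by blast
  then show ?case using Y Z by (intro exI[of _ "Y \<union> Z"]) auto
qed

lemma hasval_mon:
  fixes y :: "'n::finite \<Rightarrow> 'a::field" and x :: "'n \<Rightarrow> 'a"
  assumes R: "is_subring R" "indep R x" and y: "\<And>i. hasval R x \<phi> (y i) (v i)"
  shows "hasval R x \<phi> (mon y m) (weight v m)"
  unfolding mon_def weight_def by (rule hasval_prod[OF R]) (auto intro: hasval_power[OF R] y)

context group_ring_embedded
begin

lemma hasval_exchange_rhs:
  fixes S :: "('n::finite, 'p, 'f) seed" and x :: "'n \<Rightarrow> 'f"
  assumes ind: "indep (range \<iota>) x"
    and v: "\<And>i. hasval (range \<iota>) x \<phi> (cluster S i) (v i)"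
    and ne: "inflow (exchange_matrix S) k v \<noteq> outflow (exchange_matrix S) k v"
  shows "hasval (range \<iota>) x \<phi> (exchange_rhs \<iota> S k)
    (max (inflow (exchange_matrix S) k v) (outflow (exchange_matrix S) k v))"
proof -
  note R = is_subring_iota ind
  have nat: "real (nat z) = of_int (max z 0)" for z by simp
  have weight: "weight v (\<lambda>i. nat (exchange_matrix S $ i $ k)) = inflow (exchange_matrix S) k v"
    "weight v (\<lambda>i. nat (- exchange_matrix S $ i $ k)) = outflow (exchange_matrix S) k v"
    unfolding weight_def inflow_def outflow_def nat by simp_all
  have c: "hasval (range \<iota>) x \<phi> (group_elt \<iota> p) 0" for p
    by (rule hasval_coeff[OF R group_elt_in group_elt_nonzero])
  have 1: "hasval (range \<iota>) x \<phi> (group_elt \<iota> (coeff_pos S k) * mon (cluster S) (\<lambda>i. nat (exchange_matrix S $ i $ k)))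
      (inflow (exchange_matrix S) k v)"
    using hasval_mult[OF R c[of "coeff_pos S k"] hasval_mon[OF R, of \<phi> "cluster S" v, OF v, where m = "\<lambda>i. nat (exchange_matrix S $ i $ k)"]]
    unfolding weight by simp
  have 2: "hasval (range \<iota>) x \<phi> (group_elt \<iota> (coeff_neg S k) * mon (cluster S) (\<lambda>i. nat (- exchange_matrix S $ i $ k)))
      (outflow (exchange_matrix S) k v)"
    using hasval_mult[OF R c[of "coeff_neg S k"] hasval_mon[OF R, of \<phi> "cluster S" v, OF v, where m = "\<lambda>i. nat (- exchange_matrix S $ i $ k)"]]
    unfolding weight by simp
  show ?thesis
  proof (cases "inflow (exchange_matrix S) k v > outflow (exchange_matrix S) k v")
    case True
    then show ?thesis using hasval_add[OF R 1 2] unfolding exchange_rhs_UNIV by (simp add: max_def)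
  next
    case False
    then show ?thesis using hasval_add[OF R 2 1] ne unfolding exchange_rhs_UNIV by (simp add: max_def add.commute)
  qed
qed

lemma inflow_diff: "inflow B k (\<lambda>i. w i - \<mu> * d i) = inflow B k w - \<mu> * inflow B k d"
  and outflow_diff: "outflow B k (\<lambda>i. w i - \<mu> * d i) = outflow B k w - \<mu> * outflow B k d"
  unfolding inflow_def outflow_def by (simp_all add: algebra_simps sum_subtractf sum_distrib_left)

text \<open>Since the flows of d tie, subtracting \<mu> d shifts both flows of w equally. The same
  branch of the maximum works for all \<mu>, and w and d can be transported separately.\<close>

lemma hasval_mutation:
  fixes S S' :: "('n::finite, 'p, 'f) seed" and x :: "'n \<Rightarrow> 'f"
  assumes ind: "indep (range \<iota>) x" and mut: "seed_mutation \<iota> k S S'"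
    and good: "good_weights (exchange_matrix S) d w" and b: "exchange_matrix S $ j $ k \<noteq> 0"
    and v: "\<And>i. hasval (range \<iota>) x \<phi> (cluster S i) (w i - \<mu> * d i)"
  shows "hasval (range \<iota>) x \<phi> (cluster S' i)
    (mutate_weight (exchange_matrix S) k w i - \<mu> * mutate_weight (exchange_matrix S) k d i)"
proof (cases "i = k")
  case False
  then show ?thesis using mut v unfolding seed_mutation_def mutate_weight_def by simp
next
  case True
  let ?B = "exchange_matrix S"
  note R = is_subring_iota ind
  have fl: "inflow ?B k d = outflow ?B k d" by (rule good_weights_flow[OF good])
  have "inflow ?B k (\<lambda>i. w i - \<mu> * d i) \<noteq> outflow ?B k (\<lambda>i. w i - \<mu> * d i)"
    using good_weights_flow_neq[OF good b] fl by (simp add: inflow_diff outflow_diff)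
  then have "hasval (range \<iota>) x \<phi> (exchange_rhs \<iota> S k)
    (max (inflow ?B k (\<lambda>i. w i - \<mu> * d i)) (outflow ?B k (\<lambda>i. w i - \<mu> * d i)))"
    by (intro hasval_exchange_rhs ind v)
  moreover have "max (inflow ?B k (\<lambda>i. w i - \<mu> * d i)) (outflow ?B k (\<lambda>i. w i - \<mu> * d i)) =
      max (inflow ?B k w) (outflow ?B k w) - \<mu> * inflow ?B k d"
    unfolding inflow_diff outflow_diff fl by simp
  ultimately have "hasval (range \<iota>) x \<phi> (exchange_rhs \<iota> S k / cluster S k)
      (max (inflow ?B k w) (outflow ?B k w) - \<mu> * inflow ?B k d - (w k - \<mu> * d k))"
    using hasval_divide[OF R _ v[of k]] by metis
  moreover have "exchange_rhs \<iota> S k / cluster S k = cluster S' k"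
  proof -
    have "cluster S k * cluster S' k = exchange_rhs \<iota> S k" "cluster S k \<noteq> 0"
      using mut cluster_nonzero[of S k] unfolding seed_mutation_def by auto
    then show ?thesis by (metis nonzero_mult_div_cancel_left)
  qed
  moreover have "mutate_weight ?B k w k - \<mu> * mutate_weight ?B k d k =
      max (inflow ?B k w) (outflow ?B k w) - \<mu> * inflow ?B k d - (w k - \<mu> * d k)"
    unfolding mutate_weight_def fl by (simp add: algebra_simps)
  ultimately show ?thesis using True by simp
qed

text \<open>The valuation refers to the cluster x with weights d0 and w0, while d and w are the
  resulting values on the seed S. All \<mu> are kept, since the relevant one, the largest of
  finitely many slopes, is known only at the end.\<close>

definition weighted_seed :: "('n::finite \<Rightarrow> 'f) \<Rightarrow> ('n \<Rightarrow> real) \<Rightarrow> ('n \<Rightarrow> real) \<Rightarrow> ('n, 'p, 'f) seed \<Rightarrow> ('n \<Rightarrow> real) \<Rightarrow> ('n \<Rightarrow> real) \<Rightarrow> bool" where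
  "weighted_seed x d0 w0 S d w \<longleftrightarrow> good_weights (exchange_matrix S) d w \<and>
     (\<forall>\<mu> i. hasval (range \<iota>) x (\<lambda>i. w0 i - \<mu> * d0 i) (cluster S i) (w i - \<mu> * d i))"

text \<open>The triangle before the mutation excludes a tie in the exchange relation; the one after
  it keeps the new degree positive.\<close>

lemma weighted_seed_mutate:
  fixes S S' :: "('n::finite, 'p, 'f) seed"
  assumes "indep (range \<iota>) x" "seed_mutation \<iota> k S S'" "weighted_seed x d0 w0 S d w"
    and "cyc3 (exchange_matrix S) a b k" and "cyc3 (exchange_matrix S') a' b' k"
  shows "weighted_seed x d0 w0 S' (mutate_weight (exchange_matrix S) k d) (mutate_weight (exchange_matrix S) k w)"
proof -
  have B': "exchange_matrix S' = matrix_mutation k (exchange_matrix S)"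
    and sk: "sign_skew_symmetric (exchange_matrix S)" "sign_skew_symmetric (exchange_matrix S')"
    using assms(2) unfolding seed_mutation_def is_seed_def by auto
  have good: "good_weights (exchange_matrix S) d w"
    and v: "\<And>\<mu> i. hasval (range \<iota>) x (\<lambda>i. w0 i - \<mu> * d0 i) (cluster S i) (w i - \<mu> * d i)"
    using assms(3) unfolding weighted_seed_def by auto
  have b: "exchange_matrix S $ b $ k \<noteq> 0" using assms(4) unfolding cyc3_def by auto
  show ?thesis
    unfolding weighted_seed_def
    using good_weights_mutate[OF good sk(1) sk(2)[unfolded B'] assms(5)[unfolded B']] B'
      hasval_mutation[OF assms(1,2) good b v] by auto
qed

lemma weighted_seed_relabel:
  fixes S S' :: "('n::finite, 'p, 'f) seed"
  assumes "seed_relabeling S S'" "weighted_seed x d0 w0 S d w"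
  shows "\<exists>d' w'. weighted_seed x d0 w0 S' d' w'"
proof -
  obtain \<sigma> where \<sigma>: "bij \<sigma>" "\<And>i. cluster S' i = cluster S (\<sigma> i)"
    "\<And>i j. exchange_matrix S' $ i $ j = exchange_matrix S $ \<sigma> i $ \<sigma> j"
    using assms(1) unfolding seed_relabeling_def by blast
  have reindex: "(\<Sum>i\<in>UNIV. f (\<sigma> i)) = (\<Sum>i\<in>UNIV. f i)" for f :: "'n \<Rightarrow> real"
    by (rule sum.reindex_bij_betw[OF \<sigma>(1)])
  have good: "good_weights (exchange_matrix S) d w" using assms(2) unfolding weighted_seed_def by blast
  have "int_independent (\<lambda>i. d (\<sigma> i)) (\<lambda>i. w (\<sigma> i))"
    unfolding int_independent_def
  proof (intro allI impI; elim conjE)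
    fix c :: "'n \<Rightarrow> int" and i
    assume c: "(\<Sum>i\<in>UNIV. of_int (c i) * d (\<sigma> i)) = 0" "(\<Sum>i\<in>UNIV. of_int (c i) * w (\<sigma> i)) = 0"
    define c' where "c' i = c (inv \<sigma> i)" for i
    have c': "c i = c' (\<sigma> i)" for i unfolding c'_def using \<sigma>(1) by (simp add: bij_is_inj)
    have "c' (\<sigma> i) = 0"
      using c good unfolding c' reindex[of "\<lambda>i. of_int (c' i) * d i"] reindex[of "\<lambda>i. of_int (c' i) * w i"] good_weights_def
      by (blast intro: int_independentD)
    then show "c i = 0" by (simp add: c')
  qed
  moreover have "(\<Sum>i\<in>UNIV. of_int (exchange_matrix S' $ i $ j) * d (\<sigma> i)) = 0" for j
    unfolding \<sigma>(3) reindex[of "\<lambda>i. of_int (exchange_matrix S $ i $ \<sigma> j) * d i"]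
    using good unfolding good_weights_def by blast
  moreover have "d (\<sigma> i) > 0" for i using good unfolding good_weights_def by blast
  ultimately have "weighted_seed x d0 w0 S' (\<lambda>i. d (\<sigma> i)) (\<lambda>i. w (\<sigma> i))"
    using assms(2) unfolding weighted_seed_def good_weights_def \<sigma>(2) by auto
  then show ?thesis by blast
qed

theorem no_acyclic_seed_imp_not_finitely_generated:
  fixes S0 :: "('n::finite, 'p, 'f) seed"
  assumes card: "CARD('n) = 3" and S0: "is_seed \<iota> S0" and sk: "skew_symmetrizable (exchange_matrix S0)"
    and noacyc: "\<And>S. mutation_equivalent \<iota> S0 S \<Longrightarrow> \<not> acyclic_seed S"
  shows "\<not> finitely_generated_algebra \<iota> (cluster_algebra \<iota> S0)"
proof
  assume "finitely_generated_algebra \<iota> (cluster_algebra \<iota> S0)"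
  then obtain G where G: "finite G" "cluster_algebra \<iota> S0 = gen (range \<iota> \<union> G)"
    unfolding finitely_generated_algebra_def hull_eq_gen by blast
  define X where "X = (\<Union>S\<in>{S. mutation_equivalent \<iota> S0 S}. range (cluster S))"
  have A: "cluster_algebra \<iota> S0 = gen (range \<iota> \<union> X)"
    unfolding cluster_algebra_def hull_eq_gen X_def ..
  have "G \<subseteq> gen (range \<iota> \<union> X)" using G(2) A by (auto intro: gen_base)
  from gen_finite_set[OF G(1) this] obtain Z where "finite Z \<and> Z \<subseteq> X \<and> G \<subseteq> gen (range \<iota> \<union> Z)"
    by (elim exE)
  then have Z: "finite Z" "Z \<subseteq> X" "G \<subseteq> gen (range \<iota> \<union> Z)" by auto
  define R where "R = range \<iota>"
  define x where "x = cluster S0"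
  have ind: "indep R x" unfolding R_def x_def by (rule seed_indep_range[OF S0])
  have R: "is_subring R" unfolding R_def by (rule is_subring_iota)
  have seed: "is_seed \<iota> S" "skew_symmetrizable (exchange_matrix S)" "sign_skew_symmetric (exchange_matrix S)"
    if "mutation_equivalent \<iota> S0 S" for S
    using equivalent_seed[OF that S0 sk] skew_symmetrizable_imp_sign_skew_symmetric by auto
  have cyc: "\<exists>i j. cyc3 (exchange_matrix S) i j k" if "mutation_equivalent \<iota> S0 S" for S k
    using not_acyclic_cyc3[OF card seed(3)[OF that]] noacyc[OF that] cyc3_at unfolding acyclic_seed_def by blast
  obtain d0 w0 where dw0: "good_weights (exchange_matrix S0) d0 w0"
    using good_weights_exist[OF sk] cyc[OF mutation_equivalent_refl] by blast
  have weighted: "\<exists>d w. weighted_seed x d0 w0 S d w" if "mutation_equivalent \<iota> S0 S" for S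
    using that
  proof (induction rule: mutation_equivalent_induct)
    case base
    have "hasval R x (\<lambda>i. w0 i - \<mu> * d0 i) (x i) (w0 i - \<mu> * d0 i)" for \<mu> i
      using hasval_var[OF R ind, of "\<lambda>i. w0 i - \<mu> * d0 i" i] by simp
    then have "weighted_seed x d0 w0 S0 d0 w0"
      unfolding weighted_seed_def using dw0 by (simp add: x_def R_def)
    then show ?case by blast
  next
    case (mutate S S' k)
    then have eq': "mutation_equivalent \<iota> S0 S'"
      using mutation_equivalent_mutation mutation_equivalent_trans by blast
    obtain d w where "weighted_seed x d0 w0 S d w" using mutate.IH by blast
    from weighted_seed_mutate[OF ind[unfolded R_def] mutate.hyps(2) this] show ?case
      using cyc[OF mutate.hyps(1), of k] cyc[OF eq', of k] by blast
  next
    case (relabel S S')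
    then show ?case using weighted_seed_relabel by blast
  qed
  \<comment> \<open>A cluster variable may lie in several seeds; instead of showing that its weights
    agree, a pair (a, b) is chosen for it below. The predicate also records a cluster variable of
    larger slope.\<close>
  define slope where "slope z a b \<longleftrightarrow> z \<in> X \<and> b > 0 \<and>
    (\<forall>\<mu>. hasval R x (\<lambda>i. w0 i - \<mu> * d0 i) z (a - \<mu> * b)) \<and>
    (\<exists>z' a' b'. z' \<in> X \<and> b' > 0 \<and> (\<forall>\<mu>. hasval R x (\<lambda>i. w0 i - \<mu> * d0 i) z' (a' - \<mu> * b')) \<and> a / b < a' / b')"
    for z and a b :: real
  have slope: "\<exists>a b. slope z a b" if "z \<in> X" for z
  proof -
    obtain S i where S: "mutation_equivalent \<iota> S0 S" and z: "z = cluster S i"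
      using \<open>z \<in> X\<close> unfolding X_def by blast
    obtain d w where dw: "weighted_seed x d0 w0 S d w" using weighted[OF S] by blast
    then have good: "good_weights (exchange_matrix S) d w" unfolding weighted_seed_def by blast
    have dpos: "d j > 0" for j using good unfolding good_weights_def by blast
    let ?B = "exchange_matrix S"
    have mutate: "\<exists>S'. mutation_equivalent \<iota> S0 S' \<and> weighted_seed x d0 w0 S' (mutate_weight ?B k d) (mutate_weight ?B k w)" for k
    proof -
      obtain S' where S': "seed_mutation \<iota> k S S'" using seed_mutation_exists[OF seed(1,2)[OF S]] by blast
      then have eq': "mutation_equivalent \<iota> S0 S'"
        using S mutation_equivalent_mutation mutation_equivalent_trans by blast
      then show ?thesis
        using weighted_seed_mutate[OF ind[unfolded R_def] S' dw] cyc[OF S, of k] cyc[OF eq', of k] by blast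
    qed
    have d'pos: "mutate_weight ?B k d k > 0" for k
      using mutate[of k] unfolding weighted_seed_def good_weights_def by blast
    obtain a b where "cyc3 ?B a b i" using cyc[OF S] by blast
    from larger_slope[OF good seed(3)[OF S] this d'pos, of i] obtain k where
      k: "w i / d i < w k / d k \<or> w i / d i < mutate_weight ?B k w k / mutate_weight ?B k d k" by blast
    have "\<exists>z' a' b'. z' \<in> X \<and> b' > 0 \<and> (\<forall>\<mu>. hasval R x (\<lambda>i. w0 i - \<mu> * d0 i) z' (a' - \<mu> * b')) \<and> w i / d i < a' / b'"
    proof (cases "w i / d i < w k / d k")
      case True
      then show ?thesis
        using dw dpos[of k] S unfolding weighted_seed_def R_def X_def
        by (intro exI[of _ "cluster S k"] exI[of _ "w k"] exI[of _ "d k"]) auto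
    next
      case False
      obtain S' where eq': "mutation_equivalent \<iota> S0 S'"
        and dw': "weighted_seed x d0 w0 S' (mutate_weight ?B k d) (mutate_weight ?B k w)"
        using mutate[of k] by blast
      then show ?thesis
        using dw' k False d'pos[of k] unfolding weighted_seed_def R_def X_def
        by (intro exI[of _ "cluster S' k"] exI[of _ "mutate_weight ?B k w k"] exI[of _ "mutate_weight ?B k d k"]) auto
    qed
    then have "slope z (w i) (d i)"
      using dw dpos[of i] \<open>z \<in> X\<close> unfolding slope_def weighted_seed_def z R_def by auto
    then show ?thesis by blast
  qed
  define sa sb where "sa z = fst (SOME p. slope z (fst p) (snd p))" and "sb z = snd (SOME p. slope z (fst p) (snd p))" for z
  have sab: "slope z (sa z) (sb z)" if "z \<in> X" for z
  proof -
    have "\<exists>p. slope z (fst p) (snd p)" using slope[OF that] by auto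
    then show ?thesis unfolding sa_def sb_def by (rule someI_ex)
  qed
  define u where "u z = sa z / sb z" for z
  \<comment> \<open>\<open>z0\<close> keeps the set of slopes nonempty even if Z is empty.\<close>
  obtain z0 where z0: "z0 \<in> X" using mutation_equivalent_refl unfolding X_def by blast
  have fin: "finite (insert z0 Z)" and sub: "insert z0 Z \<subseteq> X" using Z z0 by auto
  define \<mu> where "\<mu> = Max (u ` insert z0 Z)"
  have max: "u z \<le> \<mu>" if "z \<in> Z" for z unfolding \<mu>_def using fin that by (intro Max_ge) auto
  have "\<mu> \<in> u ` insert z0 Z" unfolding \<mu>_def using fin by (intro Max_in) auto
  then obtain zm where zm: "zm \<in> X" "u zm = \<mu>" using sub by auto
  obtain z' a' b' where z': "z' \<in> X" "b' > 0" "hasval R x (\<lambda>i. w0 i - \<mu> * d0 i) z' (a' - \<mu> * b')" "\<mu> < a' / b'"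
    using sab[OF zm(1)] zm(2) unfolding slope_def u_def by blast
  \<comment> \<open>For this \<mu> the ring V contains the coefficients and Z, hence the whole
    algebra, whereas z' has the positive value a' - \<mu> b'.\<close>
  define V where "V = val_nonpos R x (\<lambda>i. w0 i - \<mu> * d0 i)"
  have V: "is_subring V" unfolding V_def by (rule is_subring_val_nonpos[OF R ind])
  have "z \<in> V" if "z \<in> Z" for z
  proof -
    have s: "slope z (sa z) (sb z)" using sab Z(2) that by blast
    then have "sa z - \<mu> * sb z \<le> 0" using max[OF that] unfolding slope_def u_def by (simp add: pos_divide_le_eq)
    then show ?thesis using s unfolding V_def slope_def by (blast intro: val_nonpos_hasval[OF R ind])
  qed
  then have "gen (range \<iota> \<union> Z) \<subseteq> V"
    using val_nonpos_coeff[OF R ind] by (intro gen_least V) (auto simp: V_def R_def)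
  moreover have "gen (range \<iota> \<union> G) \<subseteq> gen (range \<iota> \<union> Z)"
    using Z(3) by (intro gen_mono) (auto intro: gen_base)
  moreover have "z' \<in> gen (range \<iota> \<union> G)" using z'(1) G(2) A by (auto intro: gen_base)
  ultimately have "z' \<in> V" by blast
  moreover have "0 < a' - \<mu> * b'" using z'(2,4) by (simp add: pos_less_divide_eq)
  ultimately show False
    using hasval_pos_notin_val_nonpos[OF R ind z'(3)] unfolding V_def by blast
qed

end

section \<open>Exchange relations of rank two\<close>

lemma gen_gen: "gen (gen X \<union> Y) = gen (X \<union> Y)"
proof
  have "gen X \<subseteq> gen (X \<union> Y)" by (rule gen_subset) auto
  then show "gen (gen X \<union> Y) \<subseteq> gen (X \<union> Y)" by (intro gen_mono) (auto intro: gen_base)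
  show "gen (X \<union> Y) \<subseteq> gen (gen X \<union> Y)" by (intro gen_mono) (auto intro: gen_base)
qed

lemma gen_insert_poly:
  assumes T: "is_subring T" and z: "z \<in> gen (T \<union> {u})"
  shows "\<exists>P. (\<forall>i. coeff P i \<in> T) \<and> z = poly P u"
proof -
  let ?V = "{z. \<exists>P. (\<forall>i. coeff P i \<in> T) \<and> z = poly P u}"
  have "is_subring ?V"
    unfolding is_subring_def
  proof (intro conjI ballI)
    show "1 \<in> ?V" using subring_0[OF T] subring_1[OF T] by (auto intro!: exI[of _ 1] simp: coeff_1)
    fix a b assume "a \<in> ?V" "b \<in> ?V"
    then obtain P Q where P: "\<forall>i. coeff P i \<in> T" "a = poly P u" and Q: "\<forall>i. coeff Q i \<in> T" "b = poly Q u"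
      by blast
    have "\<forall>i. coeff (P + Q) i \<in> T" "\<forall>i. coeff (P - Q) i \<in> T" "\<forall>i. coeff (P * Q) i \<in> T"
      using P(1) Q(1) T by (auto simp: coeff_mult intro!: subring_add subring_diff subring_mult subring_sum)
    then show "a + b \<in> ?V" "a - b \<in> ?V" "a * b \<in> ?V"
      unfolding P(2) Q(2) poly_add[symmetric] poly_diff[symmetric] poly_mult[symmetric] by blast+
  qed
  moreover have "t \<in> ?V" if "t \<in> T" for t
    using that subring_0[OF T] by (auto intro!: exI[of _ "[:t:]"] simp: coeff_pCons split: nat.splits)
  moreover have "u \<in> ?V"
    using subring_0[OF T] subring_1[OF T]
    by (auto intro!: exI[of _ "[:0, 1:]"] simp: coeff_pCons split: nat.splits)
  ultimately have "gen (T \<union> {u}) \<subseteq> ?V" by (intro gen_least) auto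
  then show ?thesis using z by blast
qed

definition unit_in :: "'a::field set \<Rightarrow> 'a \<Rightarrow> bool" where
  "unit_in T u \<longleftrightarrow> u \<in> T \<and> inverse u \<in> T \<and> u \<noteq> 0"

lemma unit_in_mult: "is_subring T \<Longrightarrow> unit_in T u \<Longrightarrow> unit_in T v \<Longrightarrow> unit_in T (u * v)"
  unfolding unit_in_def by (simp add: subring_mult)

lemma unit_in_inverse: "unit_in T u \<Longrightarrow> unit_in T (inverse u)"
  unfolding unit_in_def by simp

lemma unit_in_divide: "is_subring T \<Longrightarrow> unit_in T u \<Longrightarrow> unit_in T v \<Longrightarrow> unit_in T (u / v)"
  by (simp add: divide_inverse unit_in_inverse unit_in_mult)

lemma unit_in_power: "is_subring T \<Longrightarrow> unit_in T u \<Longrightarrow> unit_in T (u ^ n)"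
  unfolding unit_in_def by (auto simp: subring_power power_inverse[symmetric])

lemma unit_in_subset: "unit_in T u \<Longrightarrow> T \<subseteq> T' \<Longrightarrow> unit_in T' u"
  unfolding unit_in_def by blast

lemma unit_in_cancel:
  assumes "is_subring T" "unit_in T u" "u * a \<in> T"
  shows "a \<in> T"
proof -
  have "inverse u * (u * a) \<in> T"
    using assms(2) unfolding unit_in_def by (intro subring_mult[OF assms(1) _ assms(3)]) simp
  moreover have "inverse u * (u * a) = a"
    using assms(2) unfolding unit_in_def by (simp add: mult.assoc[symmetric])
  ultimately show ?thesis by (simp only:)
qed

text \<open>X and P + Q X generate the unit ideal because P is a unit. Concretely, P X^m e = X^m (P
  + Q X) e - Q X^(m+1) e lowers the power of X step by step.\<close>

lemma absorb:
  assumes T: "is_subring T" and P: "unit_in T P" and Q: "Q \<in> T" "X \<in> T"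
    and e: "(P + Q * X) * e \<in> T" "X ^ N * e \<in> T"
  shows "e \<in> T"
proof -
  have "X ^ (N - n) * e \<in> T" if "n \<le> N" for n
    using that
  proof (induction n)
    case 0
    then show ?case using e by simp
  next
    case (Suc n)
    define m where "m = N - Suc n"
    have m: "N - n = Suc m" using Suc(2) unfolding m_def by simp
    have "P * (X ^ m * e) = X ^ m * ((P + Q * X) * e) - Q * (X ^ Suc m * e)"
      by (simp add: algebra_simps)
    also have "\<dots> \<in> T"
    proof (rule subring_diff[OF T])
      show "X ^ m * ((P + Q * X) * e) \<in> T"
        by (rule subring_mult[OF T subring_power[OF T Q(2)] e(1)])
      have "X ^ Suc m * e \<in> T" using Suc m by simp
      then show "Q * (X ^ Suc m * e) \<in> T" by (rule subring_mult[OF T Q(1)])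
    qed
    finally show ?case using unit_in_cancel[OF T P] unfolding m_def by blast
  qed
  from this[of N] show ?thesis by simp
qed

text \<open>Elements of T1 have only powers of X as denominators over T0, and M is comaximal with X;
  multiplying by M cannot remove such a denominator.\<close>

lemma absorb_power:
  assumes T: "is_subring T0" and P: "unit_in T0 P" and Q: "Q \<in> T0" "X \<in> T0" and M: "M = P + Q * X"
    and T1: "is_subring T1" "T0 \<subseteq> T1" and loc: "\<And>e. e \<in> T1 \<Longrightarrow> \<exists>N. X ^ N * e \<in> T0"
    and e: "e \<in> T1" "M ^ n * e \<in> T0"
  shows "e \<in> T0"
  using e
proof (induction n arbitrary: e)
  case (Suc n)
  have M1: "M \<in> T1" using T1 P Q unfolding M unit_in_def by (intro subring_add subring_mult) auto
  have "M * e \<in> T1" using T1(1) M1 Suc(2) by (rule subring_mult)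
  moreover have "M ^ n * (M * e) \<in> T0" using Suc(3) by (simp add: mult_ac)
  ultimately have "M * e \<in> T0" by (rule Suc(1))
  moreover obtain N where "X ^ N * e \<in> T0" using loc Suc(2) by blast
  ultimately show ?case using absorb[OF T P Q] unfolding M by blast
qed simp

text \<open>Stated for all large exponents, because the power of x used later has to be a multiple
  of a given number.\<close>

lemma gen_laurent_clear:
  assumes A: "is_subring A" and x: "x \<noteq> 0" and e: "e \<in> gen (A \<union> {x, 1 / x})"
  shows "\<exists>N. \<forall>n\<ge>N. x ^ n * e \<in> gen (A \<union> {x})"
proof -
  have "e \<in> exch_ext A 1 x" using e exch_ext_eq_gen[OF A subring_1[OF A] x] by simp
  then obtain N P where P: "e * x ^ N = poly P x" and c: "\<forall>i. \<exists>a\<in>A. coeff P i = 1 ^ (N - i) * a"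
    unfolding exch_ext_def by blast
  have "coeff P i \<in> A" for i using c by auto
  then have "e * x ^ N \<in> gen (A \<union> {x})"
    unfolding P by (intro subring_poly is_subring_gen) (auto intro: gen_base)
  moreover have "x \<in> gen (A \<union> {x})" by (auto intro: gen_base)
  ultimately have "x ^ (n - N) * (e * x ^ N) \<in> gen (A \<union> {x})" for n
    by (intro gen_closed(5)[OF gen_closed(7)])
  moreover have "x ^ n * e = x ^ (n - N) * (e * x ^ N)" if "n \<ge> N" for n
  proof -
    have "x ^ n = x ^ (n - N) * x ^ N" using that by (simp add: power_add[symmetric])
    then show ?thesis by (simp add: mult_ac)
  qed
  ultimately show ?thesis by (intro exI[of _ N]) metis
qed

text \<open>
  Here $x' = M_x/x$ and $y' = M_y/y$. The relation $P y^{-1} = y' - Q x^b y^{-1}$ trades a pole in $y$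
  for a factor $x^b$, which cancels against $x'$.
\<close>

lemma rank2_reduce:
  assumes A: "is_subring A" and nz: "x \<noteq> 0" "y \<noteq> 0" and Mx: "Mx \<in> gen (A \<union> {y})"
    and P: "unit_in A P" and Q: "Q \<in> A" and b: "0 < b" and My: "My = P + Q * x ^ b"
    and z: "z \<in> gen (A \<union> {x, Mx / x, y, 1 / y})"
  shows "\<exists>l\<in>gen (A \<union> {x, Mx / x, y, My / y}). \<exists>r\<in>gen (A \<union> {x, y, 1 / y}). z = l + r"
proof -
  let ?x = "Mx / x"
  define L D C where "L = gen (A \<union> {x, ?x, y, My / y})" and "D = gen (A \<union> {x, y, 1 / y})" and "C = gen (A \<union> {x, y})"
  have L: "is_subring L" and D: "is_subring D" and C: "is_subring C"
    unfolding L_def D_def C_def by (rule is_subring_gen)+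
  have CL: "C \<subseteq> L" and CD: "C \<subseteq> D" unfolding L_def D_def C_def by (rule gen_subset; auto)+
  have AC: "A \<subseteq> C" unfolding C_def by (auto intro: gen_base)
  have xC: "x \<in> C" and yC: "y \<in> C" unfolding C_def by (auto intro: gen_base)
  have MxC: "Mx \<in> C" using Mx gen_subset[of "A \<union> {y}" "A \<union> {x, y}"] unfolding C_def by auto
  have PQ: "P \<in> C" "Q \<in> C" "unit_in C P" using P Q AC unit_in_subset[OF P AC] unfolding unit_in_def by auto
  have xL: "?x \<in> L" "My / y \<in> L" unfolding L_def by (auto intro: gen_base)
  have yD: "1 / y \<in> D" unfolding D_def by (auto intro: gen_base)
  have "My \<in> D" unfolding My using D PQ xC CD by (intro subring_add subring_mult subring_power) auto
  then have "My * (1 / y) \<in> D" using D yD by (intro subring_mult)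
  then have MyD: "My / y \<in> D" by simp
  \<comment> \<open>The sum of L and D is not a ring, but it is closed under addition and under
    multiplication by elements of both L and D, such as C and \<open>My / y\<close>.\<close>
  define N where "N = {l + r | l r. l \<in> L \<and> r \<in> D}"
  have N_I: "l \<in> L \<Longrightarrow> r \<in> D \<Longrightarrow> l + r \<in> N" for l r unfolding N_def by blast
  have LN: "l \<in> N" if "l \<in> L" for l using N_I[OF that subring_0[OF D]] by simp
  have DN: "r \<in> N" if "r \<in> D" for r using N_I[OF subring_0[OF L] that] by simp
  have N_add: "a + b \<in> N" if ab: "a \<in> N" "b \<in> N" for a b
  proof -
    obtain l r l' r' where "a = l + r" "b = l' + r'" "l \<in> L" "l' \<in> L" "r \<in> D" "r' \<in> D"
      using ab unfolding N_def by blast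
    then have "a + b = (l + l') + (r + r')" "l + l' \<in> L" "r + r' \<in> D" using L D by (auto intro: subring_add)
    then show ?thesis using N_I by metis
  qed
  have N_mult: "c * a \<in> N" if ac: "a \<in> N" "c \<in> L" "c \<in> D" for a c
  proof -
    obtain l r where "a = l + r" "l \<in> L" "r \<in> D" using ac(1) unfolding N_def by blast
    then have "c * a = c * l + c * r" "c * l \<in> L" "c * r \<in> D"
      using L D ac by (auto intro: subring_mult simp: algebra_simps)
    then show ?thesis using N_I by metis
  qed
  have N_C: "c * a \<in> N" if "a \<in> N" "c \<in> C" for a c using N_mult that CL CD by blast
  have N_sum: "sum f I \<in> N" if "\<And>i. i \<in> I \<Longrightarrow> f i \<in> N" for f :: "nat \<Rightarrow> _" and I
    using that LN[OF subring_0[OF L]] by (induction I rule: infinite_finite_induct) (auto intro: N_add)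
  \<comment> \<open>The mixed products are the only ones not visibly in L or in D. The outer
    induction is on the power of \<open>?x\<close>, the inner one on the power of 1 / y.\<close>
  have key: "(1 / y) ^ n * ?x ^ k \<in> N" for n k
  proof (induction k arbitrary: n)
    case 0
    then show ?case using D yD by (auto intro!: DN subring_power)
  next
    case (Suc k)
    note IH = Suc.IH
    show ?case
    proof (induction n)
      case 0
      then show ?case using L xL(1) by (simp only: power_0 mult_1) (intro LN subring_power)
    next
      case (Suc n)
      have "P * ((1 / y) ^ Suc n * ?x ^ Suc k) = (My / y) * ((1 / y) ^ n * ?x ^ Suc k)
          + (- (Q * x ^ (b - 1) * Mx)) * ((1 / y) ^ Suc n * ?x ^ k)"
      proof -
        have xb: "x ^ b = x ^ (b - 1) * x" using b by (metis power_minus_mult)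
        have xx: "x * ?x = Mx" using nz by simp
        have "(My / y) * ((1 / y) ^ n * ?x ^ Suc k) = (P + Q * x ^ (b - 1) * x) * ((1 / y) ^ Suc n * ?x ^ Suc k)"
          unfolding My xb by (simp add: mult_ac divide_inverse)
        also have "\<dots> = P * ((1 / y) ^ Suc n * ?x ^ Suc k) + Q * x ^ (b - 1) * (x * ?x) * ((1 / y) ^ Suc n * ?x ^ k)"
        proof -
          have "(P + Q * w * x) * (v * u ^ Suc k) = P * (v * u ^ Suc k) + Q * w * (x * u) * (v * u ^ k)" for u v w
            by (simp add: algebra_simps)
          then show ?thesis .
        qed
        finally show ?thesis unfolding xx by simp
      qed
      also have "\<dots> \<in> N"
      proof (rule N_add)
        show "(My / y) * ((1 / y) ^ n * ?x ^ Suc k) \<in> N" by (rule N_mult[OF Suc xL(2) MyD])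
        have "- (Q * x ^ (b - 1) * Mx) \<in> C"
          by (intro subring_uminus[OF C] subring_mult[OF C] subring_power[OF C] PQ xC MxC)
        then show "- (Q * x ^ (b - 1) * Mx) * ((1 / y) ^ Suc n * ?x ^ k) \<in> N" by (rule N_C[OF IH])
      qed
      finally have Pz: "P * ((1 / y) ^ Suc n * ?x ^ Suc k) \<in> N" .
      have "inverse P \<in> C" using PQ(3) unfolding unit_in_def by blast
      then have "inverse P * (P * ((1 / y) ^ Suc n * ?x ^ Suc k)) \<in> N" by (rule N_C[OF Pz])
      moreover have "inverse P * (P * a) = a" for a
        using PQ(3) unfolding unit_in_def by (simp add: mult.assoc[symmetric])
      ultimately show ?case by (simp only:)
    qed
  qed
  \<comment> \<open>Adjoining \<open>?x\<close> and then 1 / y presents z as a combination over C of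
    the products treated in \<open>key\<close>.\<close>
  have "z \<in> gen (gen (C \<union> {?x}) \<union> {1 / y})"
  proof -
    have "A \<union> {x, ?x, y, 1 / y} = A \<union> {x, y} \<union> ({?x} \<union> {1 / y})" by auto
    then have "gen (A \<union> {x, ?x, y, 1 / y}) = gen (C \<union> ({?x} \<union> {1 / y}))"
      unfolding C_def gen_gen by simp
    also have "\<dots> = gen (gen (C \<union> {?x}) \<union> {1 / y})" unfolding gen_gen by (simp add: Un_assoc)
    finally show ?thesis using z by simp
  qed
  then obtain G where G: "\<forall>n. coeff G n \<in> gen (C \<union> {?x})" "z = poly G (1 / y)"
    using gen_insert_poly[OF is_subring_gen] by blast
  have "coeff G n * (1 / y) ^ n \<in> N" for n
  proof -
    obtain H where H: "\<forall>k. coeff H k \<in> C" "coeff G n = poly H ?x"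
      using gen_insert_poly[OF C] G(1) by blast
    have "coeff G n * (1 / y) ^ n = (\<Sum>k\<le>degree H. coeff H k * ((1 / y) ^ n * ?x ^ k))"
      unfolding H(2) poly_altdef by (simp add: sum_distrib_right sum_distrib_left mult_ac)
    also have "\<dots> \<in> N" using H(1) by (intro N_sum N_C[OF key]) simp
    finally show ?thesis .
  qed
  then have "z \<in> N" unfolding G(2) poly_altdef by (intro N_sum)
  then show ?thesis unfolding N_def L_def D_def by blast
qed

text \<open>\<open>rank2_reduce\<close> leaves a remainder without Mx / x, a Laurent polynomial in y
  over A[x]. The second membership makes its pole coefficients divisible by powers of My over
  A[x, 1/x]; as My is comaximal with x, the quotients already lie in A[x].\<close>

lemma rank2_inter:
  assumes A: "is_subring A" and nz: "x \<noteq> 0" "y \<noteq> 0" and Mx: "Mx \<in> gen (A \<union> {y})"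
    and P: "unit_in A P" and Q: "Q \<in> A" and b: "0 < b" and My: "My = P + Q * x ^ b"
    and K: "is_subring K" "gen (A \<union> {x, 1 / x}) \<subseteq> K" "trans_over K y"
    and z: "z \<in> gen (A \<union> {x, Mx / x, y, 1 / y})" "z \<in> gen (A \<union> {x, 1 / x, y, My / y})"
  shows "z \<in> gen (A \<union> {x, Mx / x, y, My / y})"
proof -
  define L E T0 T1 where "L = gen (A \<union> {x, Mx / x, y, My / y})" and "E = gen (A \<union> {x, 1 / x, y, My / y})"
    and "T0 = gen (A \<union> {x})" and "T1 = gen (A \<union> {x, 1 / x})"
  have L: "is_subring L" and E: "is_subring E" and T0: "is_subring T0" and T1: "is_subring T1"
    unfolding L_def E_def T0_def T1_def by (rule is_subring_gen)+
  obtain l r where lr: "l \<in> L" "r \<in> gen (A \<union> {x, y, 1 / y})" "z = l + r"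
    using rank2_reduce[OF A nz Mx P Q b My z(1)] unfolding L_def by blast
  have "gen (A \<union> {y}) \<subseteq> E" unfolding E_def by (rule gen_subset) auto
  then have "Mx * (1 / x) \<in> E" using Mx E by (intro subring_mult) (auto simp: E_def intro: gen_base)
  then have "L \<subseteq> E" unfolding L_def by (intro gen_least E) (auto simp: E_def intro: gen_base)
  then have "z - l \<in> E" using lr z(2) E by (intro subring_diff) (auto simp: E_def)
  then have rE: "r \<in> E" using lr by simp
  have T01: "T0 \<subseteq> T1" unfolding T0_def T1_def by (rule gen_subset) auto
  have AT0: "A \<subseteq> T0" and xT0: "x \<in> T0" unfolding T0_def by (auto intro: gen_base)
  have P0: "unit_in T0 P" using unit_in_subset[OF P AT0] .
  have My0: "My \<in> T0" using P0 Q AT0 xT0 T0 unfolding My unit_in_def by (intro subring_add subring_mult subring_power) auto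
  have "A \<union> {x, y, 1 / y} = (A \<union> {x}) \<union> {y, 1 / y}" by auto
  then have "r \<in> gen (T0 \<union> {y, 1 / y})" using lr(2) unfolding T0_def gen_gen by simp
  then have r0: "r \<in> exch_ext T0 1 y" using exch_ext_eq_gen[OF T0 subring_1[OF T0] nz(2)] by simp
  have "A \<union> {x, 1 / x, y, My / y} = (A \<union> {x, 1 / x}) \<union> {y, My / y}" by auto
  then have "r \<in> gen (T1 \<union> {y, My / y})" using rE unfolding T1_def E_def gen_gen by simp
  then have r1: "r \<in> exch_ext T1 My y" using exch_ext_eq_gen[OF T1 _ nz(2)] My0 T01 by blast
  have loc: "\<exists>N. (x ^ b) ^ N * e \<in> T0" if eT1: "e \<in> T1" for e
  proof -
    obtain N where "\<forall>n\<ge>N. x ^ n * e \<in> T0"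
      using gen_laurent_clear[OF A nz(1)] eT1 unfolding T0_def T1_def by blast
    then have "x ^ (b * N) * e \<in> T0" using b by simp
    then show ?thesis by (auto simp: power_mult)
  qed
  have "r \<in> exch_ext T0 My y"
  proof (rule exch_ext_inter[OF T0 subring_1[OF T0] T1 _ K(1) _ _ K(3) r0 r1])
    show "My \<in> T1" "T0 \<subseteq> K" "T1 \<subseteq> K" using My0 T01 K(2) unfolding T1_def by auto
    fix n e0 e1 assume e: "e0 \<in> T0" "e1 \<in> T1" "1 ^ n * e0 = My ^ n * e1"
    have "e1 \<in> T0"
      by (rule absorb_power[OF T0 P0 _ _ My T1 T01 loc e(2), of n])
        (use e Q AT0 xT0 T0 in \<open>auto intro: subring_power\<close>)
    then show "\<exists>e\<in>T0. 1 ^ n * e0 = My ^ n * e" using e by blast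
  qed
  then have "r \<in> gen (T0 \<union> {y, My / y})" using exch_ext_eq_gen[OF T0 My0 nz(2)] by simp
  moreover have "gen (T0 \<union> {y, My / y}) \<subseteq> L" unfolding T0_def gen_gen L_def by (rule gen_subset) auto
  ultimately show ?thesis using lr L unfolding L_def by (auto intro: subring_add)
qed

text \<open>Here Mx and My both lie in A. The pole coefficients in y are divisible by powers of My
  over A[x, 1/x], and a second expansion, in x, shows by coprimality that the quotients lie in
  A[x, Mx/x].\<close>

lemma rank2_inter_coprime:
  assumes A: "is_subring A" and nz: "x \<noteq> 0" "y \<noteq> 0" and M: "Mx \<in> A" "My \<in> A" "Mx \<noteq> 0" "My \<noteq> 0"
    and cop: "\<And>e f. e \<in> A \<Longrightarrow> f \<in> A \<Longrightarrow> My * e = Mx * f \<Longrightarrow> \<exists>g\<in>A. e = Mx * g"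
    and K: "is_subring K" "gen (A \<union> {x, 1 / x}) \<subseteq> K" "trans_over K y"
    and K': "is_subring K'" "A \<subseteq> K'" "trans_over K' x"
    and z: "z \<in> gen (A \<union> {x, Mx / x, y, 1 / y})" "z \<in> gen (A \<union> {x, 1 / x, y, My / y})"
  shows "z \<in> gen (A \<union> {x, Mx / x, y, My / y})"
proof -
  define T0 T1 where "T0 = gen (A \<union> {x, Mx / x})" and "T1 = gen (A \<union> {x, 1 / x})"
  have T0: "is_subring T0" and T1: "is_subring T1" unfolding T0_def T1_def by (rule is_subring_gen)+
  have T0_exch_ext: "T0 = exch_ext A Mx x" and T1_exch_ext: "T1 = exch_ext A 1 x"
    unfolding T0_def T1_def using exch_ext_eq_gen[OF A _ nz(1)] M(1) subring_1[OF A] by auto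
  have A01: "A \<subseteq> T0" "A \<subseteq> T1" unfolding T0_def T1_def by (auto intro: gen_base)
  have "Mx * (1 / x) \<in> T1" using M A01 T1 by (intro subring_mult) (auto simp: T1_def intro: gen_base)
  then have T01: "T0 \<subseteq> T1" unfolding T0_def by (intro gen_least T1) (auto simp: T1_def intro: gen_base)
  have cop_pow: "\<exists>g\<in>A. e = Mx ^ n * g" if "e \<in> A" "f \<in> A" "My * e = Mx ^ n * f" for n e f
    using that
  proof (induction n arbitrary: e f)
    case (Suc n)
    have "My * e = Mx * (Mx ^ n * f)" using Suc(4) by simp
    then obtain g where g: "g \<in> A" "e = Mx * g"
      using cop[OF Suc(2)] subring_mult[OF A subring_power[OF A M(1)] Suc(3)] by blast
    then have "My * g = Mx ^ n * f" using Suc(4) M(3) by (simp add: mult_ac)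
    then obtain h where "h \<in> A" "g = Mx ^ n * h" using Suc(1) g(1) Suc(3) by blast
    then show ?case using g by auto
  qed auto
  \<comment> \<open>With a common exponent of x, the coefficients of \<open>My * e\<close> are
    divisible by powers of Mx; coprimality passes this on to the coefficients of e.\<close>
  have div1: "e \<in> T0" if h: "e \<in> T1" "My * e \<in> T0" for e
  proof -
    obtain N F where F: "e * x ^ N = poly F x" "\<forall>i. \<exists>a\<in>A. coeff F i = 1 ^ (N - i) * a"
      using h(1) unfolding T1_exch_ext exch_ext_def by blast
    obtain N' G where G: "(My * e) * x ^ N' = poly G x" "\<forall>i. \<exists>a\<in>A. coeff G i = Mx ^ (N' - i) * a"
      using h(2) unfolding T0_exch_ext exch_ext_def by blast
    obtain F' where F': "e * x ^ (N + N') = poly F' x" "\<forall>i. \<exists>a\<in>A. coeff F' i = 1 ^ (N + N' - i) * a"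
      using exch_ext_raise[OF A subring_1[OF A] F] by blast
    obtain G' where "(My * e) * x ^ (N' + N) = poly G' x" "\<forall>i. \<exists>a\<in>A. coeff G' i = Mx ^ (N' + N - i) * a"
      using exch_ext_raise[OF A M(1) G] by blast
    then have G': "(My * e) * x ^ (N + N') = poly G' x" "\<forall>i. \<exists>a\<in>A. coeff G' i = Mx ^ (N + N' - i) * a"
      by (simp_all add: add.commute)
    have F'A: "coeff F' i \<in> A" for i using F'(2) by auto
    have "smult My F' = G'"
    proof (rule trans_over_eq[OF K'(1,3)])
      show "poly (smult My F') x = poly G' x" using F'(1) G'(1) by (simp add: mult.assoc)
      show "coeff (smult My F') i \<in> K'" for i using F'A M(2) A K'(2) by (auto intro: subring_mult)
      show "coeff G' i \<in> K'" for i using G'(2) subring_mult[OF A subring_power[OF A M(1)]] K'(2) by (metis subsetD)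
    qed
    then have eq: "My * coeff F' i = coeff G' i" for i by (metis coeff_smult)
    have "\<exists>g\<in>A. coeff F' i = Mx ^ (N + N' - i) * g" for i
    proof -
      obtain a where "a \<in> A" "coeff G' i = Mx ^ (N + N' - i) * a" using G'(2) by blast
      then show ?thesis using cop_pow[OF F'A] eq by metis
    qed
    then show ?thesis unfolding T0_exch_ext using F'(1) by (intro exch_ext_I)
  qed
  have div: "e \<in> T0" if "e \<in> T1" "My ^ n * e \<in> T0" for n e
    using that
  proof (induction n arbitrary: e)
    case (Suc n)
    have "My * e \<in> T1" using Suc(2) M A01 T1 by (auto intro: subring_mult)
    moreover have "My ^ n * (My * e) \<in> T0" using Suc(3) by (simp add: mult_ac)
    ultimately show ?case using Suc(1) div1 Suc(2) by blast
  qed simp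
  have "A \<union> {x, Mx / x, y, 1 / y} = (A \<union> {x, Mx / x}) \<union> {y, 1 / y}" by auto
  then have "z \<in> gen (T0 \<union> {y, 1 / y})" using z(1) unfolding T0_def gen_gen by simp
  then have r0: "z \<in> exch_ext T0 1 y" using exch_ext_eq_gen[OF T0 subring_1[OF T0] nz(2)] by simp
  have "A \<union> {x, 1 / x, y, My / y} = (A \<union> {x, 1 / x}) \<union> {y, My / y}" by auto
  then have "z \<in> gen (T1 \<union> {y, My / y})" using z(2) unfolding T1_def gen_gen by simp
  then have r1: "z \<in> exch_ext T1 My y" using exch_ext_eq_gen[OF T1 _ nz(2)] M A01 by blast
  have "z \<in> exch_ext T0 My y"
  proof (rule exch_ext_inter[OF T0 subring_1[OF T0] T1 _ K(1) _ _ K(3) r0 r1])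
    show "My \<in> T1" "T0 \<subseteq> K" "T1 \<subseteq> K" using M A01 T01 K(2) unfolding T1_def by auto
    fix n e0 e1 assume e: "e0 \<in> T0" "e1 \<in> T1" "1 ^ n * e0 = My ^ n * e1"
    then have "e1 \<in> T0" using div[OF e(2), of n] by simp
    then show "\<exists>e\<in>T0. 1 ^ n * e0 = My ^ n * e" using e by blast
  qed
  then have "z \<in> gen (T0 \<union> {y, My / y})" using exch_ext_eq_gen[OF T0 _ nz(2)] M A01 by blast
  then show ?thesis unfolding T0_def gen_gen by (simp add: Un_assoc insert_commute)
qed

text \<open>The binomial has constant term 1. Going upwards from the lowest coefficient, each
  coefficient of f is a multiple of N minus \<rho> times an earlier coefficient that is already
  divisible by N.\<close>

lemma gen_laurent_coprime:
  assumes R: "is_subring R" and v: "v \<noteq> 0" and K: "is_subring K" "R \<subseteq> K" "trans_over K v"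
    and \<rho>: "\<rho> \<in> R" and N: "N \<in> R" "N \<noteq> 0" and a: "0 < a"
    and f: "f \<in> gen (R \<union> {v, 1 / v})" "e \<in> gen (R \<union> {v, 1 / v})" "(1 + \<rho> * v ^ a) * f = N * e"
  shows "\<exists>g\<in>gen (R \<union> {v, 1 / v}). f = N * g"
proof -
  have exch_ext: "gen (R \<union> {v, 1 / v}) = exch_ext R 1 v" using exch_ext_eq_gen[OF R subring_1[OF R] v] by simp
  obtain m F where F: "f * v ^ m = poly F v" "\<forall>i. \<exists>c\<in>R. coeff F i = 1 ^ (m - i) * c"
    using f(1) unfolding exch_ext exch_ext_def by blast
  obtain m' E where E: "e * v ^ m' = poly E v" "\<forall>i. \<exists>c\<in>R. coeff E i = 1 ^ (m' - i) * c"
    using f(2) unfolding exch_ext exch_ext_def by blast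
  obtain F' where F': "f * v ^ (m + m') = poly F' v" "\<forall>i. \<exists>c\<in>R. coeff F' i = 1 ^ (m + m' - i) * c"
    using exch_ext_raise[OF R subring_1[OF R] F] by blast
  obtain E' where "e * v ^ (m' + m) = poly E' v" "\<forall>i. \<exists>c\<in>R. coeff E' i = 1 ^ (m' + m - i) * c"
    using exch_ext_raise[OF R subring_1[OF R] E] by blast
  then have E': "e * v ^ (m + m') = poly E' v" "\<And>i. coeff E' i \<in> R" by (auto simp: add.commute)
  have F'R: "coeff F' i \<in> R" for i using F'(2) by auto
  have coeff: "coeff (F' + monom \<rho> a * F') i = coeff F' i + (if i < a then 0 else \<rho> * coeff F' (i - a))" for i
    by (simp add: coeff_monom_mult)
  have "F' + monom \<rho> a * F' = smult N E'"
  proof (rule trans_over_eq[OF K(1,3)])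
    have "poly (F' + monom \<rho> a * F') v = ((1 + \<rho> * v ^ a) * f) * v ^ (m + m')"
      using F'(1) by (simp add: poly_monom algebra_simps)
    also have "\<dots> = poly (smult N E') v" unfolding f(3) using E'(1) by (simp add: mult.assoc)
    finally show "poly (F' + monom \<rho> a * F') v = poly (smult N E') v" .
    show "coeff (F' + monom \<rho> a * F') i \<in> K" for i
      unfolding coeff using F'R \<rho> subsetD[OF K(2)]
      by (auto intro!: subring_add[OF K(1)] subring_mult[OF K(1)] subring_0[OF K(1)])
    show "coeff (smult N E') i \<in> K" for i
      using E'(2) N R K(2) by (auto intro!: subsetD[OF K(2)] subring_mult)
  qed
  then have eq: "coeff F' i + (if i < a then 0 else \<rho> * coeff F' (i - a)) = N * coeff E' i" for i
    using coeff by (metis coeff_smult)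
  have ex: "\<exists>g\<in>R. coeff F' i = N * g" for i
  proof (induction i rule: less_induct)
    case (less i)
    show ?case
    proof (cases "i < a")
      case True
      then show ?thesis using eq[of i] E'(2) by auto
    next
      case False
      then obtain g where g: "g \<in> R" "coeff F' (i - a) = N * g" using less[of "i - a"] a by auto
      have "coeff F' i = N * (coeff E' i - \<rho> * g)"
        using eq[of i] False g by (simp add: algebra_simps)
      moreover have "coeff E' i - \<rho> * g \<in> R" using E'(2) \<rho> g R by (intro subring_diff subring_mult) auto
      ultimately show ?thesis by blast
    qed
  qed
  define G where "G = smult (inverse N) F'"
  have G: "coeff G i \<in> R" for i
  proof -
    obtain g where "g \<in> R" "coeff F' i = N * g" using ex by blast
    then show ?thesis using N(2) by (simp add: G_def mult.assoc[symmetric])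
  qed
  have "poly G v / v ^ (m + m') \<in> exch_ext R 1 v"
    by (rule exch_ext_I[of _ _ "m + m'" G]) (use v G in auto)
  moreover have "f = N * (poly G v / v ^ (m + m'))"
    unfolding G_def using F'(1) N(2) v by (simp add: field_simps)
  ultimately show ?thesis unfolding exch_ext by blast
qed

text \<open>
  Modulo $1 + \rho v^a$ the power $v^{ac}$ is the constant $(-\rho)^{-c}$, so there $1 + \sigma v^c$ divides
  the resultant, a nonzero constant.
\<close>

lemma binomial_coprime:
  assumes R: "is_subring R" and v: "v \<noteq> 0" and K: "is_subring K" "R \<subseteq> K" "trans_over K v"
    and \<rho>: "\<rho> \<in> R" and \<sigma>: "\<sigma> \<in> R" and ac: "0 < a" "0 < c" and res: "(- \<rho>) ^ c \<noteq> (- \<sigma>) ^ a"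
    and ef: "e \<in> gen (R \<union> {v, 1 / v})" "f \<in> gen (R \<union> {v, 1 / v})" "(1 + \<sigma> * v ^ c) * e = (1 + \<rho> * v ^ a) * f"
  shows "\<exists>g\<in>gen (R \<union> {v, 1 / v}). e = (1 + \<rho> * v ^ a) * g"
proof -
  define A where "A = gen (R \<union> {v, 1 / v})"
  have A: "is_subring A" unfolding A_def by (rule is_subring_gen)
  have RA: "R \<subseteq> A" and vA: "v \<in> A" "1 / v \<in> A" unfolding A_def by (auto intro: gen_base)
  \<comment> \<open>1 - s and 1 - t are the two binomials. They divide 1 - s^a and 1 - t^c, whose
    nonconstant terms are both multiples of v^(ac), so the difference is the resultant
    \<open>N\<close> times v^(ac).\<close>
  define s t where "s = - \<sigma> * v ^ c" and "t = - \<rho> * v ^ a"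
  define Ss St where "Ss = (\<Sum>i<a. s ^ i)" and "St = (\<Sum>i<c. t ^ i)"
  have stA: "s \<in> A" "t \<in> A" unfolding s_def t_def using \<rho> \<sigma> RA vA
    by (auto intro!: subring_mult[OF A] subring_uminus[OF A] subring_power[OF A])
  have SA: "Ss \<in> A" "St \<in> A" unfolding Ss_def St_def using stA by (auto intro!: subring_sum[OF A] subring_power[OF A])
  have S: "1 - s ^ a = (1 - s) * Ss" "1 - t ^ c = (1 - t) * St"
    unfolding Ss_def St_def by (simp_all add: one_diff_power_eq)
  define N where "N = (- \<rho>) ^ c - (- \<sigma>) ^ a"
  have N: "N \<in> R" "N \<noteq> 0" unfolding N_def using res \<rho> \<sigma>
    by (auto intro!: subring_diff[OF R] subring_power[OF R] subring_uminus[OF R])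
  have "N * v ^ (a * c) = t ^ c - s ^ a"
    unfolding N_def s_def t_def power_mult_distrib by (simp add: algebra_simps power_mult[symmetric])
  then have "N * v ^ (a * c) = (1 - s ^ a) - (1 - t ^ c)" by simp
  then have "N * v ^ (a * c) * e = ((1 - s) * Ss) * e - ((1 - t) * St) * e"
    unfolding S[symmetric] by (simp only: left_diff_distrib)
  also have "\<dots> = Ss * ((1 - s) * e) - (1 - t) * St * e" by (simp add: algebra_simps)
  also have "(1 - s) * e = (1 - t) * f" using ef(3) by (simp add: s_def t_def)
  also have "Ss * ((1 - t) * f) - (1 - t) * St * e = (1 - t) * (Ss * f - St * e)" by (simp add: algebra_simps)
  finally have eq: "N * v ^ (a * c) * e = (1 - t) * (Ss * f - St * e)" .
  define h where "h = (1 / v) ^ (a * c) * (Ss * f - St * e)"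
  have efA: "e \<in> A" "f \<in> A" using ef(1,2) unfolding A_def by auto
  have hA: "h \<in> A" unfolding h_def using SA efA vA(2)
    by (intro subring_mult[OF A] subring_diff[OF A] subring_power[OF A])
  have "(1 - t) * h = (1 / v) ^ (a * c) * (N * v ^ (a * c) * e)" unfolding h_def eq by (simp add: mult_ac)
  also have "\<dots> = N * e" using v by (simp add: power_divide)
  finally have "(1 + \<rho> * v ^ a) * h = N * e" by (simp add: t_def)
  \<comment> \<open>So far divisibility holds only for N e. The previous lemma shows that N divides
    h, so N cancels.\<close>
  then obtain g where g: "g \<in> A" "h = N * g"
    using gen_laurent_coprime[OF R v K \<rho> N ac(1), of h e] hA ef(1) unfolding A_def by blast
  then have "N * e = (1 + \<rho> * v ^ a) * (N * g)" using \<open>(1 + \<rho> * v ^ a) * h = N * e\<close> by (simp only:)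
  also have "\<dots> = N * ((1 + \<rho> * v ^ a) * g)" by (rule mult.left_commute)
  finally have "N * e = N * ((1 + \<rho> * v ^ a) * g)" .
  then have "e = (1 + \<rho> * v ^ a) * g" using N(2) by (auto simp only: mult_cancel_left)
  then show ?thesis using g(1) unfolding A_def by blast
qed

text \<open>
  If \<open>i\<close> and \<open>j\<close> are not linked, their exchange polynomials are binomials in the third variable \<open>v\<close>.
  Up to a unit, such a binomial is $1 + \rho v^{|b|}$, where $\rho$ is its \<open>binom_ratio\<close>.
\<close>

definition binom_ratio :: "'a::field \<Rightarrow> 'a \<Rightarrow> int \<Rightarrow> 'a" where
  "binom_ratio p q b = (if b > 0 then p / q else q / p)"

text \<open>Units are split off to normalise the binomials to constant term 1. If one exponent is
  zero, that polynomial is a nonzero element of R and \<open>gen_laurent_coprime\<close> applies;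
  otherwise the resultant decides.\<close>

lemma exchange_binomial_coprime:
  assumes R: "is_subring R" and v: "v \<noteq> 0" and K: "is_subring K" "R \<subseteq> K" "trans_over K v"
    and u: "unit_in R p" "unit_in R q" "unit_in R p'" "unit_in R q'"
    and M: "M = p * v ^ nat b + q * v ^ nat (- b)" "M \<noteq> 0"
    and M': "M' = p' * v ^ nat b' + q' * v ^ nat (- b')" "M' \<noteq> 0"
    and bb: "b \<noteq> 0 \<or> b' \<noteq> 0"
    and res: "b \<noteq> 0 \<Longrightarrow> b' \<noteq> 0 \<Longrightarrow> (- binom_ratio p q b) ^ nat \<bar>b'\<bar> \<noteq> (- binom_ratio p' q' b') ^ nat \<bar>b\<bar>"
    and ef: "e \<in> gen (R \<union> {v, 1 / v})" "f \<in> gen (R \<union> {v, 1 / v})" "M' * e = M * f"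
  shows "\<exists>g\<in>gen (R \<union> {v, 1 / v}). e = M * g"
proof -
  define A where "A = gen (R \<union> {v, 1 / v})"
  have A: "is_subring A" unfolding A_def by (rule is_subring_gen)
  have RA: "R \<subseteq> A" unfolding A_def by (auto intro: gen_base)
  have normal: "\<exists>w. unit_in R w \<and> p * v ^ nat b + q * v ^ nat (- b) = w * (1 + binom_ratio p q b * v ^ nat \<bar>b\<bar>) \<and> binom_ratio p q b \<in> R"
    if "unit_in R p" "unit_in R q" "b \<noteq> 0" for p q b
  proof (cases "b > 0")
    case True
    then have "p * v ^ nat b + q * v ^ nat (- b) = q * (1 + binom_ratio p q b * v ^ nat \<bar>b\<bar>)"
      using that unfolding binom_ratio_def unit_in_def by (simp add: field_simps)
    moreover have "binom_ratio p q b \<in> R"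
      using unit_in_divide[OF R that(1,2)] True unfolding binom_ratio_def unit_in_def by simp
    ultimately show ?thesis using that by blast
  next
    case False
    then have "p * v ^ nat b + q * v ^ nat (- b) = p * (1 + binom_ratio p q b * v ^ nat \<bar>b\<bar>)"
      using that unfolding binom_ratio_def unit_in_def by (simp add: field_simps)
    moreover have "binom_ratio p q b \<in> R"
      using unit_in_divide[OF R that(2,1)] False unfolding binom_ratio_def unit_in_def by simp
    ultimately show ?thesis using that by blast
  qed
  have const: "p * v ^ nat b + q * v ^ nat (- b) \<in> R" if "b = 0" "unit_in R p" "unit_in R q" for p q b
    using that R unfolding unit_in_def by (simp add: subring_add)
  have inA: "x * y \<in> A" if "x \<in> R" "y \<in> A" for x y using that RA by (blast intro: subring_mult[OF A])
  have efA: "e \<in> A" "f \<in> A" using ef unfolding A_def by auto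
  show ?thesis unfolding A_def[symmetric]
  proof (cases "b = 0")
    case True
    then have "b' \<noteq> 0" using bb by simp
    then obtain w where w: "unit_in R w" "M' = w * (1 + binom_ratio p' q' b' * v ^ nat \<bar>b'\<bar>)" "binom_ratio p' q' b' \<in> R"
      using normal[OF u(3,4)] unfolding M' by blast
    have "w * ((1 + binom_ratio p' q' b' * v ^ nat \<bar>b'\<bar>) * e) = w * (M * (inverse w * f))"
      using ef(3) w unfolding unit_in_def by (simp add: mult_ac)
    then have "(1 + binom_ratio p' q' b' * v ^ nat \<bar>b'\<bar>) * e = M * (inverse w * f)"
      using w(1) unfolding unit_in_def by simp
    moreover have "M \<in> R" unfolding M by (rule const[OF True u(1,2)])
    moreover have "inverse w * f \<in> A" using w efA unfolding unit_in_def by (intro inA) auto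
    ultimately show "\<exists>g\<in>A. e = M * g"
      using gen_laurent_coprime[OF R v K w(3), of M "nat \<bar>b'\<bar>" e "inverse w * f"] M(2) \<open>b' \<noteq> 0\<close> efA
      unfolding A_def by simp
  next
    case False
    then obtain w where w: "unit_in R w" "M = w * (1 + binom_ratio p q b * v ^ nat \<bar>b\<bar>)" "binom_ratio p q b \<in> R"
      using normal[OF u(1,2)] unfolding M by blast
    have wnz: "w \<noteq> 0" "inverse w \<in> R" "w \<in> R" using w(1) unfolding unit_in_def by auto
    show "\<exists>g\<in>A. e = M * g"
    proof (cases "b' = 0")
      case True
      have "M' \<in> R" unfolding M' by (rule const[OF True u(3,4)])
      moreover have "(1 + binom_ratio p q b * v ^ nat \<bar>b\<bar>) * f = M' * (inverse w * e)"
        using ef(3) w wnz by (simp add: field_simps)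
      moreover have "inverse w * e \<in> A" using wnz efA by (intro inA) auto
      ultimately obtain g where "g \<in> A" "f = M' * g"
        using gen_laurent_coprime[OF R v K w(3), of M' "nat \<bar>b\<bar>" f "inverse w * e"] M'(2) False efA
        unfolding A_def by auto
      then show ?thesis using ef(3) M'(2) by (auto simp: mult_ac)
    next
      case b'nz: False
      obtain w' where w': "unit_in R w'" "M' = w' * (1 + binom_ratio p' q' b' * v ^ nat \<bar>b'\<bar>)" "binom_ratio p' q' b' \<in> R"
        using normal[OF u(3,4) b'nz] unfolding M' by blast
      have w'nz: "w' \<noteq> 0" "inverse w' \<in> R" "w' \<in> R" using w'(1) unfolding unit_in_def by auto
      have "(1 + binom_ratio p' q' b' * v ^ nat \<bar>b'\<bar>) * (w' * e) = (1 + binom_ratio p q b * v ^ nat \<bar>b\<bar>) * (w * f)"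
        using ef(3) unfolding w(2) w'(2) by (simp add: mult_ac)
      moreover have "w' * e \<in> A" "w * f \<in> A" using efA wnz w'nz by (auto intro: inA)
      ultimately obtain g where g: "g \<in> A" "w' * e = (1 + binom_ratio p q b * v ^ nat \<bar>b\<bar>) * g"
        using binomial_coprime[OF R v K w(3) w'(3) _ _ res[OF False b'nz], of "w' * e" "w * f"] False b'nz
        unfolding A_def by auto
      have "e = M * (inverse w * inverse w' * g)"
      proof -
        have "w' * e = w' * (M * (inverse w * inverse w' * g))"
          unfolding g(2) w(2) using wnz w'nz by (simp add: field_simps)
        then show ?thesis using w'nz by simp
      qed
      moreover have "inverse w * inverse w' * g \<in> A" using wnz w'nz g(1) R by (intro inA subring_mult) auto
      ultimately show ?thesis by blast
    qed
  qed
qed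

text \<open>
  Up to a multiple of $y$, $x'^b y y' = P_y (x x')^b + Q_y x'^b$ is the new exchange polynomial of $y$,
  since $x x' \equiv P_x$ modulo $y$.
\<close>

lemma exchange_rank2_mutate:
  assumes A: "is_subring A" and nz: "x \<noteq> 0" "y \<noteq> 0"
    and in_A: "Px \<in> A" "Qx \<in> A" "Py \<in> A" "Qy \<in> A" "P \<in> A" "Q \<in> A" and u: "unit_in A Q" "unit_in A Qy"
    and bc: "0 < b" "0 < c" and Mx: "Mx = Px + Qx * y ^ c" and My: "My = Py * x ^ b + Qy"
    and M: "M = P + Q * (Mx / x) ^ b" and PQ: "P * Qy = Q * Py * Px ^ b"
  shows "M / y \<in> gen (A \<union> {x, Mx / x, y, My / y})"
proof -
  define L where "L = gen (A \<union> {x, Mx / x, y, My / y})"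
  have L: "is_subring L" unfolding L_def by (rule is_subring_gen)
  have gens: "x \<in> L" "Mx / x \<in> L" "y \<in> L" "My / y \<in> L" and AL: "A \<subseteq> L" unfolding L_def by (auto intro: gen_base)
  \<comment> \<open>The quotient of Mx^b - Px^b by Mx - Px = Qx y^c.\<close>
  define S where "S = (\<Sum>i<b. Mx ^ i * Px ^ (b - Suc i))"
  have "Mx \<in> L" unfolding Mx using L AL in_A gens by (intro subring_add subring_mult subring_power) auto
  then have SL: "S \<in> L" unfolding S_def using AL in_A by (auto intro!: subring_sum[OF L] subring_mult[OF L] subring_power[OF L])
  have "Mx ^ b - Px ^ b = (Mx - Px) * S"
    unfolding S_def by (simp add: power_diff_sumr2 mult_ac)
  then have S: "Mx ^ b = Px ^ b + Qx * y ^ c * S" unfolding Mx by (simp add: algebra_simps)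
  have "(Mx / x) ^ b * (My / y) - Py * (Qx * y ^ (c - 1) * S) = (Py * Px ^ b + Qy * (Mx / x) ^ b) / y"
  proof -
    have yc: "y ^ c = y ^ (c - 1) * y" using bc by (metis power_minus_mult)
    have "x ^ b * (Mx / x) ^ b = Mx ^ b" using nz by (simp add: power_divide)
    then have "(Mx / x) ^ b * My = Py * (Px ^ b + Qx * y ^ (c - 1) * S * y) + Qy * (Mx / x) ^ b"
      unfolding My using S unfolding yc by (simp add: algebra_simps)
    then have "(Mx / x) ^ b * My - Py * (Qx * y ^ (c - 1) * S) * y = Py * Px ^ b + Qy * (Mx / x) ^ b"
      by (simp add: algebra_simps)
    then have "((Mx / x) ^ b * My - Py * (Qx * y ^ (c - 1) * S) * y) / y = (Py * Px ^ b + Qy * (Mx / x) ^ b) / y"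
      by simp
    then show ?thesis using nz by (simp add: diff_divide_distrib)
  qed
  moreover have "(Mx / x) ^ b * (My / y) - Py * (Qx * y ^ (c - 1) * S) \<in> L"
    using gens SL AL in_A by (intro subring_diff[OF L] subring_mult[OF L] subring_power[OF L]) auto
  ultimately have "(Py * Px ^ b + Qy * (Mx / x) ^ b) / y \<in> L" by simp
  \<comment> \<open>The new exchange polynomial is the one just found times the unit Q / Qy;
    \<open>PQ\<close> says that the coefficients have mutated accordingly.\<close>
  then have "Q * inverse Qy * ((Py * Px ^ b + Qy * (Mx / x) ^ b) / y) \<in> L"
    using u AL unfolding unit_in_def by (intro subring_mult[OF L]) auto
  moreover have "Q * inverse Qy * ((Py * Px ^ b + Qy * (Mx / x) ^ b) / y) = M / y"
  proof -
    have Qy: "Qy \<noteq> 0" using u unfolding unit_in_def by blast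
    then have "P = inverse Qy * (Q * Py * Px ^ b)" using PQ by (simp add: field_simps)
    then show ?thesis unfolding M using Qy nz by (simp add: field_simps)
  qed
  ultimately show ?thesis unfolding L_def by (simp only:)
qed

section \<open>Upper and lower bounds in rank three\<close>

text \<open>The coefficients are field elements instead of group elements, since the perturbed ones
  contain powers of t.\<close>

definition exch_poly :: "('n::finite \<Rightarrow> 'a::field) \<Rightarrow> ('n \<Rightarrow> 'a) \<Rightarrow> ('n \<Rightarrow> 'a) \<Rightarrow> int ^ 'n ^ 'n \<Rightarrow> 'n \<Rightarrow> 'a" where
  "exch_poly x p q B j = p j * mon x (\<lambda>i. nat (B $ i $ j)) + q j * mon x (\<lambda>i. nat (- B $ i $ j))"

definition exch_dual :: "('n::finite \<Rightarrow> 'a::field) \<Rightarrow> ('n \<Rightarrow> 'a) \<Rightarrow> ('n \<Rightarrow> 'a) \<Rightarrow> int ^ 'n ^ 'n \<Rightarrow> 'n \<Rightarrow> 'a" where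
  "exch_dual x p q B j = exch_poly x p q B j / x j"

definition distinct3 :: "'n \<Rightarrow> 'n \<Rightarrow> 'n \<Rightarrow> bool" where
  "distinct3 i j k \<longleftrightarrow> UNIV = {i, j, k} \<and> i \<noteq> j \<and> i \<noteq> k \<and> j \<noteq> k"

lemma distinct3_perm:
  assumes "distinct3 i j k"
  shows "distinct3 j i k" "distinct3 i k j" "distinct3 j k i" "distinct3 k i j" "distinct3 k j i"
  using assms unfolding distinct3_def by auto

definition pair_alg :: "'a::field set \<Rightarrow> ('n::finite \<Rightarrow> 'a) \<Rightarrow> ('n \<Rightarrow> 'a) \<Rightarrow> ('n \<Rightarrow> 'a) \<Rightarrow> int ^ 'n ^ 'n \<Rightarrow> 'n \<Rightarrow> 'n \<Rightarrow> 'n \<Rightarrow> 'a set" where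
  "pair_alg R x p q B i j k = gen (R \<union> {x i, exch_dual x p q B i, x j, exch_dual x p q B j, x k, 1 / x k})"

text \<open>
  The upper bound of Berenstein, Fomin and Zelevinsky intersects rings with one exchanged variable;
  with two exchanged variables, as here, mutation at one of them is a purely algebraic identity
  and coprimality is only needed for the remaining pair.
\<close>

definition upper_alg :: "'a::field set \<Rightarrow> ('n::finite \<Rightarrow> 'a) \<Rightarrow> ('n \<Rightarrow> 'a) \<Rightarrow> ('n \<Rightarrow> 'a) \<Rightarrow> int ^ 'n ^ 'n \<Rightarrow> 'a set" where
  "upper_alg R x p q B = {z. \<forall>i j k. distinct3 i j k \<longrightarrow> z \<in> pair_alg R x p q B i j k}"

definition lower_alg :: "'a::field set \<Rightarrow> ('n::finite \<Rightarrow> 'a) \<Rightarrow> ('n \<Rightarrow> 'a) \<Rightarrow> ('n \<Rightarrow> 'a) \<Rightarrow> int ^ 'n ^ 'n \<Rightarrow> 'a set" where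
  "lower_alg R x p q B = gen (R \<union> range x \<union> range (exch_dual x p q B))"

lemma exch3:
  assumes "distinct3 i j k" "B $ j $ j = 0"
  shows "exch_poly x p q B j = p j * (x i ^ nat (B $ i $ j) * x k ^ nat (B $ k $ j)) +
    q j * (x i ^ nat (- B $ i $ j) * x k ^ nat (- B $ k $ j))"
proof -
  have "mon x m = x i ^ m i * x j ^ m j * x k ^ m k" for m
    using assms prod_UNIV3[of i j k "\<lambda>i. x i ^ m i"] unfolding distinct3_def mon_def by simp
  then show ?thesis using assms(2) by (simp add: exch_poly_def)
qed

text \<open>The coefficient rule is multiplied out to avoid quotients; as for seeds, only the ratio
  of the new coefficients is prescribed away from k.\<close>

definition mutated :: "'n::finite \<Rightarrow> ('n \<Rightarrow> 'a::field) \<Rightarrow> ('n \<Rightarrow> 'a) \<Rightarrow> ('n \<Rightarrow> 'a) \<Rightarrow> int ^ 'n ^ 'n \<Rightarrow>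
    ('n \<Rightarrow> 'a) \<Rightarrow> ('n \<Rightarrow> 'a) \<Rightarrow> ('n \<Rightarrow> 'a) \<Rightarrow> bool" where
  "mutated k x p q B x' p' q' \<longleftrightarrow> x k * x' k = exch_poly x p q B k \<and> (\<forall>i. i \<noteq> k \<longrightarrow> x' i = x i) \<and>
     p' k = q k \<and> q' k = p k \<and>
     (\<forall>i. i \<noteq> k \<longrightarrow> p' i * q i = (if B $ k $ i \<ge> 0 then p k else q k) powi (B $ k $ i) * p i * q' i)"

locale exchange_seed =
  fixes R :: "'a::field set" and x p q :: "'n::finite \<Rightarrow> 'a" and B :: "int ^ 'n ^ 'n"
  assumes R: "is_subring R" and ind: "indep R x" and sk: "sign_skew_symmetric B"
    and p: "unit_in R (p i)" and q: "unit_in R (q i)" and exch_nz: "exch_poly x p q B i \<noteq> 0"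
begin

abbreviation "M \<equiv> exch_poly x p q B"
abbreviation "y \<equiv> exch_dual x p q B"

lemmas sk0 = sign_skew_symmetricD(1)[OF sk] and skD = sign_skew_symmetricD(2,3)[OF sk]

lemma x_nz: "x i \<noteq> 0"
  by (rule indep_nonzero[OF R ind])

lemma M_div: "M i / x i = y i"
  by (simp add: exch_dual_def)

lemma pR: "p i \<in> R" and qR: "q i \<in> R"
  using p q unfolding unit_in_def by auto

lemma M_in:
  assumes T: "is_subring T" "R \<subseteq> T" and d: "distinct3 i j k" and x: "x i \<in> T" "x k \<in> T"
  shows "M j \<in> T"
  unfolding exch3[OF d sk0] using T x pR qR
  by (intro subring_add[OF T(1)] subring_mult[OF T(1)] subring_power[OF T(1)]) auto

lemma M_in_unlinked:
  assumes T: "is_subring T" "R \<subseteq> T" and d: "distinct3 i j k" and B: "B $ k $ j = 0" and x: "x i \<in> T"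
  shows "M j \<in> T"
proof -
  have "M j = p j * x i ^ nat (B $ i $ j) + q j * x i ^ nat (- B $ i $ j)"
    using exch3[OF d sk0, of x p q] B by simp
  then show ?thesis using T x pR qR
    by (auto intro!: subring_add[OF T(1)] subring_mult[OF T(1)] subring_power[OF T(1)])
qed

lemma fracs_without: "is_subring (fracs_without R x k)" "trans_over (fracs_without R x k) (x k)" "R \<subseteq> fracs_without R x k"
  using is_subring_fracs_without[OF R] trans_fracs_without[OF R ind] fracs_without_coeff[OF R] by auto

lemma fracs_without_x: "i \<noteq> k \<Longrightarrow> x i \<in> fracs_without R x k" "i \<noteq> k \<Longrightarrow> 1 / x i \<in> fracs_without R x k"
  using fracs_without_var[OF R, of i k x] fracs_without_inverse[OF R, of "x i" x k] by (auto simp: divide_inverse)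

lemma pair_alg_swap: "pair_alg R x p q B i j k = pair_alg R x p q B j i k"
  unfolding pair_alg_def by (rule arg_cong[where f = gen]) auto

text \<open>For unlinked i and j both exchange polynomials are binomials in x_k. The condition asks
  that at most one of them is constant and that, if none is, the resultant does not vanish.\<close>

definition coprime_at :: "'n \<Rightarrow> 'n \<Rightarrow> 'n \<Rightarrow> bool" where
  "coprime_at i j k \<longleftrightarrow> (B $ k $ i \<noteq> 0 \<or> B $ k $ j \<noteq> 0) \<and> (B $ k $ i \<noteq> 0 \<longrightarrow> B $ k $ j \<noteq> 0 \<longrightarrow>
     (- binom_ratio (p i) (q i) (B $ k $ i)) ^ nat \<bar>B $ k $ j\<bar> \<noteq>
     (- binom_ratio (p j) (q j) (B $ k $ j)) ^ nat \<bar>B $ k $ i\<bar>)"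

text \<open>Everything happens over R with x_k and its inverse adjoined. For linked vertices the
  monomial of M_j without x_i is a unit there, so no coprimality is involved; unlinked vertices use
  the resultant.\<close>

lemma pair_alg_inter:
  assumes d: "distinct3 i j k" and cop: "B $ i $ j = 0 \<Longrightarrow> coprime_at i j k"
    and z: "z \<in> gen (R \<union> {x i, y i, x j, 1 / x j, x k, 1 / x k})"
      "z \<in> gen (R \<union> {x i, 1 / x i, x j, y j, x k, 1 / x k})"
  shows "z \<in> pair_alg R x p q B i j k"
proof -
  define A where "A = gen (R \<union> {x k, 1 / x k})"
  have A: "is_subring A" unfolding A_def by (rule is_subring_gen)
  have RA: "R \<subseteq> A" and xA: "x k \<in> A" "1 / x k \<in> A" unfolding A_def by (auto intro: gen_base)
  have ne: "i \<noteq> j" "i \<noteq> k" "j \<noteq> k" using d unfolding distinct3_def by auto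
  have dji: "distinct3 j i k" by (rule distinct3_perm(1)[OF d])
  have K: "gen (A \<union> {x i, 1 / x i}) \<subseteq> fracs_without R x j"
    unfolding A_def gen_gen using fracs_without(3)[of j] fracs_without_x[of i j] fracs_without_x[of k j] ne by (intro gen_least fracs_without(1)) auto
  have z1: "z \<in> gen (A \<union> {x i, M i / x i, x j, 1 / x j})"
    using z(1) unfolding M_div A_def gen_gen by (simp add: Un_insert_left Un_insert_right insert_commute)
  have z2: "z \<in> gen (A \<union> {x i, 1 / x i, x j, M j / x j})"
    using z(2) unfolding M_div A_def gen_gen by (simp add: insert_commute)
  have goal: "gen (A \<union> {x i, M i / x i, x j, M j / x j}) = pair_alg R x p q B i j k"
    unfolding M_div A_def gen_gen pair_alg_def by (simp add: insert_commute)
  have xk_unit: "unit_in A (x k ^ n)" for n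
    by (rule unit_in_power[OF A]) (use xA x_nz in \<open>auto simp: unit_in_def divide_inverse\<close>)
  have PA: "unit_in A (p l * x k ^ n)" "unit_in A (q l * x k ^ n)" for l n
    using unit_in_mult[OF A unit_in_subset[OF p RA] xk_unit] unit_in_mult[OF A unit_in_subset[OF q RA] xk_unit] by auto
  have Mi: "M i \<in> gen (A \<union> {x j})"
    by (rule M_in[OF is_subring_gen _ dji]) (use RA xA in \<open>auto intro: gen_base\<close>)
  show ?thesis
  proof (cases "B $ i $ j = 0")
    case True
    have Bji: "B $ j $ i = 0" using True skD(2)[of i j] by simp
    have MiA: "M i \<in> A"
      by (rule M_in_unlinked[OF A RA, of k i j]) (use d dji Bji xA distinct3_perm in auto)
    have MjA: "M j \<in> A"
      by (rule M_in_unlinked[OF A RA, of k j i]) (use d True xA distinct3_perm in auto)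
    have K': "is_subring (fracs_without R x k)" "R \<subseteq> fracs_without R x k" "trans_over (fracs_without R x k) (x k)" using fracs_without by auto
    have Ki: "A \<subseteq> fracs_without R x i" unfolding A_def using fracs_without(3)[of i] fracs_without_x[of k i] ne by (intro gen_least fracs_without(1)) auto
    have cp: "coprime_at i j k" by (rule cop[OF True])
    have "\<exists>g\<in>A. e = M i * g" if "e \<in> A" "f \<in> A" "M j * e = M i * f" for e f
      unfolding A_def
    proof (rule exchange_binomial_coprime[OF R x_nz K' p[of i] q[of i] p[of j] q[of j], where b = "B $ k $ i" and b' = "B $ k $ j"])
      show "M i = p i * x k ^ nat (B $ k $ i) + q i * x k ^ nat (- B $ k $ i)"
        using exch3[OF dji sk0, of x p q] Bji by simp
      show "M j = p j * x k ^ nat (B $ k $ j) + q j * x k ^ nat (- B $ k $ j)"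
        using exch3[OF d sk0, of x p q] True by simp
      show "e \<in> gen (R \<union> {x k, 1 / x k})" "f \<in> gen (R \<union> {x k, 1 / x k})" "M j * e = M i * f"
        using that unfolding A_def by auto
    qed (use cp exch_nz in \<open>auto simp: coprime_at_def\<close>)
    then show ?thesis
      using rank2_inter_coprime[OF A x_nz x_nz MiA MjA exch_nz exch_nz _ fracs_without(1) K fracs_without(2) fracs_without(1) Ki fracs_without(2) z1 z2]
      unfolding goal by blast
  next
    case False
    define P Q where "P = (if B $ i $ j > 0 then q j * x k ^ nat (- B $ k $ j) else p j * x k ^ nat (B $ k $ j))"
      and "Q = (if B $ i $ j > 0 then p j * x k ^ nat (B $ k $ j) else q j * x k ^ nat (- B $ k $ j))"
    have P: "unit_in A P" "Q \<in> A" unfolding P_def Q_def using PA by (auto simp: unit_in_def)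
    have Mj: "M j = P + Q * x i ^ nat \<bar>B $ i $ j\<bar>"
      unfolding exch3[OF d sk0] P_def Q_def using False by (auto simp: mult_ac)
    show ?thesis
      using rank2_inter[OF A x_nz x_nz Mi P _ Mj fracs_without(1) K fracs_without(2) z1 z2] False unfolding goal by simp
  qed
qed

lemma pair_alg_subset_left:
  assumes d: "distinct3 i j k"
  shows "pair_alg R x p q B i j k \<subseteq> gen (R \<union> {x i, y i, x j, 1 / x j, x k, 1 / x k})"
proof -
  let ?T = "gen (R \<union> {x i, y i, x j, 1 / x j, x k, 1 / x k})"
  have "M j \<in> ?T" by (rule M_in[OF is_subring_gen _ d]) (auto intro: gen_base)
  then have "M j * (1 / x j) \<in> ?T" by (intro gen_closed) (auto intro: gen_base)
  then have "y j \<in> ?T" by (simp add: exch_dual_def)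
  then show ?thesis unfolding pair_alg_def by (intro gen_mono) (auto intro: gen_base)
qed

lemma pair_alg_from_others:
  assumes d: "distinct3 i j k" and cop: "B $ i $ j = 0 \<Longrightarrow> coprime_at i j k"
    and z: "z \<in> pair_alg R x p q B i k j" "z \<in> pair_alg R x p q B j k i"
  shows "z \<in> pair_alg R x p q B i j k"
proof (rule pair_alg_inter[OF d cop])
  show "z \<in> gen (R \<union> {x i, y i, x j, 1 / x j, x k, 1 / x k})"
    using pair_alg_subset_left[OF distinct3_perm(2)[OF d]] z(1) by (auto simp: insert_commute)
  show "z \<in> gen (R \<union> {x i, 1 / x i, x j, y j, x k, 1 / x k})"
    using pair_alg_subset_left[OF distinct3_perm(3)[OF d]] z(2) by (auto simp: insert_commute)
qed

lemma mutated_exch_same: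
  assumes m: "mutated k x p q B x' p' q'"
  shows "exch_poly x' p' q' (matrix_mutation k B) k = M k"
proof -
  have "mon x' m = mon x m" if "m k = 0" for m
    by (rule mon_cong[of k]) (use m that in \<open>auto simp: mutated_def\<close>)
  then show ?thesis using m sk0 unfolding exch_poly_def mutated_def by (simp add: matrix_mutation_k)
qed

lemma powi_split: "(v::'a) \<noteq> 0 \<Longrightarrow> v ^ nat b = v powi b * v ^ nat (- b)"
  by (cases "b \<ge> 0") (auto simp: power_int_def simp flip: power_mult_distrib)

lemma powi_add_mult: "(v::'a) \<noteq> 0 \<Longrightarrow> v powi (c + int (m * n)) = v powi c * (v ^ m) ^ n"
  by (simp only: power_int_add power_int_of_nat power_mult simp_thms)

text \<open>For unlinked i and j the exchange polynomial of j changes only by a unit. For linked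
  ones the sign of b_ij decides which monomial of M_j contains x_i, and
  \<open>exchange_rank2_mutate\<close> applies with p and q in the corresponding roles.\<close>

lemma mutated_dual:
  assumes m: "mutated i x p q B x' p' q'" and d: "distinct3 i j k"
    and p': "\<And>l. unit_in R (p' l)" and q': "\<And>l. unit_in R (q' l)"
  shows "exch_dual x' p' q' (matrix_mutation i B) j \<in> pair_alg R x p q B i j k"
proof -
  let ?B = "matrix_mutation i B"
  define A where "A = gen (R \<union> {x k, 1 / x k})"
  have A: "is_subring A" unfolding A_def by (rule is_subring_gen)
  have RA: "R \<subseteq> A" and xA: "x k \<in> A" "1 / x k \<in> A" unfolding A_def by (auto intro: gen_base)
  have ne: "i \<noteq> j" "i \<noteq> k" "j \<noteq> k" using d unfolding distinct3_def by auto
  have dji: "distinct3 j i k" by (rule distinct3_perm(1)[OF d])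
  have goal: "gen (A \<union> {x i, M i / x i, x j, M j / x j}) = pair_alg R x p q B i j k"
    unfolding M_div A_def gen_gen pair_alg_def by (simp add: insert_commute)
  have x'i: "x' i = M i / x i" using m x_nz[of i] unfolding mutated_def by (simp add: field_simps)
  have x'o: "x' j = x j" "x' k = x k" using m ne unfolding mutated_def by auto
  have B': "?B $ i $ j = - B $ i $ j" "?B $ j $ j = 0"
    using ne sk0 skD(1)[of i j] skD(1)[of j i] skD(2)[of i j] by (auto simp: matrix_mutation_k matrix_mutation_other max_def)
  have B'k: "?B $ k $ j = B $ k $ j + (if B $ i $ j \<ge> 0 then max (B $ k $ i) 0 else max (- B $ k $ i) 0) * B $ i $ j"
    using ne by (simp add: matrix_mutation_other)
  have ratio: "p' j * q j = (if B $ i $ j \<ge> 0 then p i else q i) powi (B $ i $ j) * p j * q' j"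
    using m ne unfolding mutated_def by simp
  have M': "exch_poly x' p' q' ?B j = p' j * (x' i ^ nat (- B $ i $ j) * x k ^ nat (?B $ k $ j)) +
      q' j * (x' i ^ nat (B $ i $ j) * x k ^ nat (- ?B $ k $ j))"
    using exch3[OF d B'(2), of x' p' q'] unfolding x'o B'(1) by simp
  define v where "v = x k"
  have v: "v \<noteq> 0" unfolding v_def by (rule x_nz)
  have v_unit: "unit_in A (v ^ n)" for n
    by (rule unit_in_power[OF A]) (use xA x_nz in \<open>auto simp: unit_in_def divide_inverse v_def\<close>)
  have U: "unit_in A (p l * v ^ n)" "unit_in A (q l * v ^ n)" "unit_in A (p' l * v ^ n)" "unit_in A (q' l * v ^ n)" for l n
    using unit_in_mult[OF A unit_in_subset[OF p RA] v_unit] unit_in_mult[OF A unit_in_subset[OF q RA] v_unit]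
      unit_in_mult[OF A unit_in_subset[OF p' RA] v_unit] unit_in_mult[OF A unit_in_subset[OF q' RA] v_unit] by auto
  have UA: "p l * v ^ n \<in> A" "q l * v ^ n \<in> A" "p' l * v ^ n \<in> A" "q' l * v ^ n \<in> A" for l n
    using U unfolding unit_in_def by auto
  have Mi3: "M i = p i * (x j ^ nat (B $ j $ i) * v ^ nat (B $ k $ i)) + q i * (x j ^ nat (- B $ j $ i) * v ^ nat (- B $ k $ i))"
    unfolding v_def by (rule exch3[OF dji sk0])
  have Mj3: "M j = p j * (x i ^ nat (B $ i $ j) * v ^ nat (B $ k $ j)) + q j * (x i ^ nat (- B $ i $ j) * v ^ nat (- B $ k $ j))"
    unfolding v_def by (rule exch3[OF d sk0])
  have "exch_poly x' p' q' ?B j / x j \<in> gen (A \<union> {x i, M i / x i, x j, M j / x j})"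
  proof (cases "B $ i $ j" "0 :: int" rule: linorder_cases)
    case equal
    have qnz: "q j \<noteq> 0" "p j \<noteq> 0" using q p unfolding unit_in_def by auto
    have "p' j * q j = p j * q' j" using ratio equal by simp
    define c where "c = q' j / q j"
    have c: "p' j = c * p j" "q' j = c * q j"
      using \<open>p' j * q j = p j * q' j\<close> qnz by (simp_all add: c_def field_simps)
    have "?B $ k $ j = B $ k $ j" using B'k equal by simp
    then have "exch_poly x' p' q' ?B j = c * M j"
      unfolding M' Mj3 equal v_def c by (simp add: algebra_simps)
    then have "exch_poly x' p' q' ?B j / x j = (q' j / q j) * (M j / x j)" by (simp add: c_def)
    moreover have "q' j / q j \<in> A" using unit_in_divide[OF R q' q] RA unfolding unit_in_def by blast
    then have "(q' j / q j) * (M j / x j) \<in> gen (A \<union> {x i, M i / x i, x j, M j / x j})"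
      by (intro gen_closed(5)) (auto intro: gen_base)
    ultimately show ?thesis by (simp only:)
  next
    case greater
    then have Bji: "B $ j $ i < 0" using skD by simp
    define b where "b = nat (B $ i $ j)"
    show ?thesis
    proof (rule exchange_rank2_mutate[OF A x_nz x_nz UA(1) UA(2) UA(1) UA(2) UA(3) UA(4) U(4) U(2)])
      show "0 < b" "0 < nat (- B $ j $ i)" using greater Bji unfolding b_def by auto
      show "M i = p i * v ^ nat (B $ k $ i) + q i * v ^ nat (- B $ k $ i) * x j ^ nat (- B $ j $ i)"
        unfolding Mi3 using Bji by (simp add: mult_ac)
      show "M j = p j * v ^ nat (B $ k $ j) * x i ^ b + q j * v ^ nat (- B $ k $ j)"
        unfolding Mj3 b_def using greater by (simp add: mult_ac)
      show "exch_poly x' p' q' ?B j = p' j * v ^ nat (?B $ k $ j) + q' j * v ^ nat (- ?B $ k $ j) * (M i / x i) ^ b"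
        unfolding M' x'i[symmetric] b_def v_def using greater by (simp add: mult_ac)
      \<comment> \<open>The remaining identity of coefficients splits into the mutation of the
        exponent of x_k, \<open>e\<close>, and the mutation of the coefficient ratio,
        \<open>r\<close>.\<close>
      have e: "?B $ k $ j = B $ k $ j + int (nat (B $ k $ i) * b)"
        unfolding B'k b_def using greater by (simp add: max_def)
      have r: "p' j * q j = p i ^ b * p j * q' j" using ratio greater unfolding b_def power_int_def by simp
      have "v powi (?B $ k $ j) = v powi (B $ k $ j) * (v ^ nat (B $ k $ i)) ^ b"
        unfolding e by (rule powi_add_mult[OF v])
      then have "v ^ nat (?B $ k $ j) = v powi (B $ k $ j) * (v ^ nat (B $ k $ i)) ^ b * v ^ nat (- ?B $ k $ j)"
        using powi_split[OF v, of "?B $ k $ j"] by simp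
      then show "p' j * v ^ nat (?B $ k $ j) * (q j * v ^ nat (- B $ k $ j)) =
          q' j * v ^ nat (- ?B $ k $ j) * (p j * v ^ nat (B $ k $ j)) * (p i * v ^ nat (B $ k $ i)) ^ b"
        using r powi_split[OF v, of "B $ k $ j"] by (simp add: power_mult_distrib mult_ac)
    qed
  next
    case less
    then have Bji: "B $ j $ i > 0" using skD by simp
    define b where "b = nat (- B $ i $ j)"
    show ?thesis
    proof (rule exchange_rank2_mutate[OF A x_nz x_nz UA(2) UA(1) UA(2) UA(1) UA(4) UA(3) U(3) U(1)])
      show "0 < b" "0 < nat (B $ j $ i)" using less Bji unfolding b_def by auto
      show "M i = q i * v ^ nat (- B $ k $ i) + p i * v ^ nat (B $ k $ i) * x j ^ nat (B $ j $ i)"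
        unfolding Mi3 using Bji by (simp add: mult_ac)
      show "M j = q j * v ^ nat (- B $ k $ j) * x i ^ b + p j * v ^ nat (B $ k $ j)"
        unfolding Mj3 b_def using less by (simp add: mult_ac)
      show "exch_poly x' p' q' ?B j = q' j * v ^ nat (- ?B $ k $ j) + p' j * v ^ nat (?B $ k $ j) * (M i / x i) ^ b"
        unfolding M' x'i[symmetric] b_def v_def using less by (simp add: mult_ac)
      \<comment> \<open>Here b_kj does not increase, so the equation is turned round to keep a
        natural number as the difference.\<close>
      have e: "B $ k $ j = ?B $ k $ j + int (nat (- B $ k $ i) * b)"
        unfolding B'k b_def using less by (simp add: max_def)
      have "q i \<noteq> 0" using q unfolding unit_in_def by blast
      have "p' j * q j * q i ^ b = (q i powi (B $ i $ j) * q i ^ b) * (p j * q' j)"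
        using ratio less by (simp add: mult_ac)
      moreover have "q i powi (B $ i $ j) * q i ^ b = 1"
        using powi_split[OF \<open>q i \<noteq> 0\<close>, of "B $ i $ j"] less unfolding b_def by simp
      ultimately have r: "p' j * q j * q i ^ b = p j * q' j" by simp
      have "v powi (B $ k $ j) = v powi (?B $ k $ j) * (v ^ nat (- B $ k $ i)) ^ b"
        by (subst e) (rule powi_add_mult[OF v])
      then have "v ^ nat (B $ k $ j) = v powi (?B $ k $ j) * (v ^ nat (- B $ k $ i)) ^ b * v ^ nat (- B $ k $ j)"
        using powi_split[OF v, of "B $ k $ j"] by simp
      then show "q' j * v ^ nat (- ?B $ k $ j) * (p j * v ^ nat (B $ k $ j)) =
          p' j * v ^ nat (?B $ k $ j) * (q j * v ^ nat (- B $ k $ j)) * (q i * v ^ nat (- B $ k $ i)) ^ b"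
        using r powi_split[OF v, of "?B $ k $ j"] by (simp add: power_mult_distrib mult_ac)
    qed
  qed
  then show ?thesis unfolding goal exch_dual_def x'o .
qed

text \<open>One inclusion is enough, as it pulls cluster variables of a distant seed back to the
  initial one. For pairs containing l the new generators lie in the old ring; coprimality enters
  only for the pair of the other two vertices, which is deduced from those.\<close>

lemma upper_alg_mutated_subset:
  assumes m: "mutated l x p q B x' p' q'"
    and p': "\<And>l. unit_in R (p' l)" and q': "\<And>l. unit_in R (q' l)"
    and cop: "\<And>i j k. distinct3 i j k \<Longrightarrow> B $ i $ j = 0 \<Longrightarrow> coprime_at i j k"
  shows "upper_alg R x' p' q' (matrix_mutation l B) \<subseteq> upper_alg R x p q B"
proof
  let ?B = "matrix_mutation l B"
  fix z assume z: "z \<in> upper_alg R x' p' q' ?B"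
  have main: "z \<in> pair_alg R x p q B l j k" if d: "distinct3 l j k" for j k
  proof -
    have ne: "l \<noteq> j" "l \<noteq> k" "j \<noteq> k" using d unfolding distinct3_def by auto
    have x'l: "x' l = y l" using m x_nz[of l] unfolding mutated_def exch_dual_def by (simp add: field_simps)
    have x'o: "x' j = x j" "x' k = x k" using m ne unfolding mutated_def by auto
    have "exch_dual x' p' q' ?B l = x l"
      unfolding exch_dual_def mutated_exch_same[OF m] x'l using x_nz exch_nz by (simp add: exch_dual_def)
    moreover have "exch_dual x' p' q' ?B j \<in> pair_alg R x p q B l j k"
      by (rule mutated_dual[OF m d p' q'])
    ultimately have "pair_alg R x' p' q' ?B l j k \<subseteq> pair_alg R x p q B l j k"
      unfolding pair_alg_def[of R x' p' q'] x'l x'o unfolding pair_alg_def by (intro gen_mono) (auto intro: gen_base)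
    then show ?thesis using z d unfolding upper_alg_def by blast
  qed
  show "z \<in> upper_alg R x p q B"
    unfolding upper_alg_def
  proof (intro CollectI allI impI)
    fix i j k :: 'n assume d: "distinct3 i j k"
    then have "l \<in> {i, j, k}" unfolding distinct3_def by blast
    then consider "l = i" | "l = j" | "l = k" by blast
    then show "z \<in> pair_alg R x p q B i j k"
    proof cases
      case 1
      then show ?thesis using main d by blast
    next
      case 2
      then show ?thesis using main[of i k] distinct3_perm(1)[OF d] pair_alg_swap by simp
    next
      case 3
      have "z \<in> pair_alg R x p q B k i j" "z \<in> pair_alg R x p q B k j i"
        using main[of i j] main[of j i] distinct3_perm[OF d] 3 by auto
      then show ?thesis
        using pair_alg_from_others[OF d cop[OF d]] pair_alg_swap by metis
    qed
  qed
qed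

text \<open>As j is linked to i alone, M_k is free of x_j, and both generators belonging to k can be
  put into the base ring while x_j stays transcendental. Then \<open>rank2_inter\<close> for i and j
  merges two of the pair rings.\<close>

lemma upper_alg_subset_lower_alg_leaf:
  assumes d: "distinct3 i j k" and Bij: "B $ i $ j \<noteq> 0" and Bkj: "B $ k $ j = 0"
  shows "upper_alg R x p q B \<subseteq> lower_alg R x p q B"
proof
  fix z assume z: "z \<in> upper_alg R x p q B"
  define A where "A = gen (R \<union> {x k, y k})"
  have A: "is_subring A" unfolding A_def by (rule is_subring_gen)
  have RA: "R \<subseteq> A" and xA: "x k \<in> A" "y k \<in> A" unfolding A_def by (auto intro: gen_base)
  have ne: "i \<noteq> j" "i \<noteq> k" "j \<noteq> k" using d unfolding distinct3_def by auto
  have Bjk: "B $ j $ k = 0" using Bkj skD(2) by simp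
  define P Q where "P = (if B $ i $ j > 0 then q j else p j)" and "Q = (if B $ i $ j > 0 then p j else q j)"
  have P: "unit_in A P" "Q \<in> A" unfolding P_def Q_def using unit_in_subset[OF p RA] unit_in_subset[OF q RA] pR qR RA by auto
  have Mj: "M j = P + Q * x i ^ nat \<bar>B $ i $ j\<bar>"
    unfolding exch3[OF d sk0] P_def Q_def using Bij Bkj by auto
  have Mi: "M i \<in> gen (A \<union> {x j})"
    by (rule M_in[OF is_subring_gen _ distinct3_perm(1)[OF d]]) (use RA xA in \<open>auto intro: gen_base\<close>)
  have Mk: "M k \<in> fracs_without R x j"
    by (rule M_in_unlinked[OF fracs_without(1) fracs_without(3), of i k j]) (use d Bjk ne distinct3_perm fracs_without_x(1) in auto)
  then have "M k * (1 / x k) \<in> fracs_without R x j" using ne by (intro subring_mult[OF fracs_without(1)] fracs_without_x) auto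
  then have "y k \<in> fracs_without R x j" by (simp add: exch_dual_def)
  then have K: "gen (A \<union> {x i, 1 / x i}) \<subseteq> fracs_without R x j"
    unfolding A_def gen_gen using fracs_without(3)[of j] fracs_without_x[of i j] fracs_without_x[of k j] ne by (intro gen_least fracs_without(1)) auto
  have "z \<in> pair_alg R x p q B i k j" "z \<in> pair_alg R x p q B j k i"
    using z distinct3_perm[OF d] unfolding upper_alg_def by auto
  then have "z \<in> gen (A \<union> {x i, M i / x i, x j, 1 / x j})" "z \<in> gen (A \<union> {x i, 1 / x i, x j, M j / x j})"
    unfolding M_div A_def gen_gen pair_alg_def by (simp_all add: insert_commute)
  then have "z \<in> gen (A \<union> {x i, M i / x i, x j, M j / x j})"
    using rank2_inter[OF A x_nz x_nz Mi P _ Mj fracs_without(1) K fracs_without(2)] Bij by simp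
  moreover have "gen (A \<union> {x i, M i / x i, x j, M j / x j}) \<subseteq> lower_alg R x p q B"
    unfolding M_div A_def gen_gen lower_alg_def by (rule gen_subset) auto
  ultimately show "z \<in> lower_alg R x p q B" by blast
qed

text \<open>The assumption says that \<open>s\<close> is a source or a sink linked to both other vertices.\<close>

lemma upper_alg_subset_lower_alg_source:
  assumes d: "distinct3 i j s" and pos: "B $ i $ s * B $ j $ s > 0"
  shows "upper_alg R x p q B \<subseteq> lower_alg R x p q B"
proof
  fix z assume z: "z \<in> upper_alg R x p q B"
  have ne: "i \<noteq> j" "i \<noteq> s" "j \<noteq> s" using d unfolding distinct3_def by auto
  have disj: "B $ i $ s > 0 \<and> B $ j $ s > 0 \<or> B $ i $ s < 0 \<and> B $ j $ s < 0"
    using pos by (simp add: zero_less_mult_iff)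
  define a b where "a = nat \<bar>B $ i $ s\<bar>" and "b = nat \<bar>B $ j $ s\<bar>"
  have ab: "0 < a" "0 < b" using disj unfolding a_def b_def by auto
  \<comment> \<open>Both entries of column s have the same sign, so one monomial of M_s is 1; P is
    its coefficient.\<close>
  define P Q where "P = (if B $ i $ s > 0 then q s else p s)" and "Q = (if B $ i $ s > 0 then p s else q s)"
  have P: "unit_in R P" "Q \<in> R" unfolding P_def Q_def using p q pR qR by auto
  have Ms: "M s = P + Q * (x i ^ a * x j ^ b)"
    unfolding exch3[OF distinct3_perm(2)[OF d] sk0] P_def Q_def a_def b_def using disj by auto
  define L where "L = lower_alg R x p q B"
  have L: "is_subring L" unfolding L_def lower_alg_def by (rule is_subring_gen)
  define A1 A2 T0 T1 E where "A1 = gen (R \<union> {x j, y j})" and "A2 = gen (R \<union> {x i})" and "T0 = gen (R \<union> {x i, x j})"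
    and "T1 = gen (R \<union> {x i, 1 / x i, x j, 1 / x j})" and "E = gen (T1 \<union> {x s, M s / x s})"
  have subr: "is_subring A1" "is_subring A2" "is_subring T0" "is_subring T1" "is_subring E"
    unfolding A1_def A2_def T0_def T1_def E_def by (rule is_subring_gen)+
  have RA: "R \<subseteq> A1" "R \<subseteq> A2" "R \<subseteq> T0" "R \<subseteq> T1" and xA: "x j \<in> A1" "y j \<in> A1" "x i \<in> A2" "x i \<in> T0" "x j \<in> T0"
    unfolding A1_def A2_def T0_def T1_def by (auto intro: gen_base)
  have T01: "T0 \<subseteq> T1" unfolding T0_def T1_def by (rule gen_subset) auto
  have Mi: "M i \<in> gen (A1 \<union> {x s})"
    by (rule M_in[OF is_subring_gen _ distinct3_perm(1)[OF d]]) (use RA xA in \<open>auto intro: gen_base\<close>)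
  have Mj: "M j \<in> gen (A2 \<union> {x s})"
    by (rule M_in[OF is_subring_gen _ d]) (use RA xA in \<open>auto intro: gen_base\<close>)
  \<comment> \<open>Two reductions: the first trades poles in x_s against \<open>y i\<close>, the
    second against \<open>y j\<close>. The final remainder r2 contains neither.\<close>
  have "z \<in> pair_alg R x p q B i j s" using z d unfolding upper_alg_def by auto
  then have "z \<in> gen (A1 \<union> {x i, M i / x i, x s, 1 / x s})"
    unfolding M_div A1_def gen_gen pair_alg_def by (simp add: insert_commute)
  moreover have "M s = P + (Q * x j ^ b) * x i ^ a" unfolding Ms by (simp add: mult_ac)
  moreover have "Q * x j ^ b \<in> A1" using P RA xA by (intro subring_mult[OF subr(1)] subring_power[OF subr(1)]) auto
  ultimately obtain l1 r1 where lr1: "l1 \<in> gen (A1 \<union> {x i, M i / x i, x s, M s / x s})"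
      "r1 \<in> gen (A1 \<union> {x i, x s, 1 / x s})" "z = l1 + r1"
    using rank2_reduce[OF subr(1) x_nz x_nz Mi unit_in_subset[OF P(1) RA(1)] _ ab(1)] by blast
  have "r1 \<in> gen (A2 \<union> {x j, M j / x j, x s, 1 / x s})"
    using lr1(2) unfolding M_div A1_def A2_def gen_gen by (simp add: insert_commute)
  moreover have "M s = P + (Q * x i ^ a) * x j ^ b" unfolding Ms by (simp add: mult_ac)
  moreover have "Q * x i ^ a \<in> A2" using P RA xA by (intro subring_mult[OF subr(2)] subring_power[OF subr(2)]) auto
  ultimately obtain l2 r2 where lr2: "l2 \<in> gen (A2 \<union> {x j, M j / x j, x s, M s / x s})"
      "r2 \<in> gen (A2 \<union> {x j, x s, 1 / x s})" "r1 = l2 + r2"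
    using rank2_reduce[OF subr(2) x_nz x_nz Mj unit_in_subset[OF P(1) RA(2)] _ ab(2)] by blast
  have "l1 \<in> L"
    using lr1(1) gen_subset[of "R \<union> {x j, y j} \<union> {x i, M i / x i, x s, M s / x s}" "R \<union> range x \<union> range y"]
    unfolding M_div A1_def gen_gen L_def lower_alg_def by auto
  moreover have "l2 \<in> L"
    using lr2(1) gen_subset[of "R \<union> {x i} \<union> {x j, M j / x j, x s, M s / x s}" "R \<union> range x \<union> range y"]
    unfolding M_div A2_def gen_gen L_def lower_alg_def by auto
  ultimately have l: "l1 + l2 \<in> L" by (rule subring_add[OF L])
  \<comment> \<open>The remainder also lies in E, because z does, through the pair {i, s}, and so
    does all of L.\<close>
  have RE: "R \<subseteq> E" and xE: "x i \<in> E" "x j \<in> E" "x s \<in> E" "1 / x i \<in> E" "1 / x j \<in> E" "y s \<in> E"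
    unfolding E_def T1_def gen_gen M_div by (auto intro: gen_base)
  have "M i \<in> E" "M j \<in> E"
    by (rule M_in[OF subr(5) RE distinct3_perm(1)[OF d]] M_in[OF subr(5) RE d]; use xE in simp)+
  then have "M i * (1 / x i) \<in> E" "M j * (1 / x j) \<in> E"
    using subring_mult[OF subr(5) _ xE(4)] subring_mult[OF subr(5) _ xE(5)] by blast+
  then have yE: "y i \<in> E" "y j \<in> E" by (simp_all add: exch_dual_def)
  have U: "UNIV = {i, j, s}" using d unfolding distinct3_def by blast
  have "range x \<union> range y \<subseteq> E" unfolding U using xE yE by auto
  then have LE: "L \<subseteq> E" unfolding L_def lower_alg_def using RE by (intro gen_least subr(5)) auto
  have "z \<in> pair_alg R x p q B i s j" using z distinct3_perm[OF d] unfolding upper_alg_def by auto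
  moreover have "pair_alg R x p q B i s j \<subseteq> E"
    unfolding pair_alg_def using RE xE yE by (intro gen_least subr(5)) auto
  ultimately have "z \<in> E" by blast
  have r2: "r2 = z - (l1 + l2)" using lr1(3) lr2(3) by simp
  have "r2 \<in> E" unfolding r2 using \<open>z \<in> E\<close> l LE by (intro subring_diff[OF subr(5)]) auto
  have Ms0: "M s \<in> T0" by (rule M_in[OF subr(3) RA(3) distinct3_perm(2)[OF d]]) (use xA in auto)
  have K: "T1 \<subseteq> fracs_without R x s"
    unfolding T1_def using fracs_without(3)[of s] fracs_without_x[of i s] fracs_without_x[of j s] ne by (intro gen_least fracs_without(1)) auto
  have r0: "r2 \<in> exch_ext T0 1 (x s)"
    using lr2(2) exch_ext_eq_gen[OF subr(3) subring_1[OF subr(3)] x_nz[of s]]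
    unfolding A2_def T0_def gen_gen by (simp add: insert_commute)
  have r1: "r2 \<in> exch_ext T1 (M s) (x s)"
    using \<open>r2 \<in> E\<close> exch_ext_eq_gen[OF subr(4) _ x_nz[of s]] Ms0 T01 unfolding E_def by blast
  \<comment> \<open>Poles in x_j and in x_i are cleared one after the other; the final exponent
    serves both because a and b are positive.\<close>
  have loc: "\<exists>N. (x i ^ a * x j ^ b) ^ N * e \<in> T0" if e: "e \<in> T1" for e
  proof -
    define C where "C = gen (R \<union> {x i, 1 / x i})"
    have C: "is_subring C" unfolding C_def by (rule is_subring_gen)
    have "e \<in> gen (C \<union> {x j, 1 / x j})" using e unfolding T1_def C_def gen_gen by (simp add: insert_commute)
    then obtain N where N: "\<forall>n\<ge>N. x j ^ n * e \<in> gen (C \<union> {x j})" using gen_laurent_clear[OF C x_nz] by blast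
    define D where "D = gen (R \<union> {x j})"
    have D: "is_subring D" unfolding D_def by (rule is_subring_gen)
    have "gen (C \<union> {x j}) = gen (D \<union> {x i, 1 / x i})" unfolding C_def D_def gen_gen by (simp add: insert_commute)
    then have "x j ^ N * e \<in> gen (D \<union> {x i, 1 / x i})" using N by auto
    then obtain N' where N': "\<forall>n\<ge>N'. x i ^ n * (x j ^ N * e) \<in> gen (D \<union> {x i})" using gen_laurent_clear[OF D x_nz] by blast
    have DT0: "gen (D \<union> {x i}) = T0" unfolding D_def T0_def gen_gen by (simp add: insert_commute)
    define n where "n = N + N'"
    have n: "a * n \<ge> N'" "b * n \<ge> N" using ab unfolding n_def
      by (metis One_nat_def Suc_leI le_add2 le_trans mult_1 mult_le_mono1, metis One_nat_def Suc_leI le_add1 le_trans mult_1 mult_le_mono1)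
    have "x i ^ (a * n) * (x j ^ N * e) \<in> T0" using N' n(1) DT0 by blast
    then have "x j ^ (b * n - N) * (x i ^ (a * n) * (x j ^ N * e)) \<in> T0"
      by (rule subring_mult[OF subr(3) subring_power[OF subr(3) xA(5)]])
    moreover have "x j ^ (b * n) = x j ^ (b * n - N) * x j ^ N" using n(2) by (simp flip: power_add)
    ultimately have "(x i ^ a * x j ^ b) ^ n * e \<in> T0"
      by (simp add: power_mult_distrib power_mult[symmetric] mult_ac)
    then show ?thesis by blast
  qed
  have "r2 \<in> exch_ext T0 (M s) (x s)"
  proof (rule exch_ext_inter[OF subr(3) subring_1[OF subr(3)] subr(4) _ fracs_without(1) _ K fracs_without(2) r0 r1])
    show "M s \<in> T1" "T0 \<subseteq> fracs_without R x s" using Ms0 T01 K by auto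
    fix n e0 e1 assume e: "e0 \<in> T0" "e1 \<in> T1" "1 ^ n * e0 = M s ^ n * e1"
    have "e1 \<in> T0"
      by (rule absorb_power[OF subr(3) unit_in_subset[OF P(1) RA(3)] _ _ Ms subr(4) T01 loc e(2), of n])
        (use e P RA xA in \<open>auto intro: subring_mult[OF subr(3)] subring_power[OF subr(3)]\<close>)
    then show "\<exists>e\<in>T0. 1 ^ n * e0 = M s ^ n * e" using e by blast
  qed
  then have "r2 \<in> gen (T0 \<union> {x s, M s / x s})" using exch_ext_eq_gen[OF subr(3) Ms0 x_nz] by simp
  moreover have "gen (T0 \<union> {x s, M s / x s}) \<subseteq> L"
    unfolding M_div T0_def gen_gen L_def lower_alg_def by (rule gen_subset) auto
  ultimately have "r2 \<in> L" by blast
  with L l have "(l1 + l2) + r2 \<in> L" by (rule subring_add)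
  then show "z \<in> lower_alg R x p q B" unfolding L_def r2 by simp
qed

text \<open>Either some vertex is linked to exactly one other, or all vertices are linked. In the
  second case some column has two entries of equal sign, since otherwise every vertex is passed
  through and the triangle is an oriented cycle.\<close>

lemma upper_alg_subset_lower_alg:
  assumes card: "CARD('n) = 3" and acyc: "acyclic {(i, j). B $ i $ j > 0}" and nz: "B $ i0 $ j0 \<noteq> 0"
  shows "upper_alg R x p q B \<subseteq> lower_alg R x p q B"
proof -
  have ne0: "i0 \<noteq> j0" using nz sk0 by auto
  have "\<exists>k0. k0 \<notin> {i0, j0}"
  proof (rule ccontr)
    assume "\<nexists>k0. k0 \<notin> {i0, j0}"
    then have "UNIV = {i0, j0}" by auto
    then have "CARD('n) = card {i0, j0}" by simp
    then show False using card ne0 by simp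
  qed
  then obtain k0 where k0: "k0 \<noteq> i0" "k0 \<noteq> j0" by auto
  then have d0: "distinct3 i0 j0 k0" using UNIV_eq3[OF card ne0, of k0] ne0 unfolding distinct3_def by auto
  show ?thesis
  proof (cases "\<exists>i j k. distinct3 i j k \<and> B $ i $ j \<noteq> 0 \<and> B $ k $ j = 0")
    case True
    then show ?thesis using upper_alg_subset_lower_alg_leaf by blast
  next
    case False
    then have all: "B $ k $ j \<noteq> 0" if "distinct3 i j k" "B $ i $ j \<noteq> 0" for i j k using that by blast
    have "B $ k0 $ j0 \<noteq> 0" using all[OF d0 nz] .
    moreover have "B $ j0 $ i0 \<noteq> 0" using nz skD(2) by blast
    then have "B $ k0 $ i0 \<noteq> 0" using all[OF distinct3_perm(1)[OF d0]] by blast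
    ultimately have nz': "B $ k0 $ j0 \<noteq> 0" "B $ k0 $ i0 \<noteq> 0" "B $ j0 $ k0 \<noteq> 0" "B $ i0 $ k0 \<noteq> 0"
        "B $ j0 $ i0 \<noteq> 0" "B $ i0 $ j0 \<noteq> 0"
      using nz skD(2) by blast+
    have nzs: "B $ i $ j \<noteq> 0" if "i \<noteq> j" for i j
    proof -
      have "i \<in> {i0, j0, k0}" "j \<in> {i0, j0, k0}" using d0 unfolding distinct3_def by blast+
      then show ?thesis using that nz' by auto
    qed
    show ?thesis
    proof (cases "\<exists>i j s. distinct3 i j s \<and> B $ i $ s * B $ j $ s > 0")
      case True
      then show ?thesis using upper_alg_subset_lower_alg_source by blast
    next
      case False
      have mixed: "B $ j $ s < 0" if "distinct3 i j s" "B $ i $ s > 0" for i j s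
      proof (rule ccontr)
        assume "\<not> B $ j $ s < 0"
        then have "B $ j $ s > 0" using nzs[of j s] that unfolding distinct3_def by force
        then have "B $ i $ s * B $ j $ s > 0" using that by simp
        then show False using False that by blast
      qed
      have cycle: False if d: "distinct3 i j k" and ij: "B $ i $ j > 0" for i j k
      proof -
        have "B $ k $ j < 0" by (rule mixed[OF distinct3_perm(2)[OF d] ij])
        then have jk: "B $ j $ k > 0" using skD(1)[of j k] by blast
        then have "B $ i $ k < 0" by (rule mixed[OF distinct3_perm(1)[OF d]])
        then have ki: "B $ k $ i > 0" using skD(1)[of k i] by blast
        have "(i, i) \<in> {(i, j). B $ i $ j > 0}\<^sup>+"
        proof (rule trancl_trans[OF trancl_trans])
          show "(i, j) \<in> {(i, j). B $ i $ j > 0}\<^sup>+" "(j, k) \<in> {(i, j). B $ i $ j > 0}\<^sup>+"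
            "(k, i) \<in> {(i, j). B $ i $ j > 0}\<^sup>+"
            using ij jk ki by (auto intro!: r_into_trancl)
        qed
        then show False using acyc unfolding acyclic_def by blast
      qed
      have "B $ i0 $ j0 > 0 \<or> B $ j0 $ i0 > 0" using nz skD(1)[of j0 i0] by linarith
      then show ?thesis using cycle[OF d0] cycle[OF distinct3_perm(1)[OF d0]] by blast
    qed
  qed
qed

end

section \<open>Perturbed coefficients\<close>

definition const_rat :: "'f::field \<Rightarrow> 'f poly fract" where
  "const_rat c = to_fract [:c:]"

text \<open>The variable t of the perturbation.\<close>

definition rat_var :: "'f::field poly fract" where
  "rat_var = to_fract [:0, 1:]"

lemma const_rat_add: "const_rat (a + b) = const_rat a + const_rat b" and const_rat_diff: "const_rat (a - b) = const_rat a - const_rat b"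
  and const_rat_mult: "const_rat (a * b) = const_rat a * const_rat b" and const_rat_0: "const_rat 0 = 0" and const_rat_1: "const_rat 1 = 1"
  and const_rat_eq_0: "const_rat a = 0 \<longleftrightarrow> a = 0"
  by (simp_all add: const_rat_def flip: to_fract_add to_fract_diff to_fract_mult) (simp add: one_pCons[symmetric])

lemma const_rat_inverse: "const_rat (inverse a) = inverse (const_rat a)"
proof (cases "a = 0")
  case False
  then have "const_rat a * const_rat (inverse a) = 1" by (simp add: const_rat_1 flip: const_rat_mult)
  then show ?thesis by (rule inverse_unique[symmetric])
qed (simp add: const_rat_0)

lemma const_rat_divide: "const_rat (a / b) = const_rat a / const_rat b"
  by (simp add: divide_inverse const_rat_mult const_rat_inverse)

lemma const_rat_uminus: "const_rat (- a) = - const_rat a"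
  using const_rat_diff[of 0 a] by (simp add: const_rat_0)

lemma const_rat_power: "const_rat (a ^ n) = const_rat a ^ n"
  by (induction n) (auto simp: const_rat_1 const_rat_mult)

lemma const_rat_powi: "const_rat (a powi n) = const_rat a powi n"
  by (simp add: power_int_def const_rat_power const_rat_inverse)

lemma const_rat_prod: "const_rat (prod f I) = (\<Prod>i\<in>I. const_rat (f i))"
  by (induction I rule: infinite_finite_induct) (auto simp: const_rat_1 const_rat_mult)

lemma const_rat_mon: "mon (\<lambda>i. const_rat (x i)) m = const_rat (mon x m)"
  by (simp add: mon_def const_rat_prod const_rat_power)

lemma rat_var_nz: "rat_var \<noteq> 0"
  by (simp add: rat_var_def)

lemma to_fract_power: "to_fract (a ^ n) = to_fract a ^ n"
  by (induction n) auto

lemma rat_var_power: "rat_var ^ n = to_fract (monom 1 n)"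
  by (simp add: rat_var_def monom_altdef flip: to_fract_power)

text \<open>The order in t is well defined: dividing by the smaller power leaves a nonzero constant
  equal to a polynomial without constant term.\<close>

lemma const_rat_rat_var_powi_inj:
  assumes "const_rat u * rat_var powi m = const_rat v * rat_var powi n" "u \<noteq> 0" "v \<noteq> 0"
  shows "m = n"
proof -
  have *: "n \<le> m" if "const_rat u * rat_var powi m = const_rat v * rat_var powi n" "u \<noteq> 0" for u v :: 'a and m n
  proof (rule ccontr)
    assume "\<not> n \<le> m"
    define k where "k = nat (n - m)"
    have k: "0 < k" "n = m + int k" using \<open>\<not> n \<le> m\<close> unfolding k_def by auto
    have "const_rat u * rat_var powi m = (const_rat v * rat_var ^ k) * rat_var powi m"
      using that(1) unfolding k(2) by (simp add: power_int_add rat_var_nz mult_ac)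
    then have "const_rat u = const_rat v * rat_var ^ k" by (simp add: rat_var_nz)
    then have "[:u:] = smult v (monom 1 k)"
      unfolding const_rat_def rat_var_power by (simp flip: to_fract_mult)
    then have "coeff [:u:] 0 = coeff (smult v (monom 1 k)) 0" by simp
    then show False using k(1) that(2) by simp
  qed
  show ?thesis using *[OF assms(1,2)] *[OF assms(1)[symmetric] assms(3)] by simp
qed

text \<open>The specialisation of a rational function at 1, as a relation because it is only partially defined.\<close>

definition specialises :: "'f::field poly fract \<Rightarrow> 'f \<Rightarrow> bool" where
  "specialises z c \<longleftrightarrow> (\<exists>a b. z * to_fract b = to_fract a \<and> poly b 1 \<noteq> 0 \<and> c * poly b 1 = poly a 1)"

lemma specialises_unique:
  assumes "specialises z c" "specialises z d"
  shows "c = d"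
proof -
  obtain a b where 1: "z * to_fract b = to_fract a" "poly b 1 \<noteq> 0" "c * poly b 1 = poly a 1"
    using assms(1) unfolding specialises_def by blast
  obtain a' b' where 2: "z * to_fract b' = to_fract a'" "poly b' 1 \<noteq> 0" "d * poly b' 1 = poly a' 1"
    using assms(2) unfolding specialises_def by blast
  have "to_fract (a * b') = to_fract (a' * b)"
    using 1(1)[symmetric] 2(1)[symmetric] by (simp add: mult_ac)
  then have "poly a 1 * poly b' 1 = poly a' 1 * poly b 1"
    by (metis to_fract_eq_iff poly_mult)
  then have "c * (poly b 1 * poly b' 1) = d * (poly b 1 * poly b' 1)"
    using 1(3)[symmetric] 2(3)[symmetric] by (simp add: mult_ac)
  then show ?thesis using 1(2) 2(2) by simp
qed

lemma specialises_const_rat: "specialises (const_rat c) c"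
  unfolding specialises_def const_rat_def by (rule exI[of _ "[:c:]"], rule exI[of _ 1]) simp

lemma specialises_0: "specialises 0 0" and specialises_1: "specialises 1 1"
  using specialises_const_rat[of 0] specialises_const_rat[of 1] by (simp_all add: const_rat_0 const_rat_1)

lemma specialises_rat_var: "specialises rat_var 1"
  unfolding specialises_def rat_var_def by (rule exI[of _ "[:0, 1:]"], rule exI[of _ 1]) simp

lemma specialises_add: "specialises z c \<Longrightarrow> specialises w d \<Longrightarrow> specialises (z + w) (c + d)"
  and specialises_diff: "specialises z c \<Longrightarrow> specialises w d \<Longrightarrow> specialises (z - w) (c - d)"
  and specialises_mult: "specialises z c \<Longrightarrow> specialises w d \<Longrightarrow> specialises (z * w) (c * d)"
proof -
  assume "specialises z c" "specialises w d"
  then obtain a b a' b' where 1: "z * to_fract b = to_fract a" "poly b 1 \<noteq> 0" "c * poly b 1 = poly a 1"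
    and 2: "w * to_fract b' = to_fract a'" "poly b' 1 \<noteq> 0" "d * poly b' 1 = poly a' 1"
    unfolding specialises_def by blast
  have b: "poly (b * b') 1 \<noteq> 0" using 1 2 by simp
  have "(z + w) * to_fract (b * b') = to_fract (a * b' + a' * b)" "(z - w) * to_fract (b * b') = to_fract (a * b' - a' * b)"
    "(z * w) * to_fract (b * b') = to_fract (a * a')"
    using 1(1)[symmetric] 2(1)[symmetric] by (simp_all add: algebra_simps)
  moreover have "(c + d) * poly (b * b') 1 = poly (a * b' + a' * b) 1" "(c - d) * poly (b * b') 1 = poly (a * b' - a' * b) 1"
    "(c * d) * poly (b * b') 1 = poly (a * a') 1"
    using 1(3)[symmetric] 2(3)[symmetric] by (simp_all add: algebra_simps)
  ultimately show "specialises (z + w) (c + d)" "specialises (z - w) (c - d)" "specialises (z * w) (c * d)"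
    unfolding specialises_def using b by blast+
qed

lemma specialises_inverse:
  assumes "specialises z c" "c \<noteq> 0"
  shows "specialises (inverse z) (inverse c)"
proof -
  obtain a b where 1: "z * to_fract b = to_fract a" "poly b 1 \<noteq> 0" "c * poly b 1 = poly a 1"
    using assms(1) unfolding specialises_def by blast
  have a: "poly a 1 \<noteq> 0" using 1 assms(2) by auto
  then have "a \<noteq> 0" by auto
  then have "z \<noteq> 0" using 1(1) by auto
  have "inverse z * to_fract a = to_fract b" unfolding 1(1)[symmetric] using \<open>z \<noteq> 0\<close> by (simp add: field_simps)
  moreover have "inverse c * poly a 1 = poly b 1" unfolding 1(3)[symmetric] using assms(2) by (simp add: field_simps)
  ultimately show ?thesis unfolding specialises_def using a by blast
qed

lemma specialises_divide: "specialises z c \<Longrightarrow> specialises w d \<Longrightarrow> d \<noteq> 0 \<Longrightarrow> specialises (z / w) (c / d)"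
  by (simp add: divide_inverse specialises_inverse specialises_mult)

lemma specialises_nonzero: "specialises z c \<Longrightarrow> c \<noteq> 0 \<Longrightarrow> z \<noteq> 0"
  using specialises_unique[OF _ specialises_0] by blast

lemma specialises_power: "specialises z c \<Longrightarrow> specialises (z ^ n) (c ^ n)"
  by (induction n) (auto intro: specialises_1 specialises_mult)

lemma specialises_prod: "(\<And>i. i \<in> I \<Longrightarrow> specialises (f i) (g i)) \<Longrightarrow> specialises (prod f I) (prod g I)"
  by (induction I rule: infinite_finite_induct) (auto intro: specialises_1 specialises_mult)

lemma specialises_rat_var_powi: "specialises ((rat_var :: 'f::field poly fract) powi n) 1"
proof -
  have "specialises ((rat_var :: 'f poly fract) ^ m) 1" for m by (metis specialises_power specialises_rat_var power_one)
  moreover have "specialises (inverse (rat_var :: 'f poly fract) ^ m) 1" for m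
    by (metis specialises_power specialises_inverse specialises_rat_var power_one inverse_1 one_neq_zero)
  ultimately show ?thesis by (simp add: power_int_def)
qed

lemma specialises_const_rat_rat_var: "specialises (const_rat c * rat_var powi n) c"
  using specialises_mult[OF specialises_const_rat specialises_rat_var_powi] by simp

lemma specialises_mon: "(\<And>i. specialises (x i) (y i)) \<Longrightarrow> specialises (mon x m) (mon y m)"
  unfolding mon_def by (intro specialises_prod specialises_power)

definition laurent_coeffs :: "'f::field set \<Rightarrow> 'f poly fract set" where
  "laurent_coeffs R = gen (const_rat ` R \<union> {rat_var, 1 / rat_var})"

lemma is_subring_laurent_coeffs: "is_subring (laurent_coeffs R)"
  unfolding laurent_coeffs_def by (rule is_subring_gen)

lemma is_subring_const_rat: "is_subring R \<Longrightarrow> is_subring (const_rat ` R)"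
  unfolding is_subring_def by (auto simp flip: const_rat_add const_rat_diff const_rat_mult) (metis const_rat_1 image_eqI)

lemma unit_in_laurent_coeffs:
  assumes R: "is_subring R" and c: "unit_in R c"
  shows "unit_in (laurent_coeffs R) (const_rat c * rat_var powi n)"
proof (rule unit_in_mult[OF is_subring_laurent_coeffs])
  have "const_rat c \<in> laurent_coeffs R" "const_rat (inverse c) \<in> laurent_coeffs R" using c unfolding laurent_coeffs_def unit_in_def by (auto intro: gen_base)
  then show "unit_in (laurent_coeffs R) (const_rat c)" using c unfolding unit_in_def by (simp add: const_rat_inverse const_rat_eq_0)
  have t: "unit_in (laurent_coeffs R) rat_var" "unit_in (laurent_coeffs R) (inverse rat_var)"
    unfolding unit_in_def laurent_coeffs_def using rat_var_nz by (auto intro: gen_base simp: divide_inverse)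
  show "unit_in (laurent_coeffs R) (rat_var powi n)"
    unfolding power_int_def using unit_in_power[OF is_subring_laurent_coeffs t(1)] unit_in_power[OF is_subring_laurent_coeffs t(2)] by simp
qed

text \<open>Valid for all large n, so that a finite family of coefficients can be cleared by one
  power of t.\<close>

lemma laurent_coeffs_clear:
  assumes R: "is_subring R" and c: "c \<in> laurent_coeffs R"
  shows "\<exists>N. \<forall>n\<ge>N. \<exists>C. c * rat_var ^ n = to_fract C \<and> (\<forall>i. coeff C i \<in> R)"
proof -
  have CR: "is_subring (const_rat ` R)" by (rule is_subring_const_rat[OF R])
  have "c \<in> exch_ext (const_rat ` R) 1 rat_var" using c exch_ext_eq_gen[OF CR subring_1[OF CR] rat_var_nz] unfolding laurent_coeffs_def by simp
  then obtain N P where P: "c * rat_var ^ N = poly P rat_var" "\<forall>i. \<exists>e\<in>const_rat ` R. coeff P i = 1 ^ (N - i) * e"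
    unfolding exch_ext_def by blast
  have "\<forall>i. \<exists>r. r \<in> R \<and> coeff P i = const_rat r" using P(2) by auto
  then have "\<exists>r. \<forall>i. r i \<in> R \<and> coeff P i = const_rat (r i)" by (rule choice)
  then obtain r where r: "\<And>i. r i \<in> R" "\<And>i. coeff P i = const_rat (r i)" by blast
  have "\<exists>C. c * rat_var ^ n = to_fract C \<and> (\<forall>i. coeff C i \<in> R)" if "n \<ge> N" for n
  proof (intro exI conjI allI)
    define C where "C = (\<Sum>i\<le>degree P. monom (r i) (i + (n - N)))"
    have to_fract_sum: "to_fract (sum f I) = (\<Sum>i\<in>I. to_fract (f i))" for f :: "nat \<Rightarrow> 'a poly" and I
      by (induction I rule: infinite_finite_induct) auto
    have mono: "to_fract (monom a k) = const_rat a * rat_var ^ k" for a :: 'a and k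
      unfolding rat_var_power const_rat_def by (simp add: smult_monom flip: to_fract_mult)
    have "c * rat_var ^ n = (c * rat_var ^ N) * rat_var ^ (n - N)" using that by (simp add: mult.assoc flip: power_add)
    also have "\<dots> = to_fract C"
      unfolding P(1) C_def to_fract_sum mono poly_altdef r(2) by (simp add: sum_distrib_right power_add mult.assoc)
    finally show "c * rat_var ^ n = to_fract C" .
    show "coeff C i \<in> R" for i
      unfolding C_def coeff_sum using r(1) subring_0[OF R] by (intro subring_sum[OF R]) auto
  qed
  then show ?thesis by blast
qed

text \<open>Once negative powers of t are cleared, the relation holds for each coefficient in t
  separately, and there it is a relation over R.\<close>

lemma indep_laurent_coeffs:
  fixes x :: "'n::finite \<Rightarrow> 'f::field"
  assumes R: "is_subring R" and ind: "indep R x"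
  shows "indep (laurent_coeffs R) (\<lambda>i. const_rat (x i))"
  unfolding indep_def
proof (intro allI impI; elim conjE)
  fix S :: "('n \<Rightarrow> nat) set" and c
  assume S: "finite S" "\<forall>m\<in>S. c m \<in> laurent_coeffs R" "(\<Sum>m\<in>S. c m * mon (\<lambda>i. const_rat (x i)) m) = 0"
  have "\<forall>m\<in>S. \<exists>N. \<forall>n\<ge>N. \<exists>C. c m * rat_var ^ n = to_fract C \<and> (\<forall>i. coeff C i \<in> R)"
    using laurent_coeffs_clear[OF R] S(2) by blast
  then obtain N where N: "\<And>m n. m \<in> S \<Longrightarrow> n \<ge> N m \<Longrightarrow> \<exists>C. c m * rat_var ^ n = to_fract C \<and> (\<forall>i. coeff C i \<in> R)"
    by (metis bchoice)
  define n where "n = (\<Sum>m\<in>S. N m)"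
  have "n \<ge> N m" if "m \<in> S" for m unfolding n_def using S(1) that by (simp add: member_le_sum)
  then have "\<forall>m\<in>S. \<exists>C. c m * rat_var ^ n = to_fract C \<and> (\<forall>i. coeff C i \<in> R)" using N by blast
  then have "\<exists>C. \<forall>m\<in>S. c m * rat_var ^ n = to_fract (C m) \<and> (\<forall>i. coeff (C m) i \<in> R)" by (rule bchoice)
  then obtain C where C: "\<And>m. m \<in> S \<Longrightarrow> c m * rat_var ^ n = to_fract (C m)" "\<And>m i. m \<in> S \<Longrightarrow> coeff (C m) i \<in> R"
    by blast
  have to_fract_sum: "to_fract (sum f I) = (\<Sum>i\<in>I. to_fract (f i))" for f :: "('n \<Rightarrow> nat) \<Rightarrow> 'f poly" and I
    by (induction I rule: infinite_finite_induct) auto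
  have "to_fract (\<Sum>m\<in>S. C m * [:mon x m:]) = (\<Sum>m\<in>S. (c m * rat_var ^ n) * const_rat (mon x m))"
    unfolding to_fract_sum to_fract_mult const_rat_def[symmetric] using C(1) by (intro sum.cong) auto
  also have "\<dots> = rat_var ^ n * (\<Sum>m\<in>S. c m * mon (\<lambda>i. const_rat (x i)) m)"
    unfolding const_rat_mon by (simp add: sum_distrib_left mult_ac)
  also have "\<dots> = 0" by (simp only: S(3) mult_zero_right)
  finally have 0: "(\<Sum>m\<in>S. C m * [:mon x m:]) = 0" by (rule iffD1[OF to_fract_eq_0_iff])
  show "\<forall>m\<in>S. c m = 0"
  proof
    fix m assume m: "m \<in> S"
    have "coeff (C m) i = 0" for i
    proof (rule indepD[OF ind S(1) _ _ m, of "\<lambda>m. coeff (C m) i"])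
      show "(\<Sum>m\<in>S. coeff (C m) i * mon x m) = 0"
        using arg_cong[OF 0, of "\<lambda>P. coeff P i"] by (simp add: coeff_sum mult.commute)
    qed (use C(2) in auto)
    then have "C m = 0" by (simp add: poly_eq_iff)
    then show "c m = 0" using C(1)[OF m] by (simp add: rat_var_nz)
  qed
qed

section \<open>Invariance of the exponents of t\<close>

lemma matrix_mutation_transpose:
  fixes B :: "int ^ 'n::finite ^ 'n"
  shows "matrix_mutation k (\<chi> i j. B $ j $ i) = (\<chi> i j. matrix_mutation k B $ j $ i)"
  by (auto simp: matrix_mutation_def vec_eq_iff algebra_simps)

text \<open>The right kernel of B is the left kernel of its transpose, so \<delta> mutates as a
  degree does. The pairing changes by \<pi>_k times one flow of \<delta>, minus \<rho>_k times the
  other, minus \<tau>_k s; both flows are s, so the change is 0.\<close>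

lemma right_kernel_mutate:
  fixes B :: "int ^ 'n::finite ^ 'n" and \<pi> \<rho> \<tau> \<tau>' :: "'n \<Rightarrow> int" and \<delta> :: "'n \<Rightarrow> real"
  assumes kk: "B $ k $ k = 0" and ker: "\<And>i. (\<Sum>j\<in>UNIV. of_int (B $ i $ j) * \<delta> j) = 0"
    and tk: "\<tau> k = \<pi> k - \<rho> k" "\<tau>' k = - \<tau> k"
    and ti: "\<And>i. i \<noteq> k \<Longrightarrow> \<tau>' i = \<tau> i + B $ k $ i * (if B $ k $ i \<ge> 0 then \<pi> k else \<rho> k)"
  shows "\<exists>\<delta>'. (\<forall>i. (\<Sum>j\<in>UNIV. of_int (matrix_mutation k B $ i $ j) * \<delta>' j) = 0) \<and>
    (\<Sum>i\<in>UNIV. of_int (\<tau>' i) * \<delta>' i) = (\<Sum>i\<in>UNIV. of_int (\<tau> i) * \<delta> i)"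
proof -
  define Bt :: "int ^ 'n ^ 'n" where "Bt = (\<chi> i j. B $ j $ i)"
  define \<delta>' where "\<delta>' = mutate_weight Bt k \<delta>"
  define s where "s = inflow Bt k \<delta>"
  have kerT: "(\<Sum>i\<in>UNIV. of_int (Bt $ i $ j) * \<delta> i) = 0" for j using ker by (simp add: Bt_def)
  have s: "outflow Bt k \<delta> = s" using inflow_minus_outflow[of Bt k \<delta>] kerT unfolding s_def by simp
  have \<delta>'k: "\<delta>' k = s - \<delta> k" unfolding \<delta>'_def mutate_weight_def s s_def[symmetric] by simp
  have \<delta>'i: "\<delta>' i = \<delta> i" if "i \<noteq> k" for i using that by (simp add: \<delta>'_def mutate_weight_def)
  have "(\<Sum>i\<in>UNIV. of_int (matrix_mutation k Bt $ i $ j) * \<delta>' i) = 0" for j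
    unfolding \<delta>'_def by (rule kernel_mutate) (use kk kerT in \<open>auto simp: Bt_def\<close>)
  then have 1: "(\<Sum>j\<in>UNIV. of_int (matrix_mutation k B $ i $ j) * \<delta>' j) = 0" for i
    unfolding Bt_def matrix_mutation_transpose by simp
  have "of_int (\<tau>' i) * \<delta>' i = of_int (\<tau> i) * \<delta> i + of_int (\<pi> k) * (of_int (max (Bt $ i $ k) 0) * \<delta> i)
      - of_int (\<rho> k) * (of_int (max (- Bt $ i $ k) 0) * \<delta> i) - (if i = k then of_int (\<tau> k) * s else 0)" for i
  proof (cases "i = k")
    case True
    then show ?thesis using kk tk(2) by (simp add: \<delta>'k Bt_def algebra_simps)
  next
    case False
    then show ?thesis
      by (cases "B $ k $ i \<ge> 0") (simp_all add: \<delta>'i ti Bt_def max_def algebra_simps)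
  qed
  then have "(\<Sum>i\<in>UNIV. of_int (\<tau>' i) * \<delta>' i) = (\<Sum>i\<in>UNIV. of_int (\<tau> i) * \<delta> i) +
      of_int (\<pi> k) * inflow Bt k \<delta> - of_int (\<rho> k) * outflow Bt k \<delta> - of_int (\<tau> k) * s"
    unfolding inflow_def outflow_def by (simp add: sum.distrib sum_subtractf sum_distrib_left)
  also have "\<dots> = (\<Sum>i\<in>UNIV. of_int (\<tau> i) * \<delta> i)"
    unfolding s s_def[symmetric] tk(1) by (simp add: algebra_simps)
  finally show ?thesis using 1 by blast
qed

lemma right_kernel_exists:
  fixes B :: "int ^ 'n::finite ^ 'n"
  assumes sk: "skew_symmetrizable B" and d: "distinct3 i j k" and nz: "B $ i $ j \<noteq> 0"
  shows "\<exists>\<delta>. \<delta> k \<noteq> 0 \<and> (\<forall>i. (\<Sum>j\<in>UNIV. of_int (B $ i $ j) * \<delta> j) = (0::real))"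
proof -
  from sk obtain D :: "'n \<Rightarrow> real" where D: "(\<forall>i. D i > 0) \<and> (\<forall>i j.
    D i * of_int (B $ i $ j) = - (D j * of_int (B $ j $ i)))"
    unfolding skew_symmetrizable_def by (elim exE)
  define a where "a i j = D i * of_int (B $ i $ j)" for i j
  have anti: "a i j = - a j i" for i j using D unfolding a_def by blast
  have a0: "a i i = 0" for i using anti[of i i] by simp
  have U: "UNIV = {i, j, k}" and ne: "i \<noteq> j" "i \<noteq> k" "j \<noteq> k" using d unfolding distinct3_def by auto
  \<comment> \<open>The kernel vector of a skew-symmetric matrix of size three; its entry at k is
    a_ij, nonzero by \<open>nz\<close>.\<close>
  define \<delta> where "\<delta> l = (if l = i then a j k else if l = j then a k i else a i j)" for l
  have \<delta>: "\<delta> i = a j k" "\<delta> j = a k i" "\<delta> k = a i j" using ne by (simp_all add: \<delta>_def)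
  have "D l * (\<Sum>m\<in>UNIV. of_int (B $ l $ m) * \<delta> m) = (\<Sum>m\<in>UNIV. a l m * \<delta> m)" for l
    unfolding a_def by (simp add: sum_distrib_left mult.assoc)
  moreover have "(\<Sum>m\<in>UNIV. a l m * \<delta> m) = 0" for l
  proof -
    have "l = i \<or> l = j \<or> l = k" using U by blast
    then show ?thesis unfolding sum_UNIV3[OF U ne] \<delta>
      using anti[of j i] anti[of k i] anti[of k j] a0 by (auto simp: algebra_simps)
  qed
  ultimately have "D l * (\<Sum>m\<in>UNIV. of_int (B $ l $ m) * \<delta> m) = 0" for l by (simp only:)
  moreover have Dnz: "D l \<noteq> 0" for l using D by (metis less_irrefl)
  ultimately have "(\<Sum>m\<in>UNIV. of_int (B $ l $ m) * \<delta> m) = 0" for l by (metis mult_eq_0_iff)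
  moreover have "\<delta> k \<noteq> 0" unfolding \<delta> a_def using Dnz nz by simp
  ultimately show ?thesis by blast
qed

context group_ring_embedded
begin

lemma unit_in_group_elt: "unit_in (range \<iota>) (group_elt \<iota> g)"
  unfolding unit_in_def using group_elt_in group_elt_nonzero by (simp flip: group_elt_uminus)

lemma group_elt_int_multiple: "group_elt \<iota> (int_multiple k g) = group_elt \<iota> g powi k"
proof (induction k rule: int_induct[where k = 0])
  case base
  show ?case by (simp add: group_elt_0)
next
  case (step1 i)
  then show ?case
    using group_elt_nonzero[of g] by (simp add: int_multiple_Suc group_elt_add power_int_add)
next
  case (step2 i)
  have "group_elt \<iota> g * group_elt \<iota> (int_multiple (i - 1) g) = group_elt \<iota> g powi i"
    using step2 int_multiple_Suc[of "i - 1" g] by (simp flip: group_elt_add)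
  then show ?case using group_elt_nonzero[of g] by (simp add: power_int_diff field_simps)
qed

section \<open>Lifts of seeds\<close>

definition seed_dual :: "('n::finite, 'p, 'f) seed \<Rightarrow> 'n \<Rightarrow> 'f" where
  "seed_dual S i = exchange_rhs \<iota> S i / cluster S i"

definition lower_bound :: "('n::finite, 'p, 'f) seed \<Rightarrow> 'f set" where
  "lower_bound S = gen (range \<iota> \<union> range (cluster S) \<union> range (seed_dual S))"

definition lift_coeff :: "('n \<Rightarrow> 'p) \<Rightarrow> ('n \<Rightarrow> int) \<Rightarrow> 'n \<Rightarrow> 'f poly fract" where
  "lift_coeff c \<pi> i = const_rat (group_elt \<iota> (c i)) * rat_var powi (\<pi> i)"

abbreviation "lifted_coeffs \<equiv> laurent_coeffs (range \<iota>)"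

lemma unit_in_lift_coeff: "unit_in lifted_coeffs (lift_coeff c \<pi> i)"
  unfolding lift_coeff_def by (rule unit_in_laurent_coeffs[OF is_subring_iota unit_in_group_elt])

lemma specialises_lift_coeff: "specialises (lift_coeff c \<pi> i) (group_elt \<iota> (c i))"
  unfolding lift_coeff_def by (rule specialises_const_rat_rat_var)

lemma specialises_exch:
  assumes "\<And>i. specialises (x i) (cluster S i)"
  shows "specialises (exch_poly x (lift_coeff (coeff_pos S) \<pi>) (lift_coeff (coeff_neg S) \<rho>) (exchange_matrix S) j) (exchange_rhs \<iota> S j)"
  unfolding exch_poly_def exchange_rhs_UNIV
  by (intro specialises_add specialises_mult specialises_lift_coeff specialises_mon assms)

text \<open>
  The coefficients are perturbed by the powers $t^{\pi_i}$ and $t^{\rho_i}$ of the new variable. The pairing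
  of $\pi - \rho$ with the right kernel vector $\delta$ is invariant under mutation, and as long as it is nonzero,
  the exchange polynomials of unlinked vertices have a nonzero resultant.
\<close>

definition seed_lift :: "('n::finite, 'p, 'f) seed \<Rightarrow> ('n \<Rightarrow> 'f poly fract) \<Rightarrow> ('n \<Rightarrow> int) \<Rightarrow> ('n \<Rightarrow> int) \<Rightarrow> bool" where
  "seed_lift S x \<pi> \<rho> \<longleftrightarrow> (\<forall>i. specialises (x i) (cluster S i)) \<and> indep lifted_coeffs x \<and>
     (\<exists>\<delta>::'n \<Rightarrow> real. (\<forall>i. (\<Sum>j\<in>UNIV. of_int (exchange_matrix S $ i $ j) * \<delta> j) = 0) \<and>
       (\<Sum>i\<in>UNIV. of_int (\<pi> i - \<rho> i) * \<delta> i) \<noteq> 0) \<and> exchange_matrix S \<noteq> 0"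

lemma seed_lift_exchange_seed:
  assumes S: "is_seed \<iota> S" and l: "seed_lift S x \<pi> \<rho>"
  shows "exchange_seed lifted_coeffs x (lift_coeff (coeff_pos S) \<pi>) (lift_coeff (coeff_neg S) \<rho>) (exchange_matrix S)"
proof
  show "is_subring lifted_coeffs" by (rule is_subring_laurent_coeffs)
  show "indep lifted_coeffs x" using l unfolding seed_lift_def by blast
  show "sign_skew_symmetric (exchange_matrix S)" using S unfolding is_seed_def by blast
  show "unit_in lifted_coeffs (lift_coeff (coeff_pos S) \<pi> i)" "unit_in lifted_coeffs (lift_coeff (coeff_neg S) \<rho> i)" for i
    by (rule unit_in_lift_coeff)+
  show "exch_poly x (lift_coeff (coeff_pos S) \<pi>) (lift_coeff (coeff_neg S) \<rho>) (exchange_matrix S) i \<noteq> 0" for i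
    by (rule specialises_nonzero[OF specialises_exch exchange_rhs_nonzero[OF S]])
      (use l in \<open>auto simp: seed_lift_def\<close>)
qed

text \<open>Both terms of the resultant are constants times powers of t, so they can be told apart
  by their exponents.\<close>

lemma binom_ratio_lift:
  "\<exists>u. u \<noteq> 0 \<and> (- binom_ratio (lift_coeff c \<pi> i) (lift_coeff d \<rho> i) b) ^ n = const_rat u * rat_var powi ((if b > 0 then 1 else -1) * (\<pi> i - \<rho> i) * int n)"
proof -
  define g where "g = group_elt \<iota> (c i) / group_elt \<iota> (d i)"
  have g: "g \<noteq> 0" unfolding g_def using group_elt_nonzero by simp
  define h where "h = (if b > 0 then g else inverse g)"
  have h: "h \<noteq> 0" using g by (simp add: h_def)
  have "binom_ratio (lift_coeff c \<pi> i) (lift_coeff d \<rho> i) b = const_rat h * rat_var powi ((if b > 0 then 1 else -1) * (\<pi> i - \<rho> i))"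
    unfolding binom_ratio_def lift_coeff_def h_def g_def
    by (simp add: const_rat_divide const_rat_inverse power_int_diff rat_var_nz)
  then have "(- binom_ratio (lift_coeff c \<pi> i) (lift_coeff d \<rho> i) b) ^ n =
      (const_rat (- h) * rat_var powi ((if b > 0 then 1 else -1) * (\<pi> i - \<rho> i))) ^ n" by (simp add: const_rat_uminus)
  also have "\<dots> = const_rat ((- h) ^ n) * rat_var powi ((if b > 0 then 1 else -1) * (\<pi> i - \<rho> i) * int n)"
    unfolding power_mult_distrib const_rat_power power_int_mult by simp
  finally show ?thesis using h by (intro exI[of _ "(- h) ^ n"]) simp
qed

text \<open>Let \<tau> = \<pi> - \<rho>. If the resultant vanished, comparing exponents of t would
  make (\<tau>_i, \<tau>_j) proportional to (b_ki, b_kj). Row i of the kernel equation gives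
  \<delta>_k = 0 and row k gives b_ki \<delta>_i + b_kj \<delta>_j = 0, so \<tau> would pair to 0
  with \<delta>.\<close>

lemma seed_lift_coprime:
  fixes S :: "('n::finite, 'p, 'f) seed"
  assumes S: "is_seed \<iota> S" and l: "seed_lift S x \<pi> \<rho>" and d: "distinct3 i j k"
    and ij: "exchange_matrix S $ i $ j = 0"
  shows "exchange_seed.coprime_at (lift_coeff (coeff_pos S) \<pi>) (lift_coeff (coeff_neg S) \<rho>) (exchange_matrix S) i j k"
proof -
  interpret exchange_seed lifted_coeffs x "lift_coeff (coeff_pos S) \<pi>" "lift_coeff (coeff_neg S) \<rho>" "exchange_matrix S"
    by (rule seed_lift_exchange_seed[OF S l])
  let ?B = "exchange_matrix S"
  obtain \<delta> :: "'n \<Rightarrow> real" where ker: "\<And>i. (\<Sum>j\<in>UNIV. of_int (?B $ i $ j) * \<delta> j) = 0"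
    and \<tau>: "(\<Sum>i\<in>UNIV. of_int (\<pi> i - \<rho> i) * \<delta> i) \<noteq> 0" and nz: "?B \<noteq> 0"
    using l unfolding seed_lift_def by blast
  have U: "UNIV = {i, j, k}" and ne: "i \<noteq> j" "i \<noteq> k" "j \<noteq> k" using d unfolding distinct3_def by auto
  have ji: "?B $ j $ i = 0" using ij skD(2) by blast
  have 1: "?B $ k $ i \<noteq> 0 \<or> ?B $ k $ j \<noteq> 0"
  proof (rule ccontr)
    assume "\<not> ?thesis"
    then have "?B $ k $ i = 0" "?B $ k $ j = 0" "?B $ i $ k = 0" "?B $ j $ k = 0" using skD(2) by blast+
    then have "?B $ a $ b = 0" if "a \<in> {i, j, k}" "b \<in> {i, j, k}" for a b using that ij ji sk0 by auto
    then have "?B = 0" unfolding U[symmetric] by (simp add: vec_eq_iff)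
    then show False using nz by blast
  qed
  have 2: "(- binom_ratio (lift_coeff (coeff_pos S) \<pi> i) (lift_coeff (coeff_neg S) \<rho> i) (?B $ k $ i)) ^ nat \<bar>?B $ k $ j\<bar> \<noteq>
     (- binom_ratio (lift_coeff (coeff_pos S) \<pi> j) (lift_coeff (coeff_neg S) \<rho> j) (?B $ k $ j)) ^ nat \<bar>?B $ k $ i\<bar>"
    if ki: "?B $ k $ i \<noteq> 0" and kj: "?B $ k $ j \<noteq> 0"
  proof
    let ?s = "\<lambda>b::int. if b > 0 then 1 else -1 :: int"
    assume eq: "(- binom_ratio (lift_coeff (coeff_pos S) \<pi> i) (lift_coeff (coeff_neg S) \<rho> i) (?B $ k $ i)) ^ nat \<bar>?B $ k $ j\<bar> =
     (- binom_ratio (lift_coeff (coeff_pos S) \<pi> j) (lift_coeff (coeff_neg S) \<rho> j) (?B $ k $ j)) ^ nat \<bar>?B $ k $ i\<bar>"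
    obtain u where u: "u \<noteq> 0" "(- binom_ratio (lift_coeff (coeff_pos S) \<pi> i) (lift_coeff (coeff_neg S) \<rho> i) (?B $ k $ i)) ^ nat \<bar>?B $ k $ j\<bar> =
      const_rat u * rat_var powi (?s (?B $ k $ i) * (\<pi> i - \<rho> i) * int (nat \<bar>?B $ k $ j\<bar>))"
      using binom_ratio_lift[of "coeff_pos S" \<pi> i "coeff_neg S" \<rho> "?B $ k $ i" "nat \<bar>?B $ k $ j\<bar>"] by blast
    obtain v where v: "v \<noteq> 0" "(- binom_ratio (lift_coeff (coeff_pos S) \<pi> j) (lift_coeff (coeff_neg S) \<rho> j) (?B $ k $ j)) ^ nat \<bar>?B $ k $ i\<bar> =
      const_rat v * rat_var powi (?s (?B $ k $ j) * (\<pi> j - \<rho> j) * int (nat \<bar>?B $ k $ i\<bar>))"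
      using binom_ratio_lift[of "coeff_pos S" \<pi> j "coeff_neg S" \<rho> "?B $ k $ j" "nat \<bar>?B $ k $ i\<bar>"] by blast
    have "?s (?B $ k $ i) * (\<pi> i - \<rho> i) * int (nat \<bar>?B $ k $ j\<bar>) = ?s (?B $ k $ j) * (\<pi> j - \<rho> j) * int (nat \<bar>?B $ k $ i\<bar>)"
      using const_rat_rat_var_powi_inj[OF _ u(1) v(1)] eq u(2) v(2) by simp
    then have par: "(\<pi> i - \<rho> i) * ?B $ k $ j = (\<pi> j - \<rho> j) * ?B $ k $ i"
      by (cases "?B $ k $ i > 0"; cases "?B $ k $ j > 0") (simp_all add: algebra_simps)
    have "?B $ i $ k \<noteq> 0" using ki skD(2) by blast
    then have "\<delta> k = 0" using ker[of i] ij sk0 unfolding sum_UNIV3[OF U ne] by simp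
    then have rowk: "of_int (?B $ k $ i) * \<delta> i + of_int (?B $ k $ j) * \<delta> j = 0"
      and t: "of_int (\<pi> i - \<rho> i) * \<delta> i + of_int (\<pi> j - \<rho> j) * \<delta> j \<noteq> 0"
      using ker[of k] \<tau> sk0 unfolding sum_UNIV3[OF U ne] by simp_all
    have "of_int (?B $ k $ i) * (of_int (\<pi> i - \<rho> i) * \<delta> i + of_int (\<pi> j - \<rho> j) * \<delta> j) =
        of_int (\<pi> i - \<rho> i) * (of_int (?B $ k $ i) * \<delta> i) + of_int ((\<pi> j - \<rho> j) * ?B $ k $ i) * \<delta> j"
      by (simp add: algebra_simps)
    also have "\<dots> = of_int (\<pi> i - \<rho> i) * (of_int (?B $ k $ i) * \<delta> i + of_int (?B $ k $ j) * \<delta> j)"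
      unfolding par[symmetric] by (simp add: algebra_simps)
    finally show False using rowk t ki by simp
  qed
  show ?thesis unfolding coprime_at_def using 1 2 by blast
qed

lemma seed_lift_mutate:
  fixes S S' :: "('n::finite, 'p, 'f) seed"
  assumes mut: "seed_mutation \<iota> k S S'" and l: "seed_lift S x \<pi> \<rho>"
  shows "\<exists>x' \<pi>' \<rho>'. seed_lift S' x' \<pi>' \<rho>' \<and>
    upper_alg lifted_coeffs x' (lift_coeff (coeff_pos S') \<pi>') (lift_coeff (coeff_neg S') \<rho>') (exchange_matrix S') \<subseteq>
    upper_alg lifted_coeffs x (lift_coeff (coeff_pos S) \<pi>) (lift_coeff (coeff_neg S) \<rho>) (exchange_matrix S)"
proof -
  let ?B = "exchange_matrix S"
  have S: "is_seed \<iota> S" and S': "is_seed \<iota> S'" and B': "exchange_matrix S' = matrix_mutation k ?B"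
    and clk: "cluster S k * cluster S' k = exchange_rhs \<iota> S k" and cli: "\<And>i. i \<noteq> k \<Longrightarrow> cluster S' i = cluster S i"
    and ck: "coeff_pos S' k = coeff_neg S k" "coeff_neg S' k = coeff_pos S k"
    and ci: "\<And>i. i \<noteq> k \<Longrightarrow> (let b = ?B $ k $ i in
           (b \<ge> 0 \<longrightarrow> coeff_pos S' i - coeff_neg S' i =
              int_multiple b (coeff_pos S k) + (coeff_pos S i - coeff_neg S i)) \<and>
           (b \<le> 0 \<longrightarrow> coeff_pos S' i - coeff_neg S' i =
              int_multiple b (coeff_neg S k) + (coeff_pos S i - coeff_neg S i)))"
    using mut unfolding seed_mutation_def by blast+
  interpret exchange_seed lifted_coeffs x "lift_coeff (coeff_pos S) \<pi>" "lift_coeff (coeff_neg S) \<rho>" ?B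
    by (rule seed_lift_exchange_seed[OF S l])
  define x' where "x' = x(k := y k)"
  \<comment> \<open>The exponents of t follow the rule for the coefficients of which they are a
    part. Only differences are prescribed away from k, so \<rho>' is 0 there.\<close>
  define \<pi>' where "\<pi>' i = (if i = k then \<rho> k else \<pi> i - \<rho> i + ?B $ k $ i * (if ?B $ k $ i \<ge> 0 then \<pi> k else \<rho> k))" for i
  define \<rho>' where "\<rho>' i = (if i = k then \<pi> k else 0)" for i
  have spx: "\<And>i. specialises (x i) (cluster S i)" and nz: "?B \<noteq> 0"
    using l unfolding seed_lift_def by auto
  have xk: "x k * x' k = M k" unfolding x'_def exch_dual_def using x_nz[of k] by simp
  have "specialises (M k) (exchange_rhs \<iota> S k)" by (rule specialises_exch[OF spx])
  then have "specialises (y k) (exchange_rhs \<iota> S k / cluster S k)"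
    unfolding exch_dual_def using spx cluster_nonzero[OF S] by (intro specialises_divide)
  moreover have "exchange_rhs \<iota> S k / cluster S k = cluster S' k"
    using clk cluster_nonzero[OF S, of k] by (simp add: field_simps)
  ultimately have sp': "specialises (x' i) (cluster S' i)" for i
    using spx cli by (cases "i = k") (auto simp: x'_def)
  have "M k \<in> fracs_without lifted_coeffs x k"
  proof -
    have "mon x m \<in> fracs_without lifted_coeffs x k" if "m k = 0" for m
      unfolding mon_def using that fracs_without_x(1)
      by (intro subring_prod[OF fracs_without(1)]) (metis fracs_without(1) power_0 subring_1 subring_power)
    then show ?thesis unfolding exch_poly_def using sk0
      by (intro subring_add[OF fracs_without(1)] subring_mult[OF fracs_without(1)] subsetD[OF fracs_without(3) pR] subsetD[OF fracs_without(3) qR]) auto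
  qed
  then have ind': "indep lifted_coeffs x'"
    using indep_mutate[OF R ind, of "M k" k x'] exch_nz xk by (simp add: x'_def)
  obtain \<delta> :: "'n \<Rightarrow> real" where ker: "\<And>i. (\<Sum>j\<in>UNIV. of_int (?B $ i $ j) * \<delta> j) = 0"
    and \<tau>: "(\<Sum>i\<in>UNIV. of_int (\<pi> i - \<rho> i) * \<delta> i) \<noteq> 0"
    using l unfolding seed_lift_def by blast
  have "\<exists>\<delta>'. (\<forall>i. (\<Sum>j\<in>UNIV. of_int (matrix_mutation k ?B $ i $ j) * \<delta>' j) = 0) \<and>
    (\<Sum>i\<in>UNIV. of_int (\<pi>' i - \<rho>' i) * \<delta>' i) = (\<Sum>i\<in>UNIV. of_int (\<pi> i - \<rho> i) * \<delta> i)"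
    by (rule right_kernel_mutate[OF sk0 ker, of "\<lambda>i. \<pi> i - \<rho> i" k \<pi> \<rho> "\<lambda>i. \<pi>' i - \<rho>' i"])
      (auto simp: \<pi>'_def \<rho>'_def)
  then have \<delta>': "\<exists>\<delta>'::'n \<Rightarrow> real. (\<forall>i. (\<Sum>j\<in>UNIV. of_int (matrix_mutation k ?B $ i $ j) * \<delta>' j) = 0) \<and>
    (\<Sum>i\<in>UNIV. of_int (\<pi>' i - \<rho>' i) * \<delta>' i) \<noteq> 0" using \<tau> by metis
  have "matrix_mutation k ?B \<noteq> 0"
  proof
    assume 0: "matrix_mutation k ?B = 0"
    have "?B = matrix_mutation k (matrix_mutation k ?B)" by (simp add: matrix_mutation_involution)
    also have "\<dots> = 0" unfolding 0 by (simp add: matrix_mutation_def vec_eq_iff)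
    finally show False using nz by blast
  qed
  then have lift': "seed_lift S' x' \<pi>' \<rho>'"
    unfolding seed_lift_def B' using sp' ind' \<delta>' by blast
  have "mutated k x (lift_coeff (coeff_pos S) \<pi>) (lift_coeff (coeff_neg S) \<rho>) ?B x'
      (lift_coeff (coeff_pos S') \<pi>') (lift_coeff (coeff_neg S') \<rho>')"
    unfolding mutated_def
  proof (intro conjI allI impI)
    show "x k * x' k = M k" by (rule xk)
    show "x' i = x i" if "i \<noteq> k" for i using that by (simp add: x'_def)
    show "lift_coeff (coeff_pos S') \<pi>' k = lift_coeff (coeff_neg S) \<rho> k"
      "lift_coeff (coeff_neg S') \<rho>' k = lift_coeff (coeff_pos S) \<pi> k"
      by (simp_all add: lift_coeff_def ck \<pi>'_def \<rho>'_def)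
    fix i assume i: "i \<noteq> k"
    define b where "b = ?B $ k $ i"
    define g where "g = (if b \<ge> 0 then coeff_pos S k else coeff_neg S k)"
    define n where "n = (if b \<ge> 0 then \<pi> k else \<rho> k)"
    have "coeff_pos S' i - coeff_neg S' i = int_multiple b g + (coeff_pos S i - coeff_neg S i)"
      using ci[OF i] unfolding Let_def b_def g_def by (cases "?B $ k $ i \<ge> 0") auto
    then have "coeff_pos S' i + coeff_neg S i = int_multiple b g + coeff_pos S i + coeff_neg S' i"
      by (simp add: algebra_simps)
    then have "group_elt \<iota> (coeff_pos S' i + coeff_neg S i) = group_elt \<iota> (int_multiple b g + coeff_pos S i + coeff_neg S' i)"
      by simp
    then have ge: "group_elt \<iota> (coeff_pos S' i) * group_elt \<iota> (coeff_neg S i) =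
        group_elt \<iota> g powi b * group_elt \<iota> (coeff_pos S i) * group_elt \<iota> (coeff_neg S' i)"
      by (simp add: group_elt_add group_elt_int_multiple)
    have ex: "\<pi>' i + \<rho> i = n * b + \<pi> i + \<rho>' i" unfolding \<pi>'_def \<rho>'_def n_def b_def using i by simp
    have gn: "(if b \<ge> 0 then lift_coeff (coeff_pos S) \<pi> k else lift_coeff (coeff_neg S) \<rho> k) = const_rat (group_elt \<iota> g) * rat_var powi n"
      unfolding g_def n_def lift_coeff_def by simp
    have "lift_coeff (coeff_pos S') \<pi>' i * lift_coeff (coeff_neg S) \<rho> i =
        const_rat (group_elt \<iota> (coeff_pos S' i) * group_elt \<iota> (coeff_neg S i)) * rat_var powi (\<pi>' i + \<rho> i)"
      by (simp add: lift_coeff_def const_rat_mult power_int_add rat_var_nz mult_ac)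
    also have "\<dots> = (const_rat (group_elt \<iota> g) * rat_var powi n) powi b * lift_coeff (coeff_pos S) \<pi> i * lift_coeff (coeff_neg S') \<rho>' i"
    proof -
      have "rat_var powi (n * b + \<pi> i + \<rho>' i) = (rat_var powi n) powi b * rat_var powi (\<pi> i) * (rat_var :: 'f poly fract) powi (\<rho>' i)"
        by (simp only: power_int_add[OF disjI1[OF rat_var_nz]] power_int_mult)
      then show ?thesis
        unfolding ge ex by (simp add: lift_coeff_def const_rat_mult const_rat_powi power_int_mult_distrib mult_ac)
    qed
    finally show "lift_coeff (coeff_pos S') \<pi>' i * lift_coeff (coeff_neg S) \<rho> i =
        (if ?B $ k $ i \<ge> 0 then lift_coeff (coeff_pos S) \<pi> k else lift_coeff (coeff_neg S) \<rho> k) powi (?B $ k $ i) *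
        lift_coeff (coeff_pos S) \<pi> i * lift_coeff (coeff_neg S') \<rho>' i"
      unfolding gn[symmetric] b_def .
  qed
  then have "upper_alg lifted_coeffs x' (lift_coeff (coeff_pos S') \<pi>') (lift_coeff (coeff_neg S') \<rho>') (exchange_matrix S') \<subseteq>
    upper_alg lifted_coeffs x (lift_coeff (coeff_pos S) \<pi>) (lift_coeff (coeff_neg S) \<rho>) ?B"
    unfolding B' by (rule upper_alg_mutated_subset[OF _ unit_in_lift_coeff unit_in_lift_coeff seed_lift_coprime[OF S l]])
  then show ?thesis using lift' by blast
qed

lemma seed_lift_relabel:
  fixes S S' :: "('n::finite, 'p, 'f) seed"
  assumes rel: "seed_relabeling S S'" and l: "seed_lift S x \<pi> \<rho>"
  shows "\<exists>x' \<pi>' \<rho>'. seed_lift S' x' \<pi>' \<rho>' \<and>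
    upper_alg lifted_coeffs x' (lift_coeff (coeff_pos S') \<pi>') (lift_coeff (coeff_neg S') \<rho>') (exchange_matrix S') \<subseteq>
    upper_alg lifted_coeffs x (lift_coeff (coeff_pos S) \<pi>) (lift_coeff (coeff_neg S) \<rho>) (exchange_matrix S)"
proof -
  let ?B = "exchange_matrix S" and ?B' = "exchange_matrix S'"
  obtain \<sigma> where \<sigma>: "bij \<sigma>" "\<And>i. cluster S' i = cluster S (\<sigma> i)" "\<And>i. coeff_pos S' i = coeff_pos S (\<sigma> i)"
    "\<And>i. coeff_neg S' i = coeff_neg S (\<sigma> i)" "\<And>i j. ?B' $ i $ j = ?B $ \<sigma> i $ \<sigma> j"
    using rel unfolding seed_relabeling_def by blast
  have reindex: "(\<Sum>i\<in>UNIV. f (\<sigma> i)) = (\<Sum>i\<in>UNIV. f i)" for f :: "'n \<Rightarrow> real"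
    by (rule sum.reindex_bij_betw[OF \<sigma>(1)])
  define x' \<pi>' \<rho>' where "x' i = x (\<sigma> i)" and "\<pi>' i = \<pi> (\<sigma> i)" and "\<rho>' i = \<rho> (\<sigma> i)" for i
  obtain \<delta> :: "'n \<Rightarrow> real" where ker: "\<And>i. (\<Sum>j\<in>UNIV. of_int (?B $ i $ j) * \<delta> j) = 0"
    and \<tau>: "(\<Sum>i\<in>UNIV. of_int (\<pi> i - \<rho> i) * \<delta> i) \<noteq> 0"
    using l unfolding seed_lift_def by blast
  have "(\<Sum>j\<in>UNIV. of_int (?B' $ i $ j) * \<delta> (\<sigma> j)) = 0" for i
    unfolding \<sigma>(5) reindex[of "\<lambda>j. of_int (?B $ \<sigma> i $ j) * \<delta> j"] by (rule ker)
  moreover have "(\<Sum>i\<in>UNIV. of_int (\<pi>' i - \<rho>' i) * \<delta> (\<sigma> i)) \<noteq> 0"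
    unfolding \<pi>'_def \<rho>'_def reindex[of "\<lambda>i. of_int (\<pi> i - \<rho> i) * \<delta> i"] by (rule \<tau>)
  ultimately have \<delta>': "\<exists>\<delta>'::'n \<Rightarrow> real. (\<forall>i. (\<Sum>j\<in>UNIV. of_int (?B' $ i $ j) * \<delta>' j) = 0) \<and>
      (\<Sum>i\<in>UNIV. of_int (\<pi>' i - \<rho>' i) * \<delta>' i) \<noteq> 0" by (intro exI[of _ "\<lambda>i. \<delta> (\<sigma> i)"]) auto
  have "?B' \<noteq> 0"
  proof
    assume "?B' = 0"
    then have "?B $ \<sigma> i $ \<sigma> j = 0" for i j unfolding \<sigma>(5)[symmetric] by simp
    then have "?B $ i $ j = 0" for i j using \<sigma>(1) by (metis bij_pointE)
    then show False using l unfolding seed_lift_def by (simp add: vec_eq_iff)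
  qed
  moreover have "indep lifted_coeffs x'"
  proof -
    have "indep lifted_coeffs x" using l unfolding seed_lift_def by blast
    then show ?thesis unfolding x'_def[abs_def] by (rule indep_reindex[OF _ \<sigma>(1)])
  qed
  ultimately have lift': "seed_lift S' x' \<pi>' \<rho>'"
    using l \<delta>' unfolding seed_lift_def by (auto simp: x'_def \<sigma>(2))
  have mon': "mon x' (\<lambda>i. m (\<sigma> i)) = mon x m" for m
    unfolding mon_def x'_def by (rule prod.reindex_bij_betw[OF \<sigma>(1)])
  have lc: "lift_coeff (coeff_pos S') \<pi>' i = lift_coeff (coeff_pos S) \<pi> (\<sigma> i)"
    "lift_coeff (coeff_neg S') \<rho>' i = lift_coeff (coeff_neg S) \<rho> (\<sigma> i)" for i
    by (simp_all add: lift_coeff_def \<pi>'_def \<rho>'_def \<sigma>)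
  have "exch_poly x' (lift_coeff (coeff_pos S') \<pi>') (lift_coeff (coeff_neg S') \<rho>') ?B' j =
      exch_poly x (lift_coeff (coeff_pos S) \<pi>) (lift_coeff (coeff_neg S) \<rho>) ?B (\<sigma> j)" for j
    unfolding exch_poly_def lc \<sigma>(5) mon'[of "\<lambda>i. nat (?B $ i $ \<sigma> j)"] mon'[of "\<lambda>i. nat (- ?B $ i $ \<sigma> j)"] ..
  then have exch_dual: "exch_dual x' (lift_coeff (coeff_pos S') \<pi>') (lift_coeff (coeff_neg S') \<rho>') ?B' j =
      exch_dual x (lift_coeff (coeff_pos S) \<pi>) (lift_coeff (coeff_neg S) \<rho>) ?B (\<sigma> j)" for j
    by (simp add: exch_dual_def x'_def)
  have "upper_alg lifted_coeffs x' (lift_coeff (coeff_pos S') \<pi>') (lift_coeff (coeff_neg S') \<rho>') ?B' \<subseteq>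
    upper_alg lifted_coeffs x (lift_coeff (coeff_pos S) \<pi>) (lift_coeff (coeff_neg S) \<rho>) ?B"
  proof
    fix z assume z: "z \<in> upper_alg lifted_coeffs x' (lift_coeff (coeff_pos S') \<pi>') (lift_coeff (coeff_neg S') \<rho>') ?B'"
    show "z \<in> upper_alg lifted_coeffs x (lift_coeff (coeff_pos S) \<pi>) (lift_coeff (coeff_neg S) \<rho>) ?B"
      unfolding upper_alg_def
    proof (intro CollectI allI impI)
      fix i j k :: 'n assume d: "distinct3 i j k"
      define s where "s = inv \<sigma>"
      have s: "\<sigma> (s i) = i" for i unfolding s_def using \<sigma>(1) by (simp add: bij_is_surj surj_f_inv_f)
      have bs: "bij s" unfolding s_def by (rule bij_imp_bij_inv[OF \<sigma>(1)])
      have "UNIV = s ` {i, j, k}" using bij_is_surj[OF bs] d unfolding distinct3_def by metis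
      then have "distinct3 (s i) (s j) (s k)"
        using d bij_is_inj[OF bs] unfolding distinct3_def by (auto dest: injD)
      then have "z \<in> pair_alg lifted_coeffs x' (lift_coeff (coeff_pos S') \<pi>') (lift_coeff (coeff_neg S') \<rho>') ?B' (s i) (s j) (s k)"
        using z unfolding upper_alg_def by blast
      then show "z \<in> pair_alg lifted_coeffs x (lift_coeff (coeff_pos S) \<pi>) (lift_coeff (coeff_neg S) \<rho>) ?B i j k"
        unfolding pair_alg_def exch_dual x'_def s .
    qed
  qed
  then show ?thesis using lift' by blast
qed

lemma seed_lift_exists:
  fixes S :: "('n::finite, 'p, 'f) seed"
  assumes card: "CARD('n) = 3" and S: "is_seed \<iota> S" and sk: "skew_symmetrizable (exchange_matrix S)"
    and nz: "exchange_matrix S $ i $ j \<noteq> 0"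
  shows "\<exists>\<pi>. seed_lift S (\<lambda>i. const_rat (cluster S i)) \<pi> (\<lambda>_. 0)"
proof -
  have ne: "i \<noteq> j" using nz skew_symmetrizable_imp_sign_skew_symmetric[OF sk] sign_skew_symmetricD(1) by metis
  have "card {i, j} < CARD('n)" using card ne by simp
  then have "{i, j} \<noteq> UNIV" by auto
  then obtain k where "k \<noteq> i" "k \<noteq> j" by auto
  then have d: "distinct3 i j k" using UNIV_eq3[OF card ne, of k] ne unfolding distinct3_def by auto
  obtain \<delta> :: "'n \<Rightarrow> real" where \<delta>: "\<delta> k \<noteq> 0" "\<forall>i. (\<Sum>j\<in>UNIV. of_int (exchange_matrix S $ i $ j) * \<delta> j) = 0"
    using right_kernel_exists[OF sk d nz] by blast
  \<comment> \<open>Perturbing one coefficient suffices, at a vertex where \<delta> does not vanish: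
    the pairing is then \<delta>_k.\<close>
  define \<pi> where "\<pi> l = (if l = k then 1 else 0 :: int)" for l
  have "(\<Sum>l\<in>UNIV. of_int (\<pi> l - 0) * \<delta> l) = (\<Sum>l\<in>UNIV. if l = k then \<delta> k else 0)"
    by (rule sum.cong) (auto simp: \<pi>_def)
  also have "\<dots> = \<delta> k" by simp
  finally have "(\<Sum>l\<in>UNIV. of_int (\<pi> l - 0) * \<delta> l) \<noteq> 0" using \<delta>(1) by simp
  moreover have "exchange_matrix S \<noteq> 0" using nz by auto
  ultimately have "seed_lift S (\<lambda>i. const_rat (cluster S i)) \<pi> (\<lambda>_. 0)"
    unfolding seed_lift_def
    using specialises_const_rat indep_laurent_coeffs[OF is_subring_iota seed_indep_range[OF S]] \<delta>(2) by blast
  then show ?thesis by blast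
qed

text \<open>A rational function need not have a value at t = 1. The generators have one in the lower
  bound, since the denominators t and x_i specialise to nonzero elements, and the elements with such
  a value form a subring.\<close>

lemma lower_alg_specialises:
  assumes S: "is_seed \<iota> S" and x: "\<And>i. specialises (x i) (cluster S i)"
    and z: "z \<in> lower_alg lifted_coeffs x (lift_coeff (coeff_pos S) \<pi>) (lift_coeff (coeff_neg S) \<rho>) (exchange_matrix S)"
  shows "\<exists>c\<in>lower_bound S. specialises z c"
proof -
  let ?V = "{z. \<exists>c\<in>lower_bound S. specialises z c}"
  have L: "is_subring (lower_bound S)" unfolding lower_bound_def by (rule is_subring_gen)
  have V: "is_subring ?V"
    unfolding is_subring_def
  proof (intro conjI ballI)
    show "1 \<in> ?V" using specialises_1 subring_1[OF L] by blast
    fix a b assume "a \<in> ?V" "b \<in> ?V"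
    then obtain c d where cd: "c \<in> lower_bound S" "specialises a c" "d \<in> lower_bound S" "specialises b d" by blast
    have "c + d \<in> lower_bound S" "c - d \<in> lower_bound S" "c * d \<in> lower_bound S"
      using cd L by (auto intro: subring_add subring_diff subring_mult)
    then show "a + b \<in> ?V" "a - b \<in> ?V" "a * b \<in> ?V"
      using specialises_add[OF cd(2,4)] specialises_diff[OF cd(2,4)] specialises_mult[OF cd(2,4)] by blast+
  qed
  have base: "range \<iota> \<union> range (cluster S) \<union> range (seed_dual S) \<subseteq> lower_bound S"
    unfolding lower_bound_def by (auto intro: gen_base)
  have "specialises (1 / rat_var) (1 / 1)" by (intro specialises_divide specialises_1 specialises_rat_var) simp
  then have "1 / rat_var \<in> ?V" "rat_var \<in> ?V" using specialises_rat_var subring_1[OF L] by auto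
  moreover have "const_rat ` range \<iota> \<subseteq> ?V" using specialises_const_rat base by blast
  ultimately have "lifted_coeffs \<subseteq> ?V" unfolding laurent_coeffs_def by (intro gen_least V) auto
  moreover have "x i \<in> ?V" for i using x base by blast
  moreover have "exch_dual x (lift_coeff (coeff_pos S) \<pi>) (lift_coeff (coeff_neg S) \<rho>) (exchange_matrix S) i \<in> ?V" for i
  proof -
    have "specialises (exch_dual x (lift_coeff (coeff_pos S) \<pi>) (lift_coeff (coeff_neg S) \<rho>) (exchange_matrix S) i) (seed_dual S i)"
      unfolding exch_dual_def seed_dual_def
      by (rule specialises_divide[OF specialises_exch[OF x] x cluster_nonzero[OF S]])
    then show ?thesis using base by blast
  qed
  ultimately have "lower_alg lifted_coeffs x (lift_coeff (coeff_pos S) \<pi>) (lift_coeff (coeff_neg S) \<rho>) (exchange_matrix S) \<subseteq> ?V"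
    unfolding lower_alg_def by (intro gen_least V) auto
  then show ?thesis using z by blast
qed

text \<open>The lift of a cluster variable lies in the upper ring of its own seed, which is carried
  back to S and there sits inside the lower ring. Values at t = 1 are unique, so the cluster
  variable itself is in the lower bound.\<close>

lemma cluster_in_lower_bound:
  fixes S S' :: "('n::finite, 'p, 'f) seed"
  assumes card: "CARD('n) = 3" and S: "is_seed \<iota> S" and sk: "skew_symmetrizable (exchange_matrix S)"
    and acyc: "acyclic_seed S" and nz: "exchange_matrix S \<noteq> 0" and eq: "mutation_equivalent \<iota> S S'"
  shows "cluster S' i \<in> lower_bound S"
proof -
  obtain a b where ab: "exchange_matrix S $ a $ b \<noteq> 0" using nz by (auto simp: vec_eq_iff)
  let ?x = "\<lambda>i. const_rat (cluster S i)"
  obtain \<pi> where l: "seed_lift S ?x \<pi> (\<lambda>_. 0)" using seed_lift_exists[OF card S sk ab] by blast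
  let ?U = "upper_alg lifted_coeffs ?x (lift_coeff (coeff_pos S) \<pi>) (lift_coeff (coeff_neg S) (\<lambda>_. 0)) (exchange_matrix S)"
  let ?L = "lower_alg lifted_coeffs ?x (lift_coeff (coeff_pos S) \<pi>) (lift_coeff (coeff_neg S) (\<lambda>_. 0)) (exchange_matrix S)"
  have UL: "?U \<subseteq> ?L"
    by (rule exchange_seed.upper_alg_subset_lower_alg[OF seed_lift_exchange_seed[OF S l] card _ ab])
      (use acyc in \<open>simp add: acyclic_seed_def\<close>)
  have "\<exists>x' \<pi>' \<rho>'. seed_lift S' x' \<pi>' \<rho>' \<and>
      upper_alg lifted_coeffs x' (lift_coeff (coeff_pos S') \<pi>') (lift_coeff (coeff_neg S') \<rho>') (exchange_matrix S') \<subseteq> ?U"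
    using eq
  proof (induction rule: mutation_equivalent_induct)
    case base
    show ?case using l by blast
  next
    case (mutate S1 S2 k)
    then show ?case using seed_lift_mutate by (meson subset_trans)
  next
    case (relabel S1 S2)
    then show ?case using seed_lift_relabel by (meson subset_trans)
  qed
  then obtain x' \<pi>' \<rho>' where l': "seed_lift S' x' \<pi>' \<rho>'"
    and sub: "upper_alg lifted_coeffs x' (lift_coeff (coeff_pos S') \<pi>') (lift_coeff (coeff_neg S') \<rho>') (exchange_matrix S') \<subseteq> ?U"
    by blast
  have "x' i \<in> pair_alg lifted_coeffs x' (lift_coeff (coeff_pos S') \<pi>') (lift_coeff (coeff_neg S') \<rho>') (exchange_matrix S') j k l"
    if "distinct3 j k l" for j k l
  proof -
    have "i \<in> {j, k, l}" using that unfolding distinct3_def by blast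
    then show ?thesis unfolding pair_alg_def by (auto intro!: gen_base)
  qed
  then have "x' i \<in> upper_alg lifted_coeffs x' (lift_coeff (coeff_pos S') \<pi>') (lift_coeff (coeff_neg S') \<rho>') (exchange_matrix S')"
    unfolding upper_alg_def by blast
  then have "x' i \<in> ?L" using sub UL by blast
  then obtain c where "c \<in> lower_bound S" "specialises (x' i) c"
    using lower_alg_specialises[OF S specialises_const_rat] by blast
  moreover have "specialises (x' i) (cluster S' i)" using l' unfolding seed_lift_def by blast
  ultimately show ?thesis using specialises_unique by blast
qed

end

section \<open>Acyclic seeds\<close>

context group_ring_embedded
begin

lemma exchange_rhs_mutated:
  assumes "seed_mutation \<iota> k S S'"
  shows "exchange_rhs \<iota> S' k = exchange_rhs \<iota> S k" "cluster S' k = seed_dual S k" "seed_dual S' k = cluster S k"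
proof -
  have 1: "cluster S k * cluster S' k = exchange_rhs \<iota> S k" "is_seed \<iota> S" "is_seed \<iota> S'"
    using assms unfolding seed_mutation_def by auto
  have "cluster S' k * cluster S k = exchange_rhs \<iota> S' k"
    using seed_mutation_sym[OF assms] unfolding seed_mutation_def by auto
  then show "exchange_rhs \<iota> S' k = exchange_rhs \<iota> S k" using 1(1) by (simp add: mult.commute)
  then show "cluster S' k = seed_dual S k" "seed_dual S' k = cluster S k"
    using 1(1) cluster_nonzero[OF 1(2), of k] cluster_nonzero[OF 1(3), of k]
    by (simp_all add: seed_dual_def field_simps)
qed

text \<open>For B = 0 the exchange polynomials are constants. Mutation at k merely swaps x_k with
  its partner, and the two coefficients at any other vertex change by a common factor from the
  group.\<close>

lemma lower_bound_mutate_disconnected: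
  fixes S S' :: "('n::finite, 'p, 'f) seed"
  assumes mut: "seed_mutation \<iota> k S S'" and B: "exchange_matrix S = 0"
  shows "exchange_matrix S' = 0 \<and> lower_bound S' \<subseteq> lower_bound S"
proof
  show B': "exchange_matrix S' = 0"
    using mut B unfolding seed_mutation_def by (simp add: matrix_mutation_def vec_eq_iff)
  have L: "is_subring (lower_bound S)" unfolding lower_bound_def by (rule is_subring_gen)
  have base: "range \<iota> \<subseteq> lower_bound S" "cluster S i \<in> lower_bound S" "seed_dual S i \<in> lower_bound S" for i
    unfolding lower_bound_def by (auto intro: gen_base)
  have "cluster S' i \<in> lower_bound S \<and> seed_dual S' i \<in> lower_bound S" for i
  proof (cases "i = k")
    case True
    then show ?thesis using exchange_rhs_mutated(2,3)[OF mut] base by simp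
  next
    case False
    have cl: "cluster S' i = cluster S i" using mut False unfolding seed_mutation_def by blast
    have "coeff_pos S' i - coeff_neg S' i = coeff_pos S i - coeff_neg S i"
      using mut False B unfolding seed_mutation_def Let_def by simp
    then have eq: "coeff_pos S' i = (coeff_neg S' i - coeff_neg S i) + coeff_pos S i"
      "coeff_neg S' i = (coeff_neg S' i - coeff_neg S i) + coeff_neg S i"
      by (simp_all add: algebra_simps)
    define g where "g = group_elt \<iota> (coeff_neg S' i - coeff_neg S i)"
    have "group_elt \<iota> (coeff_pos S' i) = g * group_elt \<iota> (coeff_pos S i)"
      "group_elt \<iota> (coeff_neg S' i) = g * group_elt \<iota> (coeff_neg S i)"
      unfolding g_def group_elt_add[symmetric] eq(1,2)[symmetric] by simp_all
    then have "exchange_rhs \<iota> S' i = g * exchange_rhs \<iota> S i"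
      unfolding exchange_rhs_UNIV B B' by (simp add: distrib_left)
    then have "seed_dual S' i = g * seed_dual S i" by (simp add: seed_dual_def cl)
    moreover have "g \<in> lower_bound S" unfolding g_def using group_elt_in base(1) by blast
    ultimately show ?thesis using base L cl by (simp add: subring_mult)
  qed
  then show "lower_bound S' \<subseteq> lower_bound S"
    unfolding lower_bound_def[of S'] using base(1) by (intro gen_least L) auto
qed

lemma lower_bound_relabel:
  fixes S S' :: "('n::finite, 'p, 'f) seed"
  assumes rel: "seed_relabeling S S'" and B: "exchange_matrix S = 0"
  shows "exchange_matrix S' = 0 \<and> lower_bound S' \<subseteq> lower_bound S"
proof -
  obtain \<sigma> where \<sigma>: "bij \<sigma>" "\<And>i. cluster S' i = cluster S (\<sigma> i)" "\<And>i. coeff_pos S' i = coeff_pos S (\<sigma> i)"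
    "\<And>i. coeff_neg S' i = coeff_neg S (\<sigma> i)" "\<And>i j. exchange_matrix S' $ i $ j = exchange_matrix S $ \<sigma> i $ \<sigma> j"
    using rel unfolding seed_relabeling_def by blast
  have B': "exchange_matrix S' = 0" using \<sigma>(5) B by (simp add: vec_eq_iff)
  have "exchange_rhs \<iota> S' i = exchange_rhs \<iota> S (\<sigma> i)" for i
    unfolding exchange_rhs_UNIV B B' \<sigma> by simp
  then have "seed_dual S' i = seed_dual S (\<sigma> i)" for i by (simp add: seed_dual_def \<sigma>)
  then have "range \<iota> \<union> range (cluster S') \<union> range (seed_dual S') \<subseteq> range \<iota> \<union> range (cluster S) \<union> range (seed_dual S)"
    using \<sigma>(2) by auto
  then have "lower_bound S' \<subseteq> lower_bound S" unfolding lower_bound_def by (rule gen_subset)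
  with B' show ?thesis by blast
qed

text \<open>Seeds with B = 0 are treated apart, as lifts require B \<noteq> 0. For the inclusion of
  the lower bound in the algebra, each partner is a cluster variable of an adjacent seed.\<close>

theorem acyclic_imp_cluster_algebra_eq_lower_bound:
  fixes S :: "('n::finite, 'p, 'f) seed"
  assumes card: "CARD('n) = 3" and S: "is_seed \<iota> S" and sk: "skew_symmetrizable (exchange_matrix S)"
    and acyc: "acyclic_seed S"
  shows "cluster_algebra \<iota> S = lower_bound S"
proof
  have "cluster S' i \<in> lower_bound S" if eq: "mutation_equivalent \<iota> S S'" for S' i
  proof (cases "exchange_matrix S = 0")
    case True
    have "exchange_matrix S' = 0 \<and> lower_bound S' \<subseteq> lower_bound S"
      using eq
    proof (induction rule: mutation_equivalent_induct)
      case base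
      then show ?case using True by simp
    next
      case (mutate S1 S2 k)
      then show ?case using lower_bound_mutate_disconnected by blast
    next
      case (relabel S1 S2)
      then show ?case using lower_bound_relabel by blast
    qed
    moreover have "cluster S' i \<in> lower_bound S'" unfolding lower_bound_def by (auto intro: gen_base)
    ultimately show ?thesis by blast
  next
    case False
    then show ?thesis by (rule cluster_in_lower_bound[OF card S sk acyc _ eq])
  qed
  moreover have "range \<iota> \<subseteq> lower_bound S" unfolding lower_bound_def by (auto intro: gen_base)
  ultimately show "cluster_algebra \<iota> S \<subseteq> lower_bound S"
    unfolding cluster_algebra_def hull_eq_gen
    by (intro gen_least) (auto simp: lower_bound_def intro: is_subring_gen)
  have A: "X \<subseteq> cluster_algebra \<iota> S" if "X \<subseteq> (\<Union>S'\<in>{S'. mutation_equivalent \<iota> S S'}. range (cluster S'))" for X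
    using that unfolding cluster_algebra_def hull_eq_gen by (auto intro: gen_base)
  have "seed_dual S k \<in> cluster_algebra \<iota> S" for k
  proof -
    obtain S' where S': "seed_mutation \<iota> k S S'" using seed_mutation_exists[OF S sk] by blast
    then have "cluster S' k \<in> cluster_algebra \<iota> S"
      using A[of "{cluster S' k}"] mutation_equivalent_mutation by blast
    then show ?thesis using exchange_rhs_mutated(2)[OF S'] by simp
  qed
  moreover have "range (cluster S) \<subseteq> cluster_algebra \<iota> S"
    using mutation_equivalent_refl by (intro A) blast
  moreover have "range \<iota> \<subseteq> cluster_algebra \<iota> S"
    unfolding cluster_algebra_def hull_eq_gen by (auto intro: gen_base)
  ultimately show "lower_bound S \<subseteq> cluster_algebra \<iota> S"
    unfolding lower_bound_def cluster_algebra_def hull_eq_gen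
    by (intro gen_least is_subring_gen) auto
qed

end

theorem theorem1p24:
  fixes \<iota> :: "('p::ab_group_add \<Rightarrow>\<^sub>0 int) \<Rightarrow> 'f::field"
    and S\<^sub>0 :: "('n::finite, 'p, 'f) seed"
  assumes "CARD('n) = 3"
    and "torsion_free TYPE('p)"
    and "ambient_field TYPE('n) \<iota>"
    and "is_seed \<iota> S\<^sub>0"
    and "skew_symmetrizable (exchange_matrix S\<^sub>0)"
  shows "finitely_generated_algebra \<iota> (cluster_algebra \<iota> S\<^sub>0) \<longleftrightarrow>
         (\<exists>S. mutation_equivalent \<iota> S\<^sub>0 S \<and> acyclic_seed S)"
proof
  interpret group_ring_embedded \<iota>
    by unfold_locales (use assms(3) in \<open>simp add: ambient_field_def\<close>)
  show "\<exists>S. mutation_equivalent \<iota> S\<^sub>0 S \<and> acyclic_seed S"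
    if "finitely_generated_algebra \<iota> (cluster_algebra \<iota> S\<^sub>0)"
  proof (rule ccontr)
    assume "\<nexists>S. mutation_equivalent \<iota> S\<^sub>0 S \<and> acyclic_seed S"
    then have "\<not> finitely_generated_algebra \<iota> (cluster_algebra \<iota> S\<^sub>0)"
      by (intro no_acyclic_seed_imp_not_finitely_generated[OF assms(1,4,5)]) blast
    then show False using that by contradiction
  qed
  assume "\<exists>S. mutation_equivalent \<iota> S\<^sub>0 S \<and> acyclic_seed S"
  then obtain S where S: "mutation_equivalent \<iota> S\<^sub>0 S" "acyclic_seed S" by blast
  have "cluster_algebra \<iota> S\<^sub>0 = lower_bound S"
    using cluster_algebra_cong[OF S(1)] equivalent_seed[OF S(1) assms(4,5)] S(2)
      acyclic_imp_cluster_algebra_eq_lower_bound[OF assms(1)] by simp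
  also have "lower_bound S = is_subalgebra \<iota> hull (range (cluster S) \<union> range (seed_dual S))"
    by (simp add: lower_bound_def hull_eq_gen Un_assoc)
  finally have eq: "cluster_algebra \<iota> S\<^sub>0 = is_subalgebra \<iota> hull (range (cluster S) \<union> range (seed_dual S))" .
  show "finitely_generated_algebra \<iota> (cluster_algebra \<iota> S\<^sub>0)"
    unfolding finitely_generated_algebra_def
  proof (intro exI conjI)
    show "finite (range (cluster S) \<union> range (seed_dual S))" by simp
  qed (rule eq)
qed

end
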